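(* Let $n\to\infty$. For each edge $e$ of the complete graph $K_n$ let $W_e$ (weight) and $C_e$ (cost) be random variables, all $2\binom n2$ of them independent and uniform on $[0,1]$. For a spanning tree $T$ put $W(T)=\sum_{e\in T}W_e$, $C(T)=\sum_{e\in T}C_e$, and let $W^*=W^*(c_0)$ be the minimum of $W(T)$ over spanning trees $T$ of $K_n$ with $C(T)\le c_0$ (where $c_0$ may depend on $n$). Define $$c_1=\frac{1}{\sqrt2}\sum_{k=1}^\infty\frac{1}{k^{3/2}}\frac{\Gamma(k-\tfrac12)}{k!},\qquad f(\beta)=\sum_{k=1}^\infty\frac{k^{k-2}}{k!}\Big(\beta^{1/2}\int_0^\beta x^{k-3/2}e^{-kx}\,dx+\int_\beta^\infty x^{k-1}e^{-kx}\,dx\Big),\ \beta\ge0.$$ Then the following hold with high probability: (1) If $c_0\in\big[c_1(500\log n)^{1/2},\ c_1 n/(8000\log n)^{1/2}\big]$, then $W^*\approx \frac{c_1^2 n}{4c_0}$. (2) Suppose $c_0=\alpha n$ where $\alpha=O(1)$ is a positive constant. (i) If $\alpha>1/2$ then $W^*\approx\zeta(3)=\sum_{k\ge1}k^{-3}$. (ii) If $0<\alpha\le 1/2$ and $\beta^*=\beta^*(\alpha)$ is the solution of $f'(\beta)=2\alpha$, then $W^*\approx f(\beta^* )-2\alpha\beta^*$. (3) Suppose $c_0=\alpha$ where $\alpha=O(1)$ is a positive constant. (i) If $\alpha<\zeta(3)$ then there is no spanning tree $T$ with $C(T)\le c_0$. (ii) If $\alpha>\zeta(3)$ and $\beta^*=\beta^*(\alpha)$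 is the solution of $f(\beta)-\beta f'(\beta)=\alpha$, then $W^*\approx\frac{f(\beta^* )-\alpha}{2\beta^*}\,n$.
   Context: "With high probability" means with probability tending to $1$ as $n\to\infty$. $A\approx B$ means $A=(1+o(1))B$ as $n\to\infty$. $\Gamma$ is the gamma function and $\zeta$ the Riemann zeta function. *)

theory Defs
  imports "HOL-Probability.Probability"
begin

definition complete_edges :: "nat \<Rightarrow> nat set set" where
  "complete_edges n = {e. e \<subseteq> {..<n} \<and> card e = 2}"

definition connected_graph :: "'v set \<Rightarrow> 'v set set \<Rightarrow> bool" where
  "connected_graph V E \<longleftrightarrow> (\<forall>u\<in>V. \<forall>v\<in>V. (u, v) \<in> {(x, y). {x, y} \<in> E}\<^sup>*)"

definition graph_cycle :: "'v set set \<Rightarrow> 'v list \<Rightarrow> bool" where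
  "graph_cycle E vs \<longleftrightarrow> length vs \<ge> 3 \<and> distinct vs \<and>
     (\<forall>i<length vs. {vs ! i, vs ! (Suc i mod length vs)} \<in> E)"

definition spanning_trees :: "nat \<Rightarrow> nat set set set" where
  "spanning_trees n =
     {T. T \<subseteq> complete_edges n \<and> connected_graph {..<n} T \<and> (\<nexists>vs. graph_cycle T vs)}"

(* The infimum ranges over a finite set: it is the minimum if a feasible tree exists
   and \<infinity> otherwise. *)
definition min_weight :: "nat \<Rightarrow> (nat set \<Rightarrow> real) \<Rightarrow> (nat set \<Rightarrow> real) \<Rightarrow> real \<Rightarrow> ereal" where
  "min_weight n w c c0 =
     (INF T \<in> {T \<in> spanning_trees n. (\<Sum>e\<in>T. c e) \<le> c0}. ereal (\<Sum>e\<in>T. w e))"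

definition whp :: "(nat \<Rightarrow> 'a measure) \<Rightarrow> (nat \<Rightarrow> 'a \<Rightarrow> bool) \<Rightarrow> bool" where
  "whp M P \<longleftrightarrow> (\<lambda>n. \<P>(\<omega> in M n. P n \<omega>)) \<longlonglongrightarrow> 1"

(* With high probability, X n = (1 + o(1)) * b n; in particular X n is then finite. *)
definition whp_approx ::
    "(nat \<Rightarrow> 'a measure) \<Rightarrow> (nat \<Rightarrow> 'a \<Rightarrow> ereal) \<Rightarrow> (nat \<Rightarrow> real) \<Rightarrow> bool" where
  "whp_approx M X b \<longleftrightarrow>
     (\<exists>\<delta> :: nat \<Rightarrow> real. \<delta> \<longlonglongrightarrow> 0 \<and>
        whp M (\<lambda>n \<omega>. \<exists>\<eta>. \<bar>\<eta>\<bar> \<le> \<delta> n \<and> X n \<omega> = ereal ((1 + \<eta>) * b n)))"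

definition c1 :: real where
  "c1 = 1 / sqrt 2 *
     (\<Sum>\<^sub>\<infinity>k\<in>{1::nat..}. 1 / real k powr (3/2) * (Gamma (real k - 1/2) / fact k))"

definition zeta3 :: real where
  "zeta3 = (\<Sum>\<^sub>\<infinity>k\<in>{1::nat..}. 1 / real k ^ 3)"

definition f :: "real \<Rightarrow> real" where
  "f \<beta> = (\<Sum>\<^sub>\<infinity>k\<in>{1::nat..}. real k powi (int k - 2) / fact k *
     (sqrt \<beta> * (LBINT x:{0..\<beta>}. x powr (real k - 3/2) * exp (- real k * x)) +
      (LBINT x:{\<beta>..}. x ^ (k - 1) * exp (- real k * x))))"

(* f is considered on [0,\<infinity>) only, so its derivative at 0 is one-sided. *)
definition f_deriv :: "real \<Rightarrow> real \<Rightarrow> bool" where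
  "f_deriv \<beta> d \<longleftrightarrow> \<beta> \<ge> 0 \<and> (f has_real_derivative d) (at \<beta> within {0..})"

end

(*
For a multiplier b >= 0 let m(b) be the minimum of W(T) + b C(T) over spanning trees T. By Kruskal,
m(b) is the integral over t >= 0 of kappa(G_t) - 1, where kappa counts components and G_t consists of
the edges with W_e + b C_e <= t. G_t is a random graph G(n, p(t)) with an explicit p(t).

Exploring a component vertex by vertex shows that in G(n, x/n) the size of the component of a vertex
converges to the Borel distribution, so E kappa / n tends to
  K(x) = sum_{k >= 1} k^(k-2) x^(k-1) e^(-kx) / k!,
without counting trees. The same exploration shows that the excess (E kappa - 1) / n is O(e^(-x/6))
uniformly in n, and by the Efron-Stein inequality Var kappa is O(xn). Hence m(b) concentrates, after
dominated convergence, around an integral of K: this gives f(beta) for b = 2 beta / n, zeta(3) for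
beta = 0, and c1 sqrt(b n) in the intermediate range of (1).

No integrality gap has to be estimated: m is concave, and the cost of a tree that is optimal for b lies
between the one-sided slopes of m at b. Taking b slightly above the optimal multiplier therefore
gives a feasible tree whose weight is asymptotically equal to the dual lower bound m(b) - b c0.
For (3) the roles of W and C are exchanged, which replaces f(beta) by its perspective g f(1/g).
*)
theory Submission
  imports Defs
begin

section \<open>Components and minimum spanning trees\<close>

text \<open>The limit of the dual function is needed only at four fixed multipliers: the optimal
  \<open>\<rho>\<close> and three points above it, spaced by a small constant
  \<open>\<delta>\<close>. Concavity replaces uniformity in b, and the strict decrease of the
  limiting slope leaves room for random errors in the feasibility test. The obstacle is the range of
  levels t: convergence at each fixed level does not control the integral, since the levels that
  matter extend up to connectivity, where x has grown to order log n. One estimate does both jobs.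
  The bound O(exp (-x/6)) is uniform in n, hence an integrable majorant; and at x = 12 log n it is
  of order 1/n^2, so that the graph is connected with probability at least 1 - 1/n and the integral
  can be cut there without error. After scaling, all cases have lengths W/a + \<beta> C/d and a
  deterministic limit \<phi>(\<beta>). For (1) this is 2 sqrt \<beta>, and 2 sqrt \<beta> - \<beta>
  has its maximum 1 at \<beta> = 1, which is why (1) contains no equation for \<beta>.\<close>

definition adj :: "'v set set \<Rightarrow> ('v \<times> 'v) set" where
  "adj E = {(x, y). {x, y} \<in> E}"

definition gcomp :: "'v set set \<Rightarrow> 'v \<Rightarrow> 'v set" where
  "gcomp E v = (adj E)\<^sup>* `` {v}"

definition ncomp :: "'v set \<Rightarrow> 'v set set \<Rightarrow> nat" where
  "ncomp V E = card (gcomp E ` V)"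

lemma adj_iff [simp]: "(x, y) \<in> adj E \<longleftrightarrow> {x, y} \<in> E"
  by (simp add: adj_def)

lemma comp_refl [simp]: "v \<in> gcomp E v"
  by (simp add: gcomp_def)

lemma comp_step: "u \<in> gcomp E v \<Longrightarrow> {u, w} \<in> E \<Longrightarrow> w \<in> gcomp E v"
  unfolding gcomp_def by (auto intro: rtrancl_into_rtrancl)

lemma sym_adj: "sym (adj E)"
  by (auto simp: sym_def insert_commute)

lemma comp_sym: "u \<in> gcomp E v \<longleftrightarrow> v \<in> gcomp E u"
  using sym_rtrancl[OF sym_adj, of E] unfolding gcomp_def by (auto simp: sym_def)

lemma comp_eqI: "u \<in> gcomp E v \<Longrightarrow> gcomp E u = gcomp E v"
proof -
  assume "u \<in> gcomp E v"
  hence "(v, u) \<in> (adj E)\<^sup>*" "(u, v) \<in> (adj E)\<^sup>*"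
    using comp_sym[of u E v] by (auto simp: gcomp_def)
  thus ?thesis by (auto simp: gcomp_def intro: rtrancl_trans[of u v] rtrancl_trans[of v u])
qed

lemma comp_eq_iff: "gcomp E u = gcomp E v \<longleftrightarrow> u \<in> gcomp E v"
  using comp_eqI comp_refl by metis

lemma comp_least:
  assumes "v \<in> S" and "\<And>x y. x \<in> S \<Longrightarrow> {x, y} \<in> E \<Longrightarrow> y \<in> S"
  shows "gcomp E v \<subseteq> S"
proof
  fix u assume "u \<in> gcomp E v"
  hence "(v, u) \<in> (adj E)\<^sup>*" by (simp add: gcomp_def)
  thus "u \<in> S" by induction (use assms in auto)
qed

lemma comp_mono: "E \<subseteq> E' \<Longrightarrow> gcomp E v \<subseteq> gcomp E' v"
  by (rule comp_least) (auto intro: comp_step)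

text \<open>The new edge merges the two components that it meets and leaves all others alone. The
  case of \<open>u\<close> and \<open>v\<close> in one component is included, the union then being
  that component.\<close>

lemma comp_insert:
  "gcomp (insert {u, v} E) w =
     (if w \<in> gcomp E u \<union> gcomp E v then gcomp E u \<union> gcomp E v else gcomp E w)"
proof -
  let ?E = "insert {u, v} E"
  have uv: "v \<in> gcomp ?E u" by (rule comp_step[OF comp_refl]) auto
  have eq: "gcomp ?E u = gcomp ?E v" using comp_eqI[OF uv] by simp
  have sub: "gcomp E x \<subseteq> gcomp ?E x" for x by (rule comp_mono) auto
  show ?thesis
  proof (cases "w \<in> gcomp E u \<union> gcomp E v")
    case True
    have "w \<in> gcomp ?E u" using True sub[of u] sub[of v] eq by auto
    hence "gcomp ?E w = gcomp ?E u" by (rule comp_eqI)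
    hence "gcomp E u \<union> gcomp E v \<subseteq> gcomp ?E w" using sub[of u] sub[of v] eq by auto
    moreover have "gcomp ?E w \<subseteq> gcomp E u \<union> gcomp E v"
      by (rule comp_least)
        (use True in \<open>auto simp: doubleton_eq_iff intro: comp_step[of _ E u] comp_step[of _ E v]\<close>)
    ultimately show ?thesis using True by auto
  next
    case False
    have "gcomp ?E w \<subseteq> gcomp E w"
    proof (rule comp_least)
      fix x y assume xy: "x \<in> gcomp E w" "{x, y} \<in> ?E"
      have "x \<noteq> u" "x \<noteq> v" using False xy(1) comp_sym[of w E] by auto
      hence "{x, y} \<in> E" using xy(2) by (auto simp: doubleton_eq_iff)
      thus "y \<in> gcomp E w" using xy(1) comp_step by fast
    qed auto
    thus ?thesis using False sub[of w] by auto
  qed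
qed

text \<open>Either nothing changes or two members of the family of components are replaced by their
  union. The second claim turns the subtraction of naturals into a genuine decrease by one.\<close>

lemma ncomp_insert:
  assumes "finite V" "u \<in> V" "v \<in> V"
  shows "ncomp V (insert {u, v} E) = (if v \<in> gcomp E u then ncomp V E else ncomp V E - 1)"
    and "v \<notin> gcomp E u \<Longrightarrow> ncomp V E \<ge> 2"
proof -
  let ?E = "insert {u, v} E"
  have *: "ncomp V ?E = ncomp V E - 1 \<and> ncomp V E \<ge> 2" if "v \<notin> gcomp E u"
  proof -
    let ?C = "gcomp E u \<union> gcomp E v"
    let ?R = "gcomp E ` V - {gcomp E u, gcomp E v}"
    have ne: "gcomp E u \<noteq> gcomp E v" using that comp_refl[of v E] by auto
    have img: "gcomp ?E ` V = insert ?C ?R"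
    proof
      show "gcomp ?E ` V \<subseteq> insert ?C ?R"
      proof
        fix X assume "X \<in> gcomp ?E ` V"
        then obtain w where w: "w \<in> V" "X = gcomp ?E w" by blast
        show "X \<in> insert ?C ?R"
        proof (cases "w \<in> ?C")
          case False
          hence "gcomp E w \<noteq> gcomp E u" "gcomp E w \<noteq> gcomp E v" using comp_refl[of w E] by fast+
          thus ?thesis using w False by (simp add: comp_insert)
        qed (simp add: w(2) comp_insert)
      qed
      show "insert ?C ?R \<subseteq> gcomp ?E ` V"
      proof
        fix X assume "X \<in> insert ?C ?R"
        thus "X \<in> gcomp ?E ` V"
        proof
          assume "X = ?C"
          hence "X = gcomp ?E u" unfolding comp_insert by auto
          thus ?thesis using assms by auto
        next
          assume "X \<in> ?R"
          then obtain w where w: "w \<in> V" "X = gcomp E w" "gcomp E w \<noteq> gcomp E u" "gcomp E w \<noteq> gcomp E v" by auto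
          hence "w \<notin> ?C" using comp_eqI by fast
          hence "X = gcomp ?E w" unfolding comp_insert w(2) by auto
          thus ?thesis using w by auto
        qed
      qed
    qed
    have notin: "?C \<notin> ?R"
    proof
      assume "?C \<in> ?R"
      then obtain w where w: "w \<in> V" "?C = gcomp E w" "gcomp E w \<noteq> gcomp E u" by auto
      have "u \<in> ?C" by simp
      hence "u \<in> gcomp E w" by (simp only: w(2))
      thus False using comp_eqI[of u E w] w(3) by auto
    qed
    have two: "card {gcomp E u, gcomp E v} = 2" using ne by simp
    have sub: "{gcomp E u, gcomp E v} \<subseteq> gcomp E ` V" using assms by auto
    have "card ?R = ncomp V E - 2" unfolding ncomp_def
      by (subst card_Diff_subset) (use sub two in auto)
    moreover have ge: "ncomp V E \<ge> 2" unfolding ncomp_def two[symmetric]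
      by (rule card_mono) (use sub assms in auto)
    moreover have "ncomp V ?E = Suc (card ?R)" unfolding ncomp_def img
      by (subst card_insert_disjoint) (use notin assms in auto)
    ultimately show ?thesis by auto
  qed
  have "gcomp ?E ` V = gcomp E ` V" if "v \<in> gcomp E u"
  proof (intro image_cong refl)
    fix w
    show "gcomp ?E w = gcomp E w"
      using comp_eqI[OF that] comp_eqI[of w E u] comp_insert[of u v E w] by simp
  qed
  thus "ncomp V ?E = (if v \<in> gcomp E u then ncomp V E else ncomp V E - 1)"
    using * by (auto simp: ncomp_def)
  show "v \<notin> gcomp E u \<Longrightarrow> ncomp V E \<ge> 2" using * by simp
qed

lemma complete_edgesE:
  assumes "e \<in> complete_edges n"
  obtains u v where "e = {u, v}" "u \<noteq> v" "u < n" "v < n"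
  using assms unfolding complete_edges_def by (auto simp: card_2_iff)

lemma finite_complete_edges [simp]: "finite (complete_edges n)"
  by (rule finite_subset[of _ "Pow {..<n}"]) (auto simp: complete_edges_def)

lemma ncomp_insert_le:
  assumes "e \<in> complete_edges n"
  shows "ncomp {..<n} (insert e E) \<le> ncomp {..<n} E"
    and "ncomp {..<n} E \<le> ncomp {..<n} (insert e E) + 1"
proof -
  obtain u v where "e = {u, v}" "u \<in> {..<n}" "v \<in> {..<n}"
    using assms by (elim complete_edgesE) auto
  thus "ncomp {..<n} (insert e E) \<le> ncomp {..<n} E"
    and "ncomp {..<n} E \<le> ncomp {..<n} (insert e E) + 1"
    using ncomp_insert(1)[of "{..<n}" u v E] by auto
qed

lemma ncomp_Un:
  assumes "finite D" "D \<subseteq> complete_edges n"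
  shows "ncomp {..<n} (E \<union> D) \<le> ncomp {..<n} E \<and> ncomp {..<n} E \<le> ncomp {..<n} (E \<union> D) + card D"
  using assms
proof (induction D)
  case (insert e D)
  thus ?case using ncomp_insert_le[of e n "E \<union> D"] by auto
qed simp

lemma ncomp_mono:
  assumes "E \<subseteq> E'" "E' \<subseteq> complete_edges n"
  shows "ncomp {..<n} E' \<le> ncomp {..<n} E"
proof -
  have "finite E'" using assms(2) by (rule finite_subset) simp
  thus ?thesis using ncomp_Un[of "E' - E" n E] assms by (auto simp: Un_absorb1)
qed

lemma comp_empty [simp]: "gcomp {} v = {v}"
  using comp_least[of v "{v}" "{}"] by auto

lemma ncomp_empty [simp]: "ncomp V {} = card V"
  unfolding ncomp_def by (subst card_image) (auto simp: inj_on_def)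

lemma ncomp_le: "E \<subseteq> complete_edges n \<Longrightarrow> ncomp {..<n} E \<le> n"
  using ncomp_mono[of "{}" E n] by simp

lemma ncomp_pos:
  fixes n :: nat
  assumes "n > 0"
  shows "ncomp {..<n} E \<ge> 1"
proof -
  have "gcomp E ` {..<n} \<noteq> {}" "finite (gcomp E ` {..<n})" using assms by auto
  thus ?thesis unfolding ncomp_def by (metis One_nat_def Suc_leI card_gt_0_iff)
qed

lemma connected_graph_comp: "connected_graph V E \<longleftrightarrow> (\<forall>u\<in>V. \<forall>v\<in>V. v \<in> gcomp E u)"
  by (simp add: connected_graph_def gcomp_def adj_def)

lemma connected_iff_ncomp:
  fixes n :: nat
  assumes "n > 0"
  shows "connected_graph {..<n} E \<longleftrightarrow> ncomp {..<n} E = 1"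
proof
  assume "connected_graph {..<n} E"
  hence con: "gcomp E v = gcomp E 0" if "v < n" for v
    using assms that by (intro comp_eqI) (auto simp: connected_graph_comp)
  have "gcomp E ` {..<n} = (\<lambda>_. gcomp E 0) ` {..<n}"
    by (intro image_cong refl con) simp
  also have "\<dots> = {gcomp E 0}" using assms by auto
  finally have "gcomp E ` {..<n} = {gcomp E 0}" .
  thus "ncomp {..<n} E = 1" by (simp add: ncomp_def)
next
  assume "ncomp {..<n} E = 1"
  then obtain C where C: "gcomp E ` {..<n} = {C}" by (auto simp: ncomp_def card_1_singleton_iff)
  show "connected_graph {..<n} E" unfolding connected_graph_comp
  proof (intro ballI)
    fix u v assume "u \<in> {..<n}" "v \<in> {..<n}"
    hence "gcomp E u \<in> {C}" "gcomp E v \<in> {C}" unfolding C[symmetric] by blast+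
    hence "gcomp E u = gcomp E v" by simp
    thus "v \<in> gcomp E u" using comp_refl[of v E] by auto
  qed
qed

text \<open>A cycle that is not already in \<open>E\<close> uses the edge \<open>{u, v}\<close>
  exactly once; the rest of it is a walk in \<open>E\<close> between the two ends. Hence an edge
  between different components keeps a forest acyclic.\<close>

lemma graph_cycle_insert:
  assumes "graph_cycle (insert {u, v} E) vs" "\<not> graph_cycle E vs"
  shows "v \<in> gcomp E u"
proof -
  let ?l = "length vs"
  have l: "?l \<ge> 3" and d: "distinct vs"
    and ed: "\<And>i. i < ?l \<Longrightarrow> {vs ! i, vs ! (Suc i mod ?l)} \<in> insert {u, v} E"
    using assms(1) by (auto simp: graph_cycle_def)
  obtain i where i: "i < ?l" "{vs ! i, vs ! (Suc i mod ?l)} \<notin> E"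
    using assms(2) l d by (auto simp: graph_cycle_def)
  have iuv: "{vs ! i, vs ! (Suc i mod ?l)} = {u, v}" using ed i by auto
  have nth_inj: "vs ! a = vs ! b \<longleftrightarrow> a = b" if "a < ?l" "b < ?l" for a b
    using that d by (simp add: nth_eq_iff_index_eq)
  have ml: "Suc a mod ?l < ?l" for a using l by (intro mod_less_divisor) linarith
  \<comment> \<open>A second position with the same pair would make \<open>i\<close> and
    \<open>j\<close> successors of each other modulo the length, which a length of at least 3 rules
    out.\<close>
  have other: "{vs ! j, vs ! (Suc j mod ?l)} \<in> E" if j: "j < ?l" "j \<noteq> i" for j
  proof (rule ccontr)
    assume "{vs ! j, vs ! (Suc j mod ?l)} \<notin> E"
    hence "{vs ! j, vs ! (Suc j mod ?l)} = {vs ! i, vs ! (Suc i mod ?l)}" using ed j iuv by auto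
    hence "j = Suc i mod ?l \<and> Suc j mod ?l = i"
      unfolding doubleton_eq_iff
      using nth_inj[OF j(1) i(1)] nth_inj[OF j(1) ml] nth_inj[OF ml i(1)] j(2) by blast
    thus False using l i j by (auto simp: mod_Suc split: if_splits)
  qed
  \<comment> \<open>The walk starts just after position \<open>i\<close> and takes
    \<open>?l - 1\<close> steps, none along the edge at \<open>i\<close>, so it arrives at
    \<open>i\<close> from the other side.\<close>
  let ?s = "\<lambda>m. vs ! ((Suc i + m) mod ?l)"
  have walk: "?s m \<in> gcomp E (?s 0)" if "m < ?l" for m
    using that
  proof (induction m)
    case (Suc m)
    let ?j = "(Suc i + m) mod ?l"
    have "?j \<noteq> i"
    proof
      assume "?j = i"
      hence *: "(i + Suc m) mod ?l = i" by simp
      show False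
      proof (cases "i + Suc m < ?l")
        case False
        hence "(i + Suc m) mod ?l = (i + Suc m - ?l) mod ?l" by (simp add: le_mod_geq)
        also have "\<dots> = i + Suc m - ?l" using i Suc.prems by (intro mod_less) simp
        finally show False using * i Suc.prems False by simp
      qed (use * in simp)
    qed
    hence "{vs ! ?j, vs ! (Suc ?j mod ?l)} \<in> E" by (intro other) (use ml[of "i + m"] in auto)
    moreover have "Suc ?j mod ?l = (Suc i + Suc m) mod ?l" by (simp add: mod_Suc_eq)
    ultimately show ?case using Suc comp_step by (metis Suc_lessD)
  qed simp
  have "Suc i + (?l - 1) = i + ?l" using l by simp
  hence "(Suc i + (?l - 1)) mod ?l = i" using i by simp
  hence "vs ! i \<in> gcomp E (vs ! (Suc i mod ?l))" using walk[of "?l - 1"] l by auto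
  thus ?thesis using iuv comp_sym[of u E v] by (auto simp: doubleton_eq_iff)
qed

text \<open>Kruskal's algorithm, run on the list of edges sorted by length.\<close>
lemma kruskal_list:
  fixes X :: "nat set \<Rightarrow> real"
  assumes "sorted (map X xs)" "distinct xs" "set xs \<subseteq> complete_edges n"
  shows "\<exists>F\<subseteq>set xs. (\<nexists>vs. graph_cycle F vs) \<and> (\<forall>v. gcomp F v = gcomp (set xs) v) \<and>
           (\<forall>t. card {e\<in>F. X e \<le> t} + ncomp {..<n} {e\<in>set xs. X e \<le> t} = n)"
  using assms
proof (induction xs rule: rev_induct)
  case Nil
  have "\<not> graph_cycle {} vs" for vs :: "nat list"
    by (cases vs) (auto simp: graph_cycle_def)
  thus ?case by (intro exI[of _ "{}"]) auto
next
  case (snoc e xs)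
  obtain F where F: "F \<subseteq> set xs" "\<nexists>vs. graph_cycle F vs" "\<And>v. gcomp F v = gcomp (set xs) v"
    "\<And>t. card {e\<in>F. X e \<le> t} + ncomp {..<n} {e\<in>set xs. X e \<le> t} = n"
    using snoc by (auto simp: sorted_append)
  obtain u v where e: "e = {u, v}" "u \<in> {..<n}" "v \<in> {..<n}"
    using snoc.prems(3) by (auto elim: complete_edgesE)
  have le: "X e' \<le> X e" if "e' \<in> set xs" for e' using snoc.prems(1) that by (auto simp: sorted_append)
  have enew: "e \<notin> set xs" using snoc.prems(2) by auto
  \<comment> \<open>\<open>e\<close> is the longest edge so far: a level below \<open>X e\<close>
    does not see it, and any other level already contains the whole list. So only two kinds of level
    have to be checked.\<close>
  have low: "{e'\<in>set (xs @ [e]). X e' \<le> t} = {e'\<in>set xs. X e' \<le> t}" if "\<not> X e \<le> t" for t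
    using that by auto
  have high: "{e'\<in>set (xs @ [e]). X e' \<le> t} = insert {u, v} (set xs)" "{e'\<in>set xs. X e' \<le> t} = set xs"
    if "X e \<le> t" for t using that le e by (auto intro: order_trans)
  show ?case
  proof (cases "v \<in> gcomp (set xs) u")
    case True
    have nc: "ncomp {..<n} (insert {u, v} (set xs)) = ncomp {..<n} (set xs)"
      using ncomp_insert(1)[of "{..<n}" u v "set xs"] True e by auto
    have "gcomp (insert {u, v} (set xs)) w = gcomp (set xs) w" for w
      using comp_eqI[OF True] comp_eqI[of w "set xs" u] comp_insert[of u v "set xs" w] by simp
    moreover have "card {e'\<in>F. X e' \<le> t} + ncomp {..<n} {e'\<in>set (xs @ [e]). X e' \<le> t} = n" for t
    proof (cases "X e \<le> t")
      case True
      show ?thesis using F(4)[of t] unfolding high[OF True] nc .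
    next
      case False
      show ?thesis using F(4)[of t] unfolding low[OF False] .
    qed
    ultimately show ?thesis using F e by (intro exI[of _ F]) auto
  next
    case False
    have nc: "ncomp {..<n} (insert {u, v} (set xs)) = ncomp {..<n} (set xs) - 1" "ncomp {..<n} (set xs) \<ge> 2"
      using ncomp_insert[of "{..<n}" u v "set xs"] False e by auto
    have "\<nexists>vs. graph_cycle (insert e F) vs"
      using graph_cycle_insert[of u v F] F False e by auto
    moreover have "gcomp (insert e F) w = gcomp (set (xs @ [e])) w" for w
      using comp_insert[of u v F w] comp_insert[of u v "set xs" w] F e by simp
    moreover have "card {e'\<in>insert e F. X e' \<le> t} + ncomp {..<n} {e'\<in>set (xs @ [e]). X e' \<le> t} = n" for t
    proof (cases "X e \<le> t")
      case True
      have "{e'\<in>F. X e' \<le> t} = F" using high(2)[OF True] F(1) by auto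
      moreover have "{e'\<in>insert e F. X e' \<le> t} = insert e F" using high(2)[OF True] F(1) True by auto
      moreover have "e \<notin> F" "finite F" using F(1) enew finite_subset by auto
      ultimately show ?thesis using F(4)[of t] nc unfolding high[OF True] by simp
    next
      case False
      have "{e'\<in>insert e F. X e' \<le> t} = {e'\<in>F. X e' \<le> t}" using False by auto
      thus ?thesis using F(4)[of t] unfolding low[OF False] by simp
    qed
    ultimately show ?thesis using F by (intro exI[of _ "insert e F"]) auto
  qed
qed

section \<open>Level graphs and the layer-cake formula for tree lengths\<close>

definition level_graph :: "nat \<Rightarrow> (nat set \<Rightarrow> real) \<Rightarrow> real \<Rightarrow> nat set set" where
  "level_graph n X t = {e \<in> complete_edges n. X e \<le> t}"

lemma level_graph_subset: "level_graph n X t \<subseteq> complete_edges n"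
  by (auto simp: level_graph_def)

lemma connected_complete: "connected_graph {..<n} (complete_edges n)"
  unfolding connected_graph_comp
proof (intro ballI)
  fix u v assume "u \<in> {..<n}" "v \<in> {..<n}"
  thus "v \<in> gcomp (complete_edges n) u"
    by (cases "u = v") (auto intro!: comp_step[OF comp_refl] simp: complete_edges_def)
qed

text \<open>One tree attains the bound of \<open>ncomp_level_le_tree\<close> at all levels
  \<open>t\<close> simultaneously. This is stronger than minimal total length and makes the integral
  over the levels exact.\<close>

lemma kruskal:
  assumes "n > 0"
  shows "\<exists>T\<in>spanning_trees n. \<forall>t. card {e\<in>T. X e > t} + 1 = ncomp {..<n} (level_graph n X t)"
proof -
  obtain xs where xs: "set xs = complete_edges n" "distinct xs"
    using finite_distinct_list[OF finite_complete_edges] by blast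
  have "set (sort_key X xs) = complete_edges n" using xs by simp
  then obtain F where F: "F \<subseteq> complete_edges n" "\<nexists>vs. graph_cycle F vs"
    "\<And>v. gcomp F v = gcomp (complete_edges n) v"
    "\<And>t. card {e\<in>F. X e \<le> t} + ncomp {..<n} (level_graph n X t) = n"
    using kruskal_list[of X "sort_key X xs" n] xs by (auto simp: level_graph_def)
  have con: "connected_graph {..<n} F"
    using connected_complete F(3) by (simp add: connected_graph_comp)
  have fin: "finite F" using F(1) by (rule finite_subset) simp
  \<comment> \<open>A level above all lengths, where the count of \<open>F\<close> becomes
    \<open>card F + 1 = n\<close>. The inserted 0 keeps the maximum defined when there is no
    edge.\<close>
  define t1 where "t1 = Max (insert 0 (X ` complete_edges n))"
  have "X e \<le> t1" if "e \<in> complete_edges n" for e unfolding t1_def using that by (intro Max_ge) auto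
  hence "{e\<in>F. X e \<le> t1} = F" "level_graph n X t1 = complete_edges n"
    using F(1) by (auto simp: level_graph_def)
  hence cardF: "card F + 1 = n" using F(4)[of t1] connected_complete[of n] connected_iff_ncomp[OF assms] by simp
  have cards: "card {e\<in>F. X e > t} + card {e\<in>F. X e \<le> t} = card F" for t
  proof -
    have "card F = card ({e\<in>F. X e > t} \<union> {e\<in>F. X e \<le> t})" by (rule arg_cong[where f = card]) auto
    also have "\<dots> = card {e\<in>F. X e > t} + card {e\<in>F. X e \<le> t}"
      by (rule card_Un_disjoint) (use fin in auto)
    finally show ?thesis by simp
  qed
  hence "card {e\<in>F. X e > t} + 1 = ncomp {..<n} (level_graph n X t)" for t
    using F(4)[of t] cardF cards[of t] by linarith
  moreover have "F \<in> spanning_trees n" using F(1,2) con by (simp add: spanning_trees_def)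
  ultimately show ?thesis by blast
qed

text \<open>The short tree edges lie in the level graph, and the long ones complete them to a
  connected graph, each lowering the number of components by at most one.\<close>

lemma ncomp_level_le_tree:
  assumes "n > 0" "T \<in> spanning_trees n"
  shows "ncomp {..<n} (level_graph n X t) \<le> card {e\<in>T. X e > t} + 1"
proof -
  let ?L = "{e\<in>T. X e \<le> t}"
  have T: "T \<subseteq> complete_edges n" "ncomp {..<n} T = 1" "finite T"
    using assms connected_iff_ncomp finite_subset[OF _ finite_complete_edges]
    by (auto simp: spanning_trees_def)
  have "ncomp {..<n} (level_graph n X t) \<le> ncomp {..<n} ?L"
    by (rule ncomp_mono) (use T in \<open>auto simp: level_graph_def\<close>)
  also have "\<dots> \<le> ncomp {..<n} (?L \<union> {e\<in>T. X e > t}) + card {e\<in>T. X e > t}"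
    using ncomp_Un[of "{e\<in>T. X e > t}" n ?L] T by auto
  also have "?L \<union> {e\<in>T. X e > t} = T" by auto
  finally show ?thesis using T by simp
qed

text \<open>For nonnegative lengths this is the sum of \<open>min (X e) \<tau>\<close> over a
  Kruskal tree, hence a lower bound for every spanning tree and the minimum itself once the graph at
  level \<open>\<tau>\<close> is connected.\<close>

definition excess_integral :: "nat \<Rightarrow> (nat set \<Rightarrow> real) \<Rightarrow> real \<Rightarrow> real" where
  "excess_integral n X \<tau> = (LBINT t:{0..\<tau>}. real (ncomp {..<n} (level_graph n X t)) - 1)"

lemma tree_layer_cake:
  assumes "finite T" "\<And>e. e \<in> T \<Longrightarrow> X e \<ge> 0" "\<tau> \<ge> (0::real)"
  shows "(LBINT t:{0..\<tau>}. real (card {e\<in>T. X e > t})) = (\<Sum>e\<in>T. min (X e) \<tau>)"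
    and "set_integrable lborel {0..\<tau>} (\<lambda>t. real (card {e\<in>T. X e > t}))"
proof -
  have card: "real (card {e\<in>T. X e > t}) = (\<Sum>e\<in>T. indicator {..<X e} t)" for t
  proof -
    have "(\<Sum>e\<in>T. indicator {..<X e} t :: real) = (\<Sum>e\<in>T. if X e > t then 1 else 0)"
      by (intro sum.cong) (auto simp: indicator_def)
    thus ?thesis using assms(1) by (simp add: sum.If_cases Int_def)
  qed
  have eq: "indicator {0..\<tau>} t *\<^sub>R real (card {e\<in>T. X e > t}) = (\<Sum>e\<in>T. indicator ({0..\<tau>} \<inter> {..<X e}) t)" for t :: real
    unfolding card by (simp add: sum_distrib_left indicator_inter_arith)
  have int: "integrable lborel (indicator ({0..\<tau>} \<inter> {..<X e}) :: real \<Rightarrow> real)" for e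
  proof (rule integrable_real_indicator)
    have "emeasure lborel ({0..\<tau>} \<inter> {..<X e}) \<le> emeasure lborel {0..\<tau>}"
      by (rule emeasure_mono) auto
    also have "\<dots> < \<infinity>" using assms(3) by simp
    finally show "emeasure lborel ({0..\<tau>} \<inter> {..<X e}) < \<infinity>" .
  qed auto
  show "set_integrable lborel {0..\<tau>} (\<lambda>t. real (card {e\<in>T. X e > t}))"
    unfolding set_integrable_def eq by (intro Bochner_Integration.integrable_sum int)
  have "measure lborel ({0..\<tau>} \<inter> {..<X e}) = min (X e) \<tau>" if "e \<in> T" for e
  proof (cases "X e \<le> \<tau>")
    case True
    hence "{0..\<tau>} \<inter> {..<X e} = {0..<X e}" by auto
    thus ?thesis using True assms(2)[OF that] by simp
  next
    case False
    hence "{0..\<tau>} \<inter> {..<X e} = {0..\<tau>}" by auto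
    thus ?thesis using False assms(3) by simp
  qed
  thus "(LBINT t:{0..\<tau>}. real (card {e\<in>T. X e > t})) = (\<Sum>e\<in>T. min (X e) \<tau>)"
    unfolding set_lebesgue_integral_def eq by (subst Bochner_Integration.integral_sum[OF int]) simp
qed

text \<open>A Kruskal tree expresses the integrand as an edge count, a finite sum of indicators of
  intervals.\<close>

lemma excess_integrable:
  assumes "n > 0" "\<And>e. e \<in> complete_edges n \<Longrightarrow> X e \<ge> 0" "\<tau> \<ge> 0"
  shows "set_integrable lborel {0..\<tau>} (\<lambda>t. real (ncomp {..<n} (level_graph n X t)) - 1)"
proof -
  obtain T where T: "T\<in>spanning_trees n" "\<And>t. card {e\<in>T. X e > t} + 1 = ncomp {..<n} (level_graph n X t)"
    using kruskal[OF assms(1), of X] by auto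
  have "T \<subseteq> complete_edges n" using T by (simp add: spanning_trees_def)
  hence "set_integrable lborel {0..\<tau>} (\<lambda>t. real (card {e\<in>T. X e > t}))"
    using assms by (intro tree_layer_cake(2)) (auto intro: finite_subset)
  moreover have "real (card {e\<in>T. X e > t}) = real (ncomp {..<n} (level_graph n X t)) - 1" for t
    using T(2)[of t] by linarith
  ultimately show ?thesis by simp
qed

lemma excess_integral_le_tree:
  assumes "n > 0" "\<And>e. e \<in> complete_edges n \<Longrightarrow> X e \<ge> 0" "\<tau> \<ge> 0" "T \<in> spanning_trees n"
  shows "excess_integral n X \<tau> \<le> (\<Sum>e\<in>T. X e)"
proof -
  have T: "T \<subseteq> complete_edges n" using assms by (simp add: spanning_trees_def)
  hence "finite T" by (auto intro: finite_subset)
  have "excess_integral n X \<tau> \<le> (LBINT t:{0..\<tau>}. real (card {e\<in>T. X e > t}))"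
    unfolding excess_integral_def
  proof (rule set_integral_mono[OF excess_integrable[OF assms(1,2,3)] tree_layer_cake(2)])
    fix t
    show "real (ncomp {..<n} (level_graph n X t)) - 1 \<le> real (card {e\<in>T. X e > t})"
      using ncomp_level_le_tree[OF assms(1,4), of X t] by linarith
  qed (use T assms \<open>finite T\<close> in auto)
  also have "\<dots> = (\<Sum>e\<in>T. min (X e) \<tau>)"
    using T assms \<open>finite T\<close> by (intro tree_layer_cake(1)) auto
  also have "\<dots> \<le> (\<Sum>e\<in>T. X e)" by (intro sum_mono) auto
  finally show ?thesis .
qed

text \<open>Connectivity at level \<open>\<tau>\<close> means that the Kruskal tree has no edge
  longer than \<open>\<tau>\<close>, so the truncation loses nothing.\<close>

lemma excess_integral_tree:
  assumes "n > 0" "\<And>e. e \<in> complete_edges n \<Longrightarrow> X e \<ge> 0" "\<tau> \<ge> 0"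
    and "ncomp {..<n} (level_graph n X \<tau>) = 1"
  shows "\<exists>T\<in>spanning_trees n. (\<Sum>e\<in>T. X e) = excess_integral n X \<tau>"
proof -
  obtain T where T: "T\<in>spanning_trees n" "\<And>t. card {e\<in>T. X e > t} + 1 = ncomp {..<n} (level_graph n X t)"
    using kruskal[OF assms(1), of X] by auto
  have sub: "T \<subseteq> complete_edges n" using T by (simp add: spanning_trees_def)
  hence fin: "finite T" by (auto intro: finite_subset)
  have "card {e\<in>T. X e > \<tau>} = 0" using T(2)[of \<tau>] assms(4) by simp
  hence le: "X e \<le> \<tau>" if "e \<in> T" for e using that fin by (auto simp: not_less)
  have "real (card {e\<in>T. X e > t}) = real (ncomp {..<n} (level_graph n X t)) - 1" for t
    using T(2)[of t] by linarith
  hence "excess_integral n X \<tau> = (LBINT t:{0..\<tau>}. real (card {e\<in>T. X e > t}))"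
    by (simp add: excess_integral_def)
  also have "\<dots> = (\<Sum>e\<in>T. min (X e) \<tau>)"
    using sub assms fin by (intro tree_layer_cake(1)) auto
  also have "\<dots> = (\<Sum>e\<in>T. X e)" using le by (intro sum.cong) (auto simp: min_def)
  finally show ?thesis using T by metis
qed

section \<open>Expectations over random edge sets\<close>

text \<open>Expectation over a random subset that contains each element of \<open>F\<close>
  independently with probability \<open>p\<close>. As a finite sum it needs no probability space and
  allows induction on the elements of \<open>F\<close>.\<close>

definition bexp :: "real \<Rightarrow> 'e set \<Rightarrow> ('e set \<Rightarrow> real) \<Rightarrow> real" where
  "bexp p F \<phi> = (\<Sum>S\<in>Pow F. p ^ card S * (1 - p) ^ card (F - S) * \<phi> S)"

lemma bexp_empty [simp]: "bexp p {} \<phi> = \<phi> {}"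
  by (simp add: bexp_def)

lemma bexp_insert:
  assumes "finite F" "e \<notin> F"
  shows "bexp p (insert e F) \<phi> = p * bexp p F (\<lambda>S. \<phi> (insert e S)) + (1 - p) * bexp p F \<phi>"
proof -
  let ?h = "\<lambda>G S. p ^ card S * (1 - p) ^ card (G - S) * \<phi> S"
  have "bexp p (insert e F) \<phi> = (\<Sum>S\<in>Pow F \<union> insert e ` Pow F. ?h (insert e F) S)"
    by (simp add: bexp_def Pow_insert)
  also have "\<dots> = (\<Sum>S\<in>Pow F. ?h (insert e F) S) + (\<Sum>S\<in>insert e ` Pow F. ?h (insert e F) S)"
    by (rule sum.union_disjoint) (use assms in auto)
  also have "(\<Sum>S\<in>insert e ` Pow F. ?h (insert e F) S) = (\<Sum>S\<in>Pow F. ?h (insert e F) (insert e S))"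
    by (rule sum.reindex_cong[of "insert e"]) (use assms in \<open>auto simp: inj_on_def\<close>)
  also have "\<dots> = p * bexp p F (\<lambda>S. \<phi> (insert e S))"
    unfolding bexp_def sum_distrib_left
  proof (rule sum.cong[OF refl])
    fix S assume "S \<in> Pow F"
    moreover from this have "e \<notin> S" "finite S" using assms finite_subset by auto
    moreover have "insert e F - insert e S = F - S" using assms by auto
    ultimately show "?h (insert e F) (insert e S) = p * (p ^ card S * (1 - p) ^ card (F - S) * \<phi> (insert e S))"
      by simp
  qed
  also have "(\<Sum>S\<in>Pow F. ?h (insert e F) S) = (1 - p) * bexp p F \<phi>"
    unfolding bexp_def sum_distrib_left
  proof (rule sum.cong[OF refl])
    fix S assume "S \<in> Pow F"
    hence "insert e F - S = insert e (F - S)" "e \<notin> F - S" "finite (F - S)" using assms by auto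
    thus "?h (insert e F) S = (1 - p) * (p ^ card S * (1 - p) ^ card (F - S) * \<phi> S)" by simp
  qed
  finally show ?thesis by simp
qed

lemma bexp_cong: "(\<And>S. S \<subseteq> F \<Longrightarrow> \<phi> S = \<psi> S) \<Longrightarrow> bexp p F \<phi> = bexp p F \<psi>"
  unfolding bexp_def by (intro sum.cong) auto

lemma bexp_mono:
  assumes "0 \<le> p" "p \<le> 1" "\<And>S. S \<subseteq> F \<Longrightarrow> \<phi> S \<le> \<psi> S"
  shows "bexp p F \<phi> \<le> bexp p F \<psi>"
  unfolding bexp_def by (intro sum_mono mult_left_mono) (use assms in auto)

lemma bexp_add: "bexp p F (\<lambda>S. \<phi> S + \<psi> S) = bexp p F \<phi> + bexp p F \<psi>"
  by (simp add: bexp_def distrib_left sum.distrib)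

lemma bexp_cmult: "bexp p F (\<lambda>S. c * \<phi> S) = c * bexp p F \<phi>"
  by (simp add: bexp_def sum_distrib_left mult_ac)

lemma bexp_diff: "bexp p F (\<lambda>S. \<phi> S - \<psi> S) = bexp p F \<phi> - bexp p F \<psi>"
  by (simp add: bexp_def right_diff_distrib sum_subtractf)

lemma bexp_sum: "bexp p F (\<lambda>S. \<Sum>i\<in>I. \<phi> i S) = (\<Sum>i\<in>I. bexp p F (\<phi> i))"
  unfolding bexp_def sum_distrib_left by (rule sum.swap)

lemma bexp_const [simp]: "finite F \<Longrightarrow> bexp p F (\<lambda>_. c) = c"
  by (induction F rule: finite_induct) (simp_all add: bexp_insert algebra_simps)

lemma bexp_Un:
  assumes "finite F" "finite G" "F \<inter> G = {}"
  shows "bexp p (F \<union> G) \<phi> = bexp p F (\<lambda>S. bexp p G (\<lambda>T. \<phi> (S \<union> T)))"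
  using assms(1,3)
proof (induction F arbitrary: \<phi> rule: finite_induct)
  case (insert e F)
  have "bexp p (insert e F \<union> G) \<phi> = bexp p (insert e (F \<union> G)) \<phi>" by simp
  also have "\<dots> = p * bexp p (F \<union> G) (\<lambda>S. \<phi> (insert e S)) + (1 - p) * bexp p (F \<union> G) \<phi>"
    by (rule bexp_insert) (use insert assms(2) in auto)
  also have "\<dots> = bexp p (insert e F) (\<lambda>S. bexp p G (\<lambda>T. \<phi> (S \<union> T)))"
    using insert by (simp add: bexp_insert)
  finally show ?case .
qed simp

text \<open>Induction on the elements takes the place of the monotone coupling: conditioning on one
  element gives \<open>?a - p * (?a - ?b)\<close>, which decreases in \<open>p\<close> because
  adding the element lowers \<open>\<phi>\<close>.\<close>

lemma bexp_antimono_prob: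
  assumes "finite F" "0 \<le> p" "p \<le> p'" "p' \<le> 1"
    and "\<And>S T. S \<subseteq> T \<Longrightarrow> T \<subseteq> F \<Longrightarrow> \<phi> T \<le> \<phi> S"
  shows "bexp p' F \<phi> \<le> bexp p F \<phi>"
  using assms(1,5)
proof (induction F arbitrary: \<phi> rule: finite_induct)
  case (insert e F)
  let ?a = "bexp p F \<phi>" and ?b = "bexp p F (\<lambda>S. \<phi> (insert e S))"
  have 1: "bexp p' F \<phi> \<le> ?a"
    by (rule insert.IH, rule insert.prems) auto
  have 2: "bexp p' F (\<lambda>S. \<phi> (insert e S)) \<le> ?b"
    by (rule insert.IH, rule insert.prems) auto
  have 3: "?b \<le> ?a"
    by (rule bexp_mono, use assms in simp, use assms in simp, rule insert.prems) auto
  have "bexp p' (insert e F) \<phi> \<le> p' * ?b + (1 - p') * ?a"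
    unfolding bexp_insert[OF insert.hyps]
    by (intro add_mono mult_left_mono) (use 1 2 assms in auto)
  also have "\<dots> = ?a - p' * (?a - ?b)" by (simp add: algebra_simps)
  also have "\<dots> \<le> ?a - p * (?a - ?b)" using 3 assms by (intro diff_left_mono mult_right_mono) auto
  also have "\<dots> = bexp p (insert e F) \<phi>"
    unfolding bexp_insert[OF insert.hyps] by (simp add: algebra_simps)
  finally show ?case .
qed simp

text \<open>Efron--Stein: by the law of total variance each edge contributes at most \<open>p (1 - p)\<close>.\<close>
lemma bexp_variance:
  assumes "finite F" "0 \<le> p" "p \<le> 1"
    and "\<And>S e. S \<subseteq> F \<Longrightarrow> e \<in> F \<Longrightarrow> \<bar>\<phi> (insert e S) - \<phi> S\<bar> \<le> 1"
  shows "bexp p F (\<lambda>S. (\<phi> S)\<^sup>2) - (bexp p F \<phi>)\<^sup>2 \<le> p * real (card F)"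
  using assms(1,4)
proof (induction F arbitrary: \<phi> rule: finite_induct)
  case (insert e F)
  let ?a = "bexp p F \<phi>" and ?b = "bexp p F (\<lambda>S. \<phi> (insert e S))"
  let ?a2 = "bexp p F (\<lambda>S. (\<phi> S)\<^sup>2)" and ?b2 = "bexp p F (\<lambda>S. (\<phi> (insert e S))\<^sup>2)"
  have 1: "?a2 - ?a\<^sup>2 \<le> p * real (card F)"
    by (rule insert.IH) (use insert.prems in auto)
  have 2: "?b2 - ?b\<^sup>2 \<le> p * real (card F)"
  proof (rule insert.IH)
    fix S e' assume *: "S \<subseteq> F" "e' \<in> F"
    have "insert e S \<subseteq> insert e F" using * by auto
    from insert.prems[OF this, of e'] show "\<bar>\<phi> (insert e (insert e' S)) - \<phi> (insert e S)\<bar> \<le> 1"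
      using * by (simp add: insert_commute)
  qed
  have "\<bar>?b - ?a\<bar> \<le> 1"
  proof -
    have "bexp p F (\<lambda>S. \<phi> (insert e S) - \<phi> S) \<le> bexp p F (\<lambda>_. 1)"
    proof (rule bexp_mono)
      fix S assume "S \<subseteq> F"
      hence "S \<subseteq> insert e F" by auto
      thus "\<phi> (insert e S) - \<phi> S \<le> 1" using insert.prems[of S e] by (auto simp: abs_le_iff)
    qed (use assms in auto)
    moreover have "bexp p F (\<lambda>_. -1) \<le> bexp p F (\<lambda>S. \<phi> (insert e S) - \<phi> S)"
    proof (rule bexp_mono)
      fix S assume "S \<subseteq> F"
      hence "S \<subseteq> insert e F" by auto
      thus "-1 \<le> \<phi> (insert e S) - \<phi> S" using insert.prems[of S e] by (auto simp: abs_le_iff)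
    qed (use assms in auto)
    ultimately show ?thesis using insert.hyps by (simp add: bexp_diff)
  qed
  hence 3: "(?b - ?a)\<^sup>2 \<le> 1" by (simp add: abs_square_le_1)
  have "bexp p (insert e F) (\<lambda>S. (\<phi> S)\<^sup>2) - (bexp p (insert e F) \<phi>)\<^sup>2
      = p * (?b2 - ?b\<^sup>2) + (1 - p) * (?a2 - ?a\<^sup>2) + p * (1 - p) * (?b - ?a)\<^sup>2"
    unfolding bexp_insert[OF insert.hyps] by (simp add: power2_eq_square algebra_simps)
  also have "\<dots> \<le> p * (p * real (card F)) + (1 - p) * (p * real (card F)) + p * 1 * 1"
    by (intro add_mono mult_mono 1 2 3 mult_left_mono) (use assms in auto)
  also have "\<dots> = p * real (card (insert e F))" using insert.hyps by (simp add: algebra_simps)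
  finally show ?case .
qed simp

text \<open>Jensen's inequality, obtained from the nonnegative variance of
  \<open>\<bar>\<phi> S - m\<bar>\<close>, followed by the variance bound.\<close>

lemma bexp_abs_deviation:
  assumes "finite F" "0 \<le> p" "p \<le> 1"
    and "\<And>S e. S \<subseteq> F \<Longrightarrow> e \<in> F \<Longrightarrow> \<bar>\<phi> (insert e S) - \<phi> S\<bar> \<le> 1"
  shows "bexp p F (\<lambda>S. \<bar>\<phi> S - bexp p F \<phi>\<bar>) \<le> sqrt (p * real (card F))"
proof -
  define m where "m = bexp p F \<phi>"
  define d where "d = bexp p F (\<lambda>S. \<bar>\<phi> S - m\<bar>)"
  have "0 \<le> bexp p F (\<lambda>S. (\<bar>\<phi> S - m\<bar> - d)\<^sup>2)"
    using bexp_mono[of p F "\<lambda>_. 0" "\<lambda>S. (\<bar>\<phi> S - m\<bar> - d)\<^sup>2"] assms by simp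
  also have "(\<lambda>S. (\<bar>\<phi> S - m\<bar> - d)\<^sup>2) =
      (\<lambda>S. (((\<phi> S)\<^sup>2 - (2 * m) * \<phi> S) + m\<^sup>2) + (d\<^sup>2 - (2 * d) * \<bar>\<phi> S - m\<bar>))"
    by (auto simp: power2_diff fun_eq_iff)
  also have "bexp p F \<dots> = bexp p F (\<lambda>S. (\<phi> S)\<^sup>2) - 2 * m * m + m\<^sup>2 + (d\<^sup>2 - 2 * d * d)"
    unfolding bexp_add bexp_diff bexp_cmult using assms by (simp add: m_def[symmetric] d_def[symmetric])
  finally have "d\<^sup>2 \<le> bexp p F (\<lambda>S. (\<phi> S)\<^sup>2) - m\<^sup>2" by (simp add: power2_eq_square)
  also have "\<dots> \<le> p * real (card F)" unfolding m_def by (rule bexp_variance[OF assms])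
  finally have "d \<le> sqrt (p * real (card F))" by (rule real_le_rsqrt)
  thus ?thesis by (simp add: d_def m_def)
qed

lemma bexp_bij:
  assumes "bij_betw g F G" "finite F"
  shows "bexp p G \<phi> = bexp p F (\<lambda>S. \<phi> (g ` S))"
  unfolding bexp_def
proof (rule sum.reindex_bij_betw[symmetric, THEN trans])
  show "bij_betw ((`) g) (Pow F) (Pow G)" by (rule bij_betw_Pow[OF assms(1)])
  show "(\<Sum>S\<in>Pow F. p ^ card (g ` S) * (1 - p) ^ card (G - g ` S) * \<phi> (g ` S)) =
        (\<Sum>S\<in>Pow F. p ^ card S * (1 - p) ^ card (F - S) * \<phi> (g ` S))"
  proof (rule sum.cong[OF refl])
    fix S assume "S \<in> Pow F"
    hence "inj_on g S" "inj_on g (F - S)" "G - g ` S = g ` (F - S)"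
      using assms(1) inj_on_image_set_diff[of g F F S] unfolding bij_betw_def
      by (auto intro: inj_on_subset)
    thus "p ^ card (g ` S) * (1 - p) ^ card (G - g ` S) * \<phi> (g ` S) =
          p ^ card S * (1 - p) ^ card (F - S) * \<phi> (g ` S)"
      by (simp add: card_image)
  qed
qed

lemma bexp_card:
  assumes "finite F"
  shows "bexp p F (\<lambda>S. h (card S)) = (\<Sum>i\<le>card F. real (card F choose i) * p ^ i * (1 - p) ^ (card F - i) * h i)"
proof -
  have "bexp p F (\<lambda>S. h (card S)) = (\<Sum>S\<in>Pow F. p ^ card S * (1 - p) ^ (card F - card S) * h (card S))"
    unfolding bexp_def using assms
    by (intro sum.cong refl) (metis PowD card_Diff_subset finite_subset)
  also have "\<dots> = (\<Sum>i\<le>card F. \<Sum>S\<in>{S\<in>Pow F. card S = i}. p ^ card S * (1 - p) ^ (card F - card S) * h (card S))"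
    by (rule sum.group[symmetric]) (use assms in \<open>auto intro: card_mono\<close>)
  also have "\<dots> = (\<Sum>i\<le>card F. real (card F choose i) * (p ^ i * (1 - p) ^ (card F - i) * h i))"
  proof (rule sum.cong[OF refl])
    fix i
    have "(\<Sum>S\<in>{S\<in>Pow F. card S = i}. p ^ card S * (1 - p) ^ (card F - card S) * h (card S))
        = (\<Sum>S\<in>{S\<in>Pow F. card S = i}. p ^ i * (1 - p) ^ (card F - i) * h i)"
      by (intro sum.cong) auto
    thus "(\<Sum>S\<in>{S\<in>Pow F. card S = i}. p ^ card S * (1 - p) ^ (card F - card S) * h (card S))
       = real (card F choose i) * (p ^ i * (1 - p) ^ (card F - i) * h i)"
      using n_subsets[OF assms, of i] by simp
  qed
  finally show ?thesis by (simp add: mult_ac)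
qed

lemma bexp_power_card:
  assumes "finite F"
  shows "bexp p F (\<lambda>S. r ^ card S) = (1 - p + p * r) ^ card F"
  using assms
proof (induction F rule: finite_induct)
  case (insert e F)
  have "bexp p F (\<lambda>S. r ^ card (insert e S)) = bexp p F (\<lambda>S. r * r ^ card S)"
  proof (rule bexp_cong)
    fix S assume "S \<subseteq> F"
    hence "finite S" "e \<notin> S" using insert.hyps finite_subset by auto
    thus "r ^ card (insert e S) = r * r ^ card S" by simp
  qed
  thus ?case using insert by (simp add: bexp_insert bexp_cmult algebra_simps)
qed simp

section \<open>Exploration of components\<close>

text \<open>State of an exploration: \<open>A\<close> holds the active vertices, \<open>U\<close>
  the unseen ones, and all others are exhausted. The set collects the unseen vertices that are
  eventually discovered, along paths that stay in \<open>U\<close> after their start.\<close>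

definition reach :: "'v set set \<Rightarrow> 'v set \<Rightarrow> 'v set \<Rightarrow> 'v set" where
  "reach E A U = {u \<in> U. \<exists>a\<in>A. (a, u) \<in> {(x, y). {x, y} \<in> E \<and> y \<in> U}\<^sup>*}"

text \<open>The pairs whose state can still matter: at least one end is unseen. Pairs inside
  \<open>A\<close> are left out because they discover nothing.\<close>

definition explore_edges :: "'v set \<Rightarrow> 'v set \<Rightarrow> 'v set set" where
  "explore_edges A U = {e. \<exists>x\<in>A \<union> U. \<exists>u\<in>U. x \<noteq> u \<and> e = {x, u}}"

lemma reach_subset: "reach E A U \<subseteq> U"
  by (auto simp: reach_def)

lemma finite_reach: "finite U \<Longrightarrow> finite (reach E A U)"
  by (rule finite_subset[OF reach_subset])

lemma reach_empty [simp]: "reach E {} U = {}"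
  by (simp add: reach_def)

lemma reach_step:
  assumes "x \<in> A \<or> x \<in> reach E A U" "{x, y} \<in> E" "y \<in> U"
  shows "y \<in> reach E A U"
proof -
  let ?R = "{(x, y). {x, y} \<in> E \<and> y \<in> U}"
  obtain a where "a \<in> A" "(a, x) \<in> ?R\<^sup>*" using assms(1) by (auto simp: reach_def)
  moreover have "(x, y) \<in> ?R" using assms by auto
  ultimately have "(a, y) \<in> ?R\<^sup>*" by (meson rtrancl.rtrancl_into_rtrancl)
  thus ?thesis using \<open>a \<in> A\<close> assms(3) by (auto simp: reach_def)
qed

lemma reach_least:
  assumes "\<And>x y. x \<in> A \<or> x \<in> S \<Longrightarrow> {x, y} \<in> E \<Longrightarrow> y \<in> U \<Longrightarrow> y \<in> S" "A \<inter> U = {}"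
  shows "reach E A U \<subseteq> S"
proof
  fix u assume "u \<in> reach E A U"
  then obtain a where a: "a \<in> A" "(a, u) \<in> {(x, y). {x, y} \<in> E \<and> y \<in> U}\<^sup>*" "u \<in> U"
    by (auto simp: reach_def)
  from a(2) have "u \<in> A \<or> u \<in> S" by induction (use a assms in auto)
  thus "u \<in> S" using a assms by auto
qed

text \<open>One step of the exploration: the unseen neighbours of \<open>a\<close> become active and
  \<open>a\<close> is retired. Retiring it loses nothing, since all that it sees in \<open>U\<close>
  is in \<open>N\<close>.\<close>

lemma reach_recursion:
  fixes E :: "'v set set"
  assumes "a \<in> A" "A \<inter> U = {}"
  defines "N \<equiv> {u\<in>U. {a, u} \<in> E}"
  shows "reach E A U = N \<union> reach E (A - {a} \<union> N) (U - N)"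
proof
  let ?R' = "reach E (A - {a} \<union> N) (U - N)"
  show "reach E A U \<subseteq> N \<union> ?R'"
  proof (rule reach_least[OF _ assms(2)])
    fix x y assume xy: "x \<in> A \<or> x \<in> N \<union> ?R'" "{x, y} \<in> E" "y \<in> U"
    show "y \<in> N \<union> ?R'"
    proof (cases "y \<in> N")
      case False
      hence "x \<noteq> a" using xy by (auto simp: N_def)
      hence "y \<in> ?R'" using xy False by (intro reach_step[of x]) auto
      thus ?thesis by simp
    qed simp
  qed
  have N: "N \<subseteq> reach E A U" using assms by (auto intro: reach_step)
  have "?R' \<subseteq> reach E A U"
    by (rule reach_least) (use N assms in \<open>auto intro: reach_step\<close>)
  thus "N \<union> ?R' \<subseteq> reach E A U" using N by simp
qed

lemma reach_cong:
  assumes "A \<inter> U = {}" "\<And>x u. x \<in> A \<union> U \<Longrightarrow> u \<in> U \<Longrightarrow> {x, u} \<in> E \<longleftrightarrow> {x, u} \<in> E'"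
  shows "reach E A U = reach E' A U"
proof
  show "reach E A U \<subseteq> reach E' A U"
  proof (rule reach_least[OF _ assms(1)])
    fix x y assume *: "x \<in> A \<or> x \<in> reach E' A U" "{x, y} \<in> E" "y \<in> U"
    moreover have "x \<in> A \<union> U" using * reach_subset[of E' A U] by auto
    ultimately show "y \<in> reach E' A U" using assms(2) by (intro reach_step[of x]) auto
  qed
  show "reach E' A U \<subseteq> reach E A U"
  proof (rule reach_least[OF _ assms(1)])
    fix x y assume *: "x \<in> A \<or> x \<in> reach E A U" "{x, y} \<in> E'" "y \<in> U"
    moreover have "x \<in> A \<union> U" using * reach_subset[of E A U] by auto
    ultimately show "y \<in> reach E A U" using assms(2) by (intro reach_step[of x]) auto
  qed
qed

lemma gcomp_reach:
  assumes "E \<subseteq> complete_edges n" "v < n"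
  shows "gcomp E v = insert v (reach E {v} ({..<n} - {v}))"
proof
  have "\<And>x y. {x, y} \<in> E \<Longrightarrow> y < n" using assms(1) by (auto simp: complete_edges_def)
  thus "gcomp E v \<subseteq> insert v (reach E {v} ({..<n} - {v}))"
    by (intro comp_least) (auto intro: reach_step)
  have "reach E {v} ({..<n} - {v}) \<subseteq> gcomp E v"
    by (rule reach_least) (auto intro: comp_step comp_step[OF comp_refl])
  thus "insert v (reach E {v} ({..<n} - {v})) \<subseteq> gcomp E v" by simp
qed

lemma explore_edges_complete:
  assumes "v < n"
  shows "explore_edges {v} ({..<n} - {v}) = complete_edges n"
proof
  show "explore_edges {v} ({..<n} - {v}) \<subseteq> complete_edges n"
    using assms by (auto simp: explore_edges_def complete_edges_def)
  show "complete_edges n \<subseteq> explore_edges {v} ({..<n} - {v})"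
  proof
    fix e assume "e \<in> complete_edges n"
    then obtain x y where e: "e = {x, y}" "x \<noteq> y" "x < n" "y < n" by (elim complete_edgesE)
    show "e \<in> explore_edges {v} ({..<n} - {v})"
    proof (cases "y = v")
      case True
      thus ?thesis using e unfolding explore_edges_def
        by (auto intro!: exI[of _ "{y, x}"] bexI[of _ y] bexI[of _ x] simp: insert_commute)
    next
      case False
      thus ?thesis using e unfolding explore_edges_def by auto
    qed
  qed
qed

lemma finite_explore_edges:
  assumes "finite A" "finite U"
  shows "finite (explore_edges A U)"
proof (rule finite_subset)
  show "explore_edges A U \<subseteq> Pow (A \<union> U)" by (auto simp: explore_edges_def)
qed (use assms in auto)

text \<open>The edges at the explored vertex \<open>a\<close> are independent of those seen later on.\<close>
lemma bexp_explore:
  assumes "finite A" "finite U" "a \<in> A" "A \<inter> U = {}"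
  shows "bexp p (explore_edges A U) (\<lambda>E. h (reach E A U)) =
         bexp p U (\<lambda>N. bexp p (explore_edges (A - {a} \<union> N) (U - N))
                        (\<lambda>E. h (N \<union> reach E (A - {a} \<union> N) (U - N))))"
proof -
  define F where "F = (\<lambda>u. {a, u}) ` U"
  define G where "G = explore_edges (A - {a}) U"
  have aU: "a \<notin> U" using assms(3,4) by blast
  have FG: "explore_edges A U = F \<union> G"
  proof
    show "explore_edges A U \<subseteq> F \<union> G"
    proof
      fix e assume "e \<in> explore_edges A U"
      then obtain x u where e: "x \<in> A \<union> U" "u \<in> U" "x \<noteq> u" "e = {x, u}"
        unfolding explore_edges_def by blast
      show "e \<in> F \<union> G"
      proof (cases "x = a")
        case True
        thus ?thesis using e unfolding F_def by blast
      next
        case False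
        thus ?thesis using e unfolding G_def explore_edges_def by blast
      qed
    qed
    have "{a, u} \<in> explore_edges A U" if "u \<in> U" for u
      unfolding explore_edges_def mem_Collect_eq
      by (rule bexI[of _ a], rule bexI[of _ u]) (use that assms(3) aU in auto)
    hence "F \<subseteq> explore_edges A U" unfolding F_def by blast
    moreover have "G \<subseteq> explore_edges A U" unfolding G_def explore_edges_def by blast
    ultimately show "F \<union> G \<subseteq> explore_edges A U" by simp
  qed
  have "a \<notin> e" if "e \<in> G" for e using that aU unfolding G_def explore_edges_def by blast
  hence disj: "F \<inter> G = {}" unfolding F_def by blast
  have fin: "finite F" "finite G"
    unfolding F_def G_def using assms by (auto intro: finite_explore_edges)
  have bij: "bij_betw (\<lambda>u. {a, u}) U F"
    unfolding F_def bij_betw_def by (auto simp: inj_on_def doubleton_eq_iff)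
  have "bexp p (explore_edges A U) (\<lambda>E. h (reach E A U)) =
      bexp p U (\<lambda>N. bexp p G (\<lambda>T. h (reach ((\<lambda>u. {a, u}) ` N \<union> T) A U)))"
    unfolding FG bexp_Un[OF fin disj] by (rule bexp_bij[OF bij assms(2)])
  also have "\<dots> = bexp p U (\<lambda>N. bexp p (explore_edges (A - {a} \<union> N) (U - N))
                        (\<lambda>E. h (N \<union> reach E (A - {a} \<union> N) (U - N))))"
  proof (rule bexp_cong)
    fix N assume N: "N \<subseteq> U"
    \<comment> \<open>The edges in \<open>G - G'\<close> join a vertex of \<open>N\<close> to
      another vertex of \<open>N\<close> or to an active vertex. Both ends are known by now, so
      these edges do not affect the outcome and are integrated out.\<close>
    define G' where "G' = explore_edges (A - {a} \<union> N) (U - N)"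
    have G': "G' \<subseteq> G" using N by (auto simp: G'_def G_def explore_edges_def)
    have fin': "finite G'" "finite (G - G')" using G' fin finite_subset by auto
    have "bexp p G (\<lambda>T. h (reach ((\<lambda>u. {a, u}) ` N \<union> T) A U)) =
          bexp p (G' \<union> (G - G')) (\<lambda>T. h (reach ((\<lambda>u. {a, u}) ` N \<union> T) A U))"
      using G' by (simp add: Un_absorb1)
    also have "\<dots> = bexp p G' (\<lambda>S. bexp p (G - G') (\<lambda>T. h (reach ((\<lambda>u. {a, u}) ` N \<union> (S \<union> T)) A U)))"
      by (rule bexp_Un) (use fin' in auto)
    also have "\<dots> = bexp p G' (\<lambda>S. bexp p (G - G') (\<lambda>T. h (N \<union> reach S (A - {a} \<union> N) (U - N))))"
    proof (intro bexp_cong arg_cong[where f = h])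
      fix S T assume S: "S \<subseteq> G'" and T: "T \<subseteq> G - G'"
      define E where "E = (\<lambda>u. {a, u}) ` N \<union> (S \<union> T)"
      have nG: "{a, u} \<notin> G" if "u \<in> U" for u
        using disj that by (auto simp: F_def)
      have "{u\<in>U. {a, u} \<in> E} = N"
        using N nG S T G' by (auto simp: E_def doubleton_eq_iff)
      hence "reach E A U = N \<union> reach E (A - {a} \<union> N) (U - N)"
        using reach_recursion[OF assms(3,4), of E] by simp
      also have "reach E (A - {a} \<union> N) (U - N) = reach S (A - {a} \<union> N) (U - N)"
      proof (rule reach_cong)
        show "(A - {a} \<union> N) \<inter> (U - N) = {}" using assms by auto
        fix x u assume xu: "x \<in> A - {a} \<union> N \<union> (U - N)" "u \<in> U - N"
        have "x \<noteq> a" "u \<noteq> a" using xu assms N by auto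
        hence "{x, u} \<notin> (\<lambda>u. {a, u}) ` N" by (auto simp: doubleton_eq_iff)
        moreover have "{x, u} \<notin> T"
        proof
          assume "{x, u} \<in> T"
          hence "{x, u} \<in> G" "{x, u} \<notin> G'" using T by auto
          moreover have "x \<noteq> u" using \<open>{x, u} \<in> G\<close> by (auto simp: G_def explore_edges_def doubleton_eq_iff)
          ultimately show False using xu by (auto simp: G'_def explore_edges_def)
        qed
        ultimately show "{x, u} \<in> E \<longleftrightarrow> {x, u} \<in> S" by (auto simp: E_def)
      qed
      finally show "reach ((\<lambda>u. {a, u}) ` N \<union> (S \<union> T)) A U = N \<union> reach S (A - {a} \<union> N) (U - N)"
        by (simp add: E_def)
    qed
    also have "\<dots> = bexp p G' (\<lambda>S. h (N \<union> reach S (A - {a} \<union> N) (U - N)))"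
      using fin' by simp
    finally show "bexp p G (\<lambda>T. h (reach ((\<lambda>u. {a, u}) ` N \<union> T) A U)) =
       bexp p (explore_edges (A - {a} \<union> N) (U - N)) (\<lambda>E. h (N \<union> reach E (A - {a} \<union> N) (U - N)))"
      by (simp add: G'_def)
  qed
  finally show ?thesis .
qed

text \<open>Probability that exactly \<open>j\<close> further vertices are discovered from
  \<open>a\<close> active and \<open>m\<close> unseen ones: an active vertex finds a binomial number
  \<open>i\<close> of new ones and is retired. Since \<open>i\<close> moves from \<open>j\<close> to
  the active count, \<open>a + j\<close> drops by one in each call.\<close>

function explore_prob :: "real \<Rightarrow> nat \<Rightarrow> nat \<Rightarrow> nat \<Rightarrow> real" where
  "explore_prob p 0 m j = (if j = 0 then 1 else 0)"
| "explore_prob p (Suc a) m j =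
     (\<Sum>i\<le>j. real (m choose i) * p ^ i * (1 - p) ^ (m - i) * explore_prob p (a + i) (m - i) (j - i))"
  by pat_completeness auto
termination by (relation "Wellfounded.measure (\<lambda>(p, a, m, j). a + j)") auto

lemma bexp_reach_card:
  assumes "finite A" "finite U" "A \<inter> U = {}"
  shows "bexp p (explore_edges A U) (\<lambda>E. of_bool (card (reach E A U) = j)) =
         explore_prob p (card A) (card U) j"
  using assms
proof (induction "card A + card U" arbitrary: A U j)
  case 0
  thus ?case by (simp add: finite_explore_edges of_bool_def)
next
  case (Suc k)
  note IH = Suc.hyps(1) and fin = Suc.prems
  show ?case
  proof (cases "A = {}")
    case True
    thus ?thesis using fin by (simp add: finite_explore_edges of_bool_def)
  next
    case False
    then obtain a where a: "a \<in> A" by auto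
    obtain b where b: "card A = Suc b" using a fin(1) by (metis card_Suc_Diff1)
    have cA: "card (A - {a}) = b" using a b fin(1) by simp
    have "bexp p (explore_edges A U) (\<lambda>E. of_bool (card (reach E A U) = j)) =
       bexp p U (\<lambda>N. bexp p (explore_edges (A - {a} \<union> N) (U - N))
                        (\<lambda>E. of_bool (card (N \<union> reach E (A - {a} \<union> N) (U - N)) = j)))"
      by (rule bexp_explore[OF fin(1,2) a fin(3)])
    also have "\<dots> = bexp p U (\<lambda>N. of_bool (card N \<le> j) * explore_prob p (b + card N) (card U - card N) (j - card N))"
    proof (rule bexp_cong)
      fix N assume N: "N \<subseteq> U"
      let ?A = "A - {a} \<union> N" and ?U = "U - N"
      have finN: "finite N" using N fin finite_subset by auto
      have cA': "card ?A = b + card N"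
        by (subst card_Un_disjoint) (use cA finN N fin in auto)
      have cU': "card ?U = card U - card N" using N finN by (rule card_Diff_subset[rotated])
      have cNU: "card N \<le> card U" using N fin by (auto intro: card_mono)
      have "card (N \<union> reach E ?A ?U) = card N + card (reach E ?A ?U)" for E
        by (rule card_Un_disjoint) (use finN reach_subset[of E ?A ?U] fin in \<open>auto intro: finite_reach\<close>)
      hence "of_bool (card (N \<union> reach E ?A ?U) = j) =
          of_bool (card N \<le> j) * (of_bool (card (reach E ?A ?U) = j - card N) :: real)" for E
        by (auto simp: of_bool_def)
      hence "bexp p (explore_edges ?A ?U) (\<lambda>E. of_bool (card (N \<union> reach E ?A ?U) = j)) =
          of_bool (card N \<le> j) * bexp p (explore_edges ?A ?U) (\<lambda>E. of_bool (card (reach E ?A ?U) = j - card N))"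
        by (simp add: bexp_cmult)
      also have "bexp p (explore_edges ?A ?U) (\<lambda>E. of_bool (card (reach E ?A ?U) = j - card N)) =
          explore_prob p (card ?A) (card ?U) (j - card N)"
        by (rule IH) (use Suc.hyps(2) b cA' cU' cNU fin finN in auto)
      finally show "bexp p (explore_edges ?A ?U) (\<lambda>E. of_bool (card (N \<union> reach E ?A ?U) = j)) =
          of_bool (card N \<le> j) * explore_prob p (b + card N) (card U - card N) (j - card N)"
        by (simp add: cA' cU')
    qed
    also have "\<dots> = (\<Sum>i\<le>card U. real (card U choose i) * p ^ i * (1 - p) ^ (card U - i) *
        (of_bool (i \<le> j) * explore_prob p (b + i) (card U - i) (j - i)))"
      by (rule bexp_card[OF fin(2)])
    \<comment> \<open>The range changes from \<open>{..card U}\<close> to \<open>{..j}\<close>: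
      terms with \<open>i > j\<close> vanish by the indicator, those with \<open>i > card U\<close>
      by the binomial coefficient.\<close>
    also have "\<dots> = (\<Sum>i\<in>{..card U} \<inter> {..j}. real (card U choose i) * p ^ i * (1 - p) ^ (card U - i) *
        explore_prob p (b + i) (card U - i) (j - i))"
      by (rule sum.mono_neutral_cong_right) auto
    also have "\<dots> = (\<Sum>i\<le>j. real (card U choose i) * p ^ i * (1 - p) ^ (card U - i) *
        explore_prob p (b + i) (card U - i) (j - i))"
      by (rule sum.mono_neutral_cong_left) (auto simp: binomial_eq_0)
    finally show ?thesis by (simp add: b)
  qed
qed

text \<open>As long as \<open>M\<close> vertices are unseen, exploring one active vertex multiplies the
  expectation of \<open>r\<close> to the number of active vertices by at most \<open>(1 - p + p r)\<^sup>M / r \<le> 1\<close>.\<close>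
lemma bexp_reach_small:
  assumes "finite A" "finite U" "A \<inter> U = {}" "0 \<le> p" "p \<le> 1" "0 \<le> r" "r \<le> 1"
    and "(1 - p + p * r) ^ M \<le> r"
  shows "bexp p (explore_edges A U) (\<lambda>E. of_bool (card (reach E A U) + M \<le> card U)) \<le> r ^ card A"
  using assms(1-3)
proof (induction "card A + card U" arbitrary: A U)
  case 0
  thus ?case
    using bexp_mono[of p "explore_edges A U" "\<lambda>E. of_bool (card (reach E A U) + M \<le> card U)" "\<lambda>_. 1"] assms
    by (simp add: finite_explore_edges of_bool_def)
next
  case (Suc k)
  note IH = Suc.hyps(1) and fin = Suc.prems
  have le1: "bexp p (explore_edges A U) (\<lambda>E. of_bool (card (reach E A U) + M \<le> card U)) \<le> 1"
    using bexp_mono[of p "explore_edges A U" "\<lambda>E. of_bool (card (reach E A U) + M \<le> card U)" "\<lambda>_. 1"] assms fin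
    by (simp add: finite_explore_edges of_bool_def)
  show ?case
  proof (cases "A = {}")
    case True
    thus ?thesis using le1 by simp
  next
    case False
    then obtain a where a: "a \<in> A" by auto
    obtain b where b: "card A = Suc b" using a fin(1) by (metis card_Suc_Diff1)
    have cA: "card (A - {a}) = b" using a b fin(1) by simp
    show ?thesis
    proof (cases "M \<le> card U")
      case False
      hence "\<not> card (reach E A U) + M \<le> card U" for E by simp
      thus ?thesis using assms fin by (simp add: finite_explore_edges)
    next
      case MU: True
      have "bexp p (explore_edges A U) (\<lambda>E. of_bool (card (reach E A U) + M \<le> card U)) =
         bexp p U (\<lambda>N. bexp p (explore_edges (A - {a} \<union> N) (U - N))
                          (\<lambda>E. of_bool (card (N \<union> reach E (A - {a} \<union> N) (U - N)) + M \<le> card U)))"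
        by (rule bexp_explore[OF fin(1,2) a fin(3)])
      also have "\<dots> \<le> bexp p U (\<lambda>N. r ^ b * r ^ card N)"
      proof (rule bexp_mono)
        fix N assume N: "N \<subseteq> U"
        let ?A = "A - {a} \<union> N" and ?U = "U - N"
        have finN: "finite N" using N fin finite_subset by auto
        have cA': "card ?A = b + card N"
          by (subst card_Un_disjoint) (use cA finN N fin in auto)
        have cU': "card ?U = card U - card N" using N finN by (rule card_Diff_subset[rotated])
        have cNU: "card N \<le> card U" using N fin by (auto intro: card_mono)
        have "card (N \<union> reach E ?A ?U) = card N + card (reach E ?A ?U)" for E
          by (rule card_Un_disjoint) (use finN reach_subset[of E ?A ?U] fin in \<open>auto intro: finite_reach\<close>)
        \<comment> \<open>The event says that at least \<open>M\<close> vertices of \<open>U\<close>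
          are never discovered, a condition that one exploration step leaves unchanged.\<close>
        hence "card (N \<union> reach E ?A ?U) + M \<le> card U \<longleftrightarrow> card (reach E ?A ?U) + M \<le> card ?U" for E
          using cU' cNU by auto
        hence "bexp p (explore_edges ?A ?U) (\<lambda>E. of_bool (card (N \<union> reach E ?A ?U) + M \<le> card U)) =
               bexp p (explore_edges ?A ?U) (\<lambda>E. of_bool (card (reach E ?A ?U) + M \<le> card ?U))"
          by simp
        also have "\<dots> \<le> r ^ card ?A"
          by (rule IH) (use Suc.hyps(2) b cA' cU' cNU fin finN in auto)
        finally show "bexp p (explore_edges ?A ?U) (\<lambda>E. of_bool (card (N \<union> reach E ?A ?U) + M \<le> card U))
            \<le> r ^ b * r ^ card N" by (simp add: cA' power_add)
      qed (use assms in auto)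
      also have "\<dots> = r ^ b * (1 - p + p * r) ^ card U"
        using fin by (simp add: bexp_cmult bexp_power_card)
      also have "\<dots> \<le> r ^ b * r"
      proof (rule mult_left_mono)
        have *: "0 \<le> 1 - p + p * r" "1 - p + p * r \<le> 1"
          using assms mult_left_mono[of r 1 p] by auto
        have "(1 - p + p * r) ^ card U \<le> (1 - p + p * r) ^ M"
          by (rule power_decreasing[OF MU *])
        thus "(1 - p + p * r) ^ card U \<le> r" using assms(8) by linarith
      qed (use assms in auto)
      finally show ?thesis by (simp add: b mult.commute)
    qed
  qed
qed

section \<open>The expected number of components\<close>

definition ecomp :: "nat \<Rightarrow> real \<Rightarrow> real" where
  "ecomp n p = bexp p (complete_edges n) (\<lambda>E. real (ncomp {..<n} E))"

lemma gcomp_subset: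
  assumes "E \<subseteq> complete_edges n" "v < n"
  shows "gcomp E v \<subseteq> {..<n}"
  using gcomp_reach[OF assms] reach_subset[of E "{v}" "{..<n} - {v}"] assms(2) by auto

lemma card_gcomp:
  assumes "E \<subseteq> complete_edges n" "v < n"
  shows "card (gcomp E v) = Suc (card (reach E {v} ({..<n} - {v})))"
  unfolding gcomp_reach[OF assms]
  using reach_subset[of E "{v}" "{..<n} - {v}"] by (intro card_insert_disjoint finite_reach) auto

lemma card_reach_less:
  assumes "v < n"
  shows "card (reach E {v} ({..<n} - {v})) < n"
proof -
  have "card (reach E {v} ({..<n} - {v})) \<le> card ({..<n} - {v})"
    by (intro card_mono reach_subset) simp
  also have "\<dots> < n" using assms by simp
  finally show ?thesis .
qed

text \<open>A component of size s is counted by each of its s vertices with weight 1/s. The number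
  of components thereby becomes a statistic of explorations from single vertices.\<close>

lemma ncomp_eq_sum:
  assumes "E \<subseteq> complete_edges n"
  shows "real (ncomp {..<n} E) = (\<Sum>v<n. 1 / real (card (gcomp E v)))"
proof -
  have "(\<Sum>v<n. 1 / real (card (gcomp E v))) =
      (\<Sum>C\<in>gcomp E ` {..<n}. \<Sum>v\<in>{v. v \<in> {..<n} \<and> gcomp E v = C}. 1 / real (card (gcomp E v)))"
    by (rule sum.image_gen) simp
  also have "\<dots> = (\<Sum>C\<in>gcomp E ` {..<n}. 1)"
  proof (rule sum.cong[OF refl])
    fix C assume "C \<in> gcomp E ` {..<n}"
    then obtain w where w: "w < n" "C = gcomp E w" by auto
    have C: "{v. v \<in> {..<n} \<and> gcomp E v = C} = C"
      using gcomp_subset[OF assms w(1)] comp_eq_iff[of E _ w] unfolding w(2) by blast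
    have "card C > 0"
      using comp_refl[of w E] gcomp_subset[OF assms w(1)] finite_subset[of C "{..<n}"]
      unfolding w(2) card_gt_0_iff by blast
    moreover have "(\<Sum>v\<in>{v. v \<in> {..<n} \<and> gcomp E v = C}. 1 / real (card (gcomp E v))) =
        (\<Sum>v\<in>{v. v \<in> {..<n} \<and> gcomp E v = C}. 1 / real (card C))"
      by (rule sum.cong) auto
    ultimately show "(\<Sum>v\<in>{v. v \<in> {..<n} \<and> gcomp E v = C}. 1 / real (card (gcomp E v))) = 1"
      unfolding C by simp
  qed
  finally show ?thesis by (simp add: ncomp_def)
qed

lemma bexp_reach_vertex:
  assumes "v < n"
  shows "bexp p (complete_edges n) (\<lambda>E. of_bool (card (reach E {v} ({..<n} - {v})) = j)) =
         explore_prob p 1 (n - 1) j"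
  using bexp_reach_card[of "{v}" "{..<n} - {v}" p j] assms by (simp add: explore_edges_complete)

text \<open>All vertices contribute equally. The index \<open>j\<close> counts the vertices
  discovered besides the starting one, so the component has size \<open>Suc j\<close>.\<close>

lemma ecomp_eq_sum:
  "ecomp n p = real n * (\<Sum>j<n. explore_prob p 1 (n - 1) j / real (Suc j))"
proof -
  have "ecomp n p = bexp p (complete_edges n) (\<lambda>E. \<Sum>v<n. \<Sum>j<n.
      1 / real (Suc j) * of_bool (card (reach E {v} ({..<n} - {v})) = j))"
    unfolding ecomp_def
  proof (rule bexp_cong)
    fix E assume E: "E \<subseteq> complete_edges n"
    have "real (ncomp {..<n} E) = (\<Sum>v<n. 1 / real (Suc (card (reach E {v} ({..<n} - {v})))))"
      unfolding ncomp_eq_sum[OF E] using card_gcomp[OF E] by (intro sum.cong) auto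
    also have "\<dots> = (\<Sum>v<n. \<Sum>j<n. if card (reach E {v} ({..<n} - {v})) = j then 1 / real (Suc j) else 0)"
    proof (rule sum.cong[OF refl])
      fix v assume "v \<in> {..<n}"
      thus "1 / real (Suc (card (reach E {v} ({..<n} - {v})))) =
        (\<Sum>j<n. if card (reach E {v} ({..<n} - {v})) = j then 1 / real (Suc j) else 0)"
        by (subst sum.delta') (use card_reach_less in auto)
    qed
    also have "\<dots> = (\<Sum>v<n. \<Sum>j<n. 1 / real (Suc j) * of_bool (card (reach E {v} ({..<n} - {v})) = j))"
      by (intro sum.cong refl) (simp add: of_bool_def)
    finally show "real (ncomp {..<n} E) = \<dots>" .
  qed
  also have "\<dots> = (\<Sum>v<n. \<Sum>j<n. 1 / real (Suc j) * explore_prob p 1 (n - 1) j)"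
    unfolding bexp_sum bexp_cmult by (intro sum.cong refl arg_cong2[where f = "(*)"] bexp_reach_vertex) auto
  finally show ?thesis by simp
qed

lemma explore_prob_vertex_nonneg:
  assumes "0 \<le> p" "p \<le> 1" "0 < n"
  shows "0 \<le> explore_prob p 1 (n - 1) j"
proof -
  have "bexp p (complete_edges n) (\<lambda>_. 0) \<le>
      bexp p (complete_edges n) (\<lambda>E. of_bool (card (reach E {0} ({..<n} - {0})) = j))"
    using assms by (intro bexp_mono) auto
  thus ?thesis using assms unfolding bexp_reach_vertex[OF assms(3)] by simp
qed

lemma explore_prob_vertex_sum_le:
  assumes "0 \<le> p" "p \<le> 1" "0 < n"
  shows "(\<Sum>j<J. explore_prob p 1 (n - 1) j) \<le> 1"
proof -
  have "(\<Sum>j<J. explore_prob p 1 (n - 1) j) =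
     bexp p (complete_edges n) (\<lambda>E. \<Sum>j<J. of_bool (card (reach E {0} ({..<n} - {0})) = j))"
    unfolding bexp_sum bexp_reach_vertex[OF assms(3)] ..
  also have "\<dots> \<le> bexp p (complete_edges n) (\<lambda>_. 1)"
    by (intro bexp_mono assms) (simp add: of_bool_def sum.delta)
  finally show ?thesis by simp
qed

section \<open>The Borel-Tanner law as the limit of the exploration\<close>

text \<open>Probability that a branching process with Poisson offspring of mean \<open>x\<close> and
  \<open>a\<close> ancestors has \<open>j\<close> descendants besides them. For \<open>a = 0\<close>
  the formula would divide zero by zero at \<open>j = 0\<close>.\<close>

definition borel_tanner :: "real \<Rightarrow> nat \<Rightarrow> nat \<Rightarrow> real" where
  "borel_tanner x a j = (if a = 0 then of_bool (j = 0) else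
     real a / real (a + j) * exp (- real (a + j) * x) * (real (a + j) * x) ^ j / fact j)"

text \<open>The binomial theorem for the summand with \<open>real b\<close>; for the one with
  \<open>real i\<close>, the absorption of \<open>i\<close> into the binomial coefficient lowers
  \<open>j\<close> by one.\<close>

lemma sum_binomial_weighted:
  "(\<Sum>i\<le>j. real (j choose i) * (real b + real i) * m ^ (j - i)) =
     real b * (m + 1) ^ j + real j * (m + 1) ^ (j - 1)"
proof -
  have bin: "(\<Sum>i\<le>k. real (k choose i) * m ^ (k - i)) = (m + 1) ^ k" for k
    using binomial_ring[of 1 m k] by (simp add: add.commute)
  have "(\<Sum>i\<le>j. real i * real (j choose i) * m ^ (j - i)) = real j * (m + 1) ^ (j - 1)"
  proof (cases j)
    case (Suc k)
    have "(\<Sum>i\<le>Suc k. real i * real (Suc k choose i) * m ^ (Suc k - i)) =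
        (\<Sum>i\<le>k. real (Suc i) * real (Suc k choose Suc i) * m ^ (k - i))"
      by (subst sum.atMost_Suc_shift) simp
    also have "\<dots> = (\<Sum>i\<le>k. real (Suc k) * (real (k choose i) * m ^ (k - i)))"
    proof (rule sum.cong[OF refl])
      fix i
      have "real (Suc i) * real (Suc k choose Suc i) = real (Suc k) * real (k choose i)"
        using Suc_times_binomial_eq[of k i] by (metis of_nat_mult mult.commute)
      thus "real (Suc i) * real (Suc k choose Suc i) * m ^ (k - i) = real (Suc k) * (real (k choose i) * m ^ (k - i))"
        by simp
    qed
    also have "\<dots> = real (Suc k) * (m + 1) ^ k" by (simp only: bin flip: sum_distrib_left)
    finally show ?thesis using Suc by simp
  qed simp
  moreover have "(\<Sum>i\<le>j. real (j choose i) * (real b + real i) * m ^ (j - i)) =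
     real b * (\<Sum>i\<le>j. real (j choose i) * m ^ (j - i)) + (\<Sum>i\<le>j. real i * real (j choose i) * m ^ (j - i))"
    by (simp add: sum_distrib_left distrib_left distrib_right sum.distrib mult_ac)
  ultimately show ?thesis by (simp add: bin)
qed

text \<open>Condition on the Poisson number \<open>i\<close> of children of one ancestor. The
  remaining individuals number \<open>m = b + j\<close> whatever \<open>i\<close> is, so all powers
  have the same base and only a binomial sum is left.\<close>

lemma borel_tanner_recursion:
  "borel_tanner x (Suc b) j = (\<Sum>i\<le>j. x ^ i / fact i * exp (- x) * borel_tanner x (b + i) (j - i))"
proof (cases "b + j = 0")
  case True
  thus ?thesis by (simp add: borel_tanner_def)
next
  case False
  define m where "m = real (b + j)"
  have m: "m > 0" using False unfolding m_def by linarith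
  have "(\<Sum>i\<le>j. x ^ i / fact i * exp (- x) * borel_tanner x (b + i) (j - i)) =
        (\<Sum>i\<le>j. exp (- (m + 1) * x) * x ^ j / (m * fact j) * (real (j choose i) * (real b + real i) * m ^ (j - i)))"
  proof (rule sum.cong[OF refl])
    fix i assume i: "i \<in> {..j}"
    have "borel_tanner x (b + i) (j - i) = (real b + real i) / m * exp (- m * x) * (m * x) ^ (j - i) / fact (j - i)"
      using i False by (auto simp: borel_tanner_def m_def)
    hence "x ^ i / fact i * exp (- x) * borel_tanner x (b + i) (j - i) =
        (exp (- x) * exp (- m * x)) * (x ^ i * x ^ (j - i)) / m * (1 / (fact i * fact (j - i))) * (real b + real i) * m ^ (j - i)"
      by (simp add: power_mult_distrib mult_ac)
    also have "exp (- x) * exp (- m * x) = exp (- (m + 1) * x)" by (simp add: algebra_simps flip: exp_add)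
    also have "x ^ i * x ^ (j - i) = x ^ j" using i by (simp flip: power_add)
    also have "1 / (fact i * fact (j - i)) = real (j choose i) / fact j" using i by (simp add: binomial_fact)
    finally show "x ^ i / fact i * exp (- x) * borel_tanner x (b + i) (j - i) =
        exp (- (m + 1) * x) * x ^ j / (m * fact j) * (real (j choose i) * (real b + real i) * m ^ (j - i))"
      by (simp add: mult_ac)
  qed
  also have "\<dots> = exp (- (m + 1) * x) * x ^ j / (m * fact j) * (real b * (m + 1) ^ j + real j * (m + 1) ^ (j - 1))"
    by (simp only: sum_binomial_weighted flip: sum_distrib_left)
  also have "real b * (m + 1) ^ j + real j * (m + 1) ^ (j - 1) = m * (real b + 1) / (m + 1) * (m + 1) ^ j"
  proof (cases j)
    case 0
    thus ?thesis using m by (simp add: m_def)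
  next
    case (Suc k)
    have "real b * (m + 1) + real j = m * (real b + 1)" by (simp add: m_def algebra_simps)
    hence "(real b * (m + 1) + real j) * (m + 1) ^ k = m * (real b + 1) * (m + 1) ^ k" by simp
    also have "\<dots> = m * (real b + 1) / (m + 1) * (m + 1) ^ j" using m Suc by simp
    also have "(real b * (m + 1) + real j) * (m + 1) ^ k = real b * (m + 1) ^ j + real j * (m + 1) ^ (j - 1)"
      by (simp add: Suc distrib_right)
    finally show ?thesis .
  qed
  also have "exp (- (m + 1) * x) * x ^ j / (m * fact j) * (m * (real b + 1) / (m + 1) * (m + 1) ^ j) =
      (real b + 1) / (m + 1) * exp (- (m + 1) * x) * ((m + 1) * x) ^ j / fact j"
    using m by (simp add: power_mult_distrib mult_ac)
  also have "\<dots> = borel_tanner x (Suc b) j"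
  proof -
    have "real (Suc b + j) = m + 1" "real (Suc b) = real b + 1" by (simp_all add: m_def)
    thus ?thesis by (simp only: borel_tanner_def) simp
  qed
  finally show ?thesis ..
qed

lemma binomial_poisson_limit:
  fixes x :: real
  shows "(\<lambda>n. real ((n - r) choose i) * (x / real n) ^ i) \<longlonglongrightarrow> x ^ i / fact i"
proof -
  have factor: "(\<lambda>n. (real (n - r) - real k) * (x / real n)) \<longlonglongrightarrow> x" for k
  proof -
    have lim: "(\<lambda>n. x - (real r + real k) * x / real n) \<longlonglongrightarrow> x - 0"
      by (intro tendsto_intros lim_const_over_n)
    have ev: "\<forall>\<^sub>F n in sequentially. x - (real r + real k) * x / real n = (real (n - r) - real k) * (x / real n)"
      using eventually_ge_at_top[of "Suc r"]
    proof eventually_elim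
      case (elim n)
      hence "real (n - r) = real n - real r" "real n \<noteq> 0" by auto
      thus ?case by (simp add: field_simps)
    qed
    show ?thesis using Lim_transform_eventually[OF lim ev] by simp
  qed
  have "(\<lambda>n. (\<Prod>k = 0..<i. (real (n - r) - real k) * (x / real n)) / fact i) \<longlonglongrightarrow> (\<Prod>k = 0..<i. x) / fact i"
    by (intro tendsto_divide tendsto_prod factor tendsto_const) simp
  moreover have "(\<Prod>k = 0..<i. (real (n - r) - real k) * (x / real n)) / fact i =
      real ((n - r) choose i) * (x / real n) ^ i" for n
    by (simp only: prod.distrib binomial_gbinomial gbinomial_prod_rev) simp
  ultimately show ?thesis by simp
qed

lemma one_minus_power_limit:
  fixes x :: real
  shows "(\<lambda>n. (1 - x / real n) ^ (n - s)) \<longlonglongrightarrow> exp (- x)"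
proof -
  have "(\<lambda>n. 1 - x / real n) \<longlonglongrightarrow> 1 - 0" by (intro tendsto_intros lim_const_over_n)
  hence lim1: "(\<lambda>n. 1 - x / real n) \<longlonglongrightarrow> 1" by simp
  have "(\<lambda>n. (1 + (- x) / real n) ^ n / (1 - x / real n) ^ s) \<longlonglongrightarrow> exp (- x) / 1 ^ s"
    by (intro tendsto_divide tendsto_exp_limit_sequentially tendsto_power lim1) simp
  hence lim: "(\<lambda>n. (1 - x / real n) ^ n / (1 - x / real n) ^ s) \<longlonglongrightarrow> exp (- x)" by simp
  have ev: "\<forall>\<^sub>F n in sequentially. (1 - x / real n) ^ n / (1 - x / real n) ^ s = (1 - x / real n) ^ (n - s)"
    using eventually_ge_at_top[of s] order_tendstoD(1)[OF lim1 zero_less_one]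
  proof eventually_elim
    case (elim n)
    hence "1 - x / real n \<noteq> 0" by linarith
    thus ?case using elim(1) by (rule power_diff[symmetric])
  qed
  show ?thesis using lim ev by (rule Lim_transform_eventually)
qed

text \<open>Both sides satisfy the same recursion, with binomial weights converging to Poisson
  weights. The shift \<open>r\<close> is arbitrary because each step removes a bounded number of
  unseen vertices.\<close>

lemma explore_prob_limit:
  "(\<lambda>n. explore_prob (x / real n) a (n - r) j) \<longlonglongrightarrow> borel_tanner x a j"
proof (induction "a + j" arbitrary: a j r rule: less_induct)
  case less
  show ?case
  proof (cases a)
    case 0
    thus ?thesis by (simp add: borel_tanner_def of_bool_def)
  next
    case (Suc b)
    have "(\<lambda>n. \<Sum>i\<le>j. real ((n - r) choose i) * (x / real n) ^ i * (1 - x / real n) ^ (n - (r + i)) *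
          explore_prob (x / real n) (b + i) (n - (r + i)) (j - i))
       \<longlonglongrightarrow> (\<Sum>i\<le>j. x ^ i / fact i * exp (- x) * borel_tanner x (b + i) (j - i))"
      by (intro tendsto_sum tendsto_mult binomial_poisson_limit one_minus_power_limit less) (use Suc in auto)
    thus ?thesis using Suc by (simp add: borel_tanner_recursion)
  qed
qed

section \<open>The limiting component density\<close>

text \<open>Contribution of components of size \<open>Suc k\<close>: the Borel probability of that
  size divided by the size, so that the sum \<open>kfun\<close> is the expected reciprocal
  size.\<close>

definition kterm :: "nat \<Rightarrow> real \<Rightarrow> real" where
  "kterm k x = (real (Suc k) * x) ^ k * exp (- (real (Suc k) * x)) / fact k / (real (Suc k))\<^sup>2"

definition kfun :: "real \<Rightarrow> real" where
  "kfun x = (\<Sum>k. kterm k x)"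

lemma borel_tanner_one: "borel_tanner x 1 j / real (Suc j) = kterm j x"
  by (simp add: borel_tanner_def kterm_def power2_eq_square field_simps)

lemma kterm_nonneg: "0 \<le> x \<Longrightarrow> 0 \<le> kterm k x"
  by (simp add: kterm_def)

text \<open>Apart from the last denominator the term is a Poisson probability with mean
  \<open>real (Suc k) * x\<close>, hence at most 1. The bound does not depend on \<open>x\<close>
  and serves the Weierstrass test.\<close>

lemma kterm_le:
  assumes "0 \<le> x"
  shows "kterm k x \<le> 1 / (real (Suc k))\<^sup>2"
proof -
  let ?y = "real (Suc k) * x"
  have "(\<Sum>n\<in>{k}. ?y ^ n /\<^sub>R fact n) \<le> (\<Sum>n. ?y ^ n /\<^sub>R fact n)"
    by (rule sum_le_suminf[OF summable_exp_generic]) (use assms in auto)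
  hence "?y ^ k / fact k \<le> exp ?y" by (simp add: exp_def divide_inverse mult.commute)
  hence "?y ^ k / fact k * exp (- ?y) \<le> exp ?y * exp (- ?y)" by (rule mult_right_mono) simp
  also have "\<dots> = 1" by (simp flip: exp_add)
  finally have "?y ^ k * exp (- ?y) / fact k \<le> 1" by simp
  thus ?thesis unfolding kterm_def by (rule divide_right_mono) simp
qed

lemma summable_inverse_squares_Suc: "summable (\<lambda>k. 1 / (real (Suc k))\<^sup>2)"
  using inverse_squares_sums by (simp add: sums_iff add.commute)

lemma summable_kterm: "0 \<le> x \<Longrightarrow> summable (\<lambda>k. kterm k x)"
  by (rule summable_comparison_test'[OF summable_inverse_squares_Suc, of 0])
    (simp add: kterm_le kterm_nonneg del: of_nat_Suc)

lemma kfun_nonneg: "0 \<le> x \<Longrightarrow> 0 \<le> kfun x"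
  unfolding kfun_def by (intro suminf_nonneg summable_kterm kterm_nonneg)

lemma continuous_on_kfun: "continuous_on {0..} kfun"
proof -
  have "uniform_limit {0..} (\<lambda>n x. \<Sum>k<n. kterm k x) kfun sequentially"
    unfolding kfun_def
    by (rule Weierstrass_m_test[OF _ summable_inverse_squares_Suc]) (auto simp: kterm_le kterm_nonneg simp del: of_nat_Suc)
  thus ?thesis
    by (rule uniform_limit_theorem[rotated])
      (auto simp: kterm_def intro!: always_eventually continuous_intros)
qed

lemma kfun_0: "kfun 0 = 1"
proof -
  have "kterm k 0 = (if k = 0 then 1 else 0)" for k by (simp add: kterm_def)
  hence "(\<lambda>k. kterm k 0) = (\<lambda>k. if k = 0 then 1 else 0)" by auto
  thus ?thesis using sums_single[of 0 "\<lambda>_. 1 :: real"] by (simp add: kfun_def sums_iff)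
qed

text \<open>Inherited from the finite graphs, where the sizes have a probability distribution. Mass
  may be lost in the limit, namely to a giant component.\<close>

lemma borel_tanner_sum_le:
  assumes "0 \<le> x"
  shows "(\<Sum>j<J. borel_tanner x 1 j) \<le> 1"
proof (rule LIMSEQ_le_const2)
  show "(\<lambda>n. \<Sum>j<J. explore_prob (x / real n) 1 (n - 1) j) \<longlonglongrightarrow> (\<Sum>j<J. borel_tanner x 1 j)"
    by (intro tendsto_sum explore_prob_limit)
  obtain N where N: "x \<le> real N" using real_arch_simple by blast
  show "\<exists>N. \<forall>n\<ge>N. (\<Sum>j<J. explore_prob (x / real n) 1 (n - 1) j) \<le> 1"
  proof (intro exI[of _ "Suc N"] allI impI)
    fix n assume "Suc N \<le> n"
    hence "x \<le> real n" "0 < n" using N by linarith+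
    thus "(\<Sum>j<J. explore_prob (x / real n) 1 (n - 1) j) \<le> 1"
      using assms by (intro explore_prob_vertex_sum_le) auto
  qed
qed

text \<open>Each probability converges, and vertices in components of size above \<open>J\<close>
  contribute at most \<open>1 / real (Suc J)\<close> in total because of the weight 1/size. Hence no
  tightness is required, although a giant component may carry away mass.\<close>

lemma ecomp_limit:
  assumes x: "0 \<le> x"
  shows "(\<lambda>n. ecomp n (x / real n) / real n) \<longlonglongrightarrow> kfun x"
proof (rule LIMSEQ_I)
  fix e :: real assume e: "e > 0"
  define a where "a = (\<lambda>n j. explore_prob (x / real n) 1 (n - 1) j)"
  have "(\<lambda>J. \<Sum>j<J. kterm j x) \<longlonglongrightarrow> kfun x"
    unfolding kfun_def by (rule summable_LIMSEQ[OF summable_kterm[OF x]])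
  from LIMSEQ_D[OF this, of "e / 3"] e obtain J1
    where J1: "\<And>J. J \<ge> J1 \<Longrightarrow> \<bar>(\<Sum>j<J. kterm j x) - kfun x\<bar> < e / 3" by auto
  obtain J2 where J2: "1 / real (Suc J2) < e / 3"
    using reals_Archimedean[of "e / 3"] e by (auto simp: inverse_eq_divide)
  define J where "J = max J1 J2"
  have Je: "1 / real (Suc J) < e / 3"
    using J2 by (rule order.strict_trans1[rotated]) (simp add: J_def frac_le)
  have "(\<lambda>n. \<Sum>j<J. a n j / real (Suc j)) \<longlonglongrightarrow> (\<Sum>j<J. borel_tanner x 1 j / real (Suc j))"
    unfolding a_def by (intro tendsto_sum tendsto_divide explore_prob_limit tendsto_const) simp
  hence "(\<lambda>n. \<Sum>j<J. a n j / real (Suc j)) \<longlonglongrightarrow> (\<Sum>j<J. kterm j x)"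
    by (simp only: borel_tanner_one)
  from LIMSEQ_D[OF this, of "e / 3"] e obtain N1
    where N1: "\<And>n. n \<ge> N1 \<Longrightarrow> \<bar>(\<Sum>j<J. a n j / real (Suc j)) - (\<Sum>j<J. kterm j x)\<bar> < e / 3" by auto
  obtain N2 where N2: "x \<le> real N2" using real_arch_simple by blast
  show "\<exists>no. \<forall>n\<ge>no. norm (ecomp n (x / real n) / real n - kfun x) < e"
  proof (intro exI[of _ "Suc (max (max N1 N2) J)"] allI impI)
    fix n assume n: "n \<ge> Suc (max (max N1 N2) J)"
    hence nx: "x \<le> real n" "0 < n" "J \<le> n" "n \<ge> N1" using N2 by linarith+
    have p: "0 \<le> x / real n" "x / real n \<le> 1" using x nx by auto
    have a0: "0 \<le> a n j" for j unfolding a_def using explore_prob_vertex_nonneg[OF p nx(2)] .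
    have "ecomp n (x / real n) / real n = (\<Sum>j<n. a n j / real (Suc j))"
      using nx(2) by (simp add: ecomp_eq_sum a_def)
    also have "\<dots> = (\<Sum>j<J. a n j / real (Suc j)) + (\<Sum>j=J..<n. a n j / real (Suc j))"
      using sum.atLeastLessThan_concat[of 0 J n "\<lambda>j. a n j / real (Suc j)"] nx(3)
      by (simp add: lessThan_atLeast0)
    finally have split: "ecomp n (x / real n) / real n = \<dots>" .
    have "(\<Sum>j=J..<n. a n j / real (Suc j)) \<le> (\<Sum>j=J..<n. a n j / real (Suc J))"
      by (intro sum_mono divide_left_mono a0) auto
    also have "\<dots> \<le> (\<Sum>j<n. a n j / real (Suc J))"
      by (intro sum_mono2) (use a0 in auto)
    also have "\<dots> = (\<Sum>j<n. a n j) / real (Suc J)" by (simp add: sum_divide_distrib)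
    also have "\<dots> \<le> 1 / real (Suc J)"
      unfolding a_def by (intro divide_right_mono explore_prob_vertex_sum_le p nx) simp
    finally have up: "(\<Sum>j=J..<n. a n j / real (Suc j)) < e / 3" using Je by linarith
    have lo: "0 \<le> (\<Sum>j=J..<n. a n j / real (Suc j))" by (intro sum_nonneg) (simp add: a0)
    have "\<bar>(\<Sum>j<J. kterm j x) - kfun x\<bar> < e / 3" by (rule J1) (simp add: J_def)
    thus "norm (ecomp n (x / real n) / real n - kfun x) < e"
      using N1[OF nx(4)] up lo unfolding split real_norm_def by linarith
  qed
qed

lemma ecomp_antimono:
  assumes "0 \<le> p" "p \<le> p'" "p' \<le> 1"
  shows "ecomp n p' \<le> ecomp n p"
  unfolding ecomp_def using assms by (intro bexp_antimono_prob) (auto intro: ncomp_mono)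

text \<open>Read off the random graphs, where adding edges merges components. The series does not
  show it term by term, since the terms with positive index first increase.\<close>

lemma kfun_antimono:
  assumes "0 \<le> x" "x \<le> y"
  shows "kfun y \<le> kfun x"
proof (rule LIMSEQ_le[OF ecomp_limit ecomp_limit])
  obtain N where N: "y \<le> real N" using real_arch_simple by blast
  show "\<exists>N. \<forall>n\<ge>N. ecomp n (y / real n) / real n \<le> ecomp n (x / real n) / real n"
  proof (intro exI[of _ "Suc N"] allI impI)
    fix n assume "n \<ge> Suc N"
    hence "y \<le> real n" "0 < n" using N by linarith+
    thus "ecomp n (y / real n) / real n \<le> ecomp n (x / real n) / real n"
      using assms by (intro divide_right_mono ecomp_antimono) (auto simp: divide_right_mono)
  qed
qed (use assms in auto)

lemma kfun_le_one: "0 \<le> x \<Longrightarrow> kfun x \<le> 1"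
  using kfun_antimono[of 0 x] by (simp add: kfun_0)

text \<open>Isolated vertices have probability \<open>exp (- x)\<close> and weight 1; all other
  sizes have weight at most 1/2 and total mass at most \<open>1 - exp (- x)\<close>.\<close>

lemma kfun_less_one:
  assumes "0 < x"
  shows "kfun x < 1"
proof -
  have "kfun x \<le> exp (- x) + (1 - exp (- x)) / 2"
    unfolding kfun_def
  proof (rule suminf_le_const[OF summable_kterm])
    fix J
    have k0: "kterm 0 x = borel_tanner x 1 0" using borel_tanner_one[of x 0] by simp
    have t0: "borel_tanner x 1 0 = exp (- x)" by (simp add: borel_tanner_def)
    have nn: "0 \<le> borel_tanner x 1 j" for j using assms by (simp add: borel_tanner_def)
    have "(\<Sum>j<J. kterm j x) \<le> (\<Sum>j<Suc J. kterm j x)"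
      using kterm_nonneg[of x J] assms by simp
    also have "\<dots> = borel_tanner x 1 0 + (\<Sum>j<J. borel_tanner x 1 (Suc j) / real (Suc (Suc j)))"
      by (subst sum.lessThan_Suc_shift) (simp only: k0 borel_tanner_one)
    also have "(\<Sum>j<J. borel_tanner x 1 (Suc j) / real (Suc (Suc j))) \<le> (\<Sum>j<J. borel_tanner x 1 (Suc j) / 2)"
      by (intro sum_mono divide_left_mono nn) auto
    also have "\<dots> = (\<Sum>j<J. borel_tanner x 1 (Suc j)) / 2" by (simp add: sum_divide_distrib)
    also have "(\<Sum>j<J. borel_tanner x 1 (Suc j)) = (\<Sum>j<Suc J. borel_tanner x 1 j) - borel_tanner x 1 0"
      by (subst sum.lessThan_Suc_shift) simp
    also have "\<dots> / 2 \<le> (1 - borel_tanner x 1 0) / 2"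
      using borel_tanner_sum_le[of x "Suc J"] assms by (intro divide_right_mono diff_right_mono) auto
    finally show "(\<Sum>j<J. kterm j x) \<le> exp (- x) + (1 - exp (- x)) / 2" by (simp only: t0)
  qed (use assms in simp)
  also have "\<dots> < 1" using assms by (simp add: field_simps)
  finally show ?thesis .
qed

section \<open>Exponential bounds and connectivity\<close>

text \<open>At most one component contains more than half of the vertices; each of the others
  contains a vertex that is counted on the right.\<close>

lemma ncomp_le_small_vertices:
  assumes "E \<subseteq> complete_edges n"
  shows "real (ncomp {..<n} E) - 1 \<le> (\<Sum>v<n. of_bool (2 * card (gcomp E v) \<le> n))"
proof -
  let ?P = "gcomp E ` {..<n}"
  let ?S = "{v\<in>{..<n}. 2 * card (gcomp E v) \<le> n}"
  define L where "L = {C\<in>?P. \<not> 2 * card C \<le> n}"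
  have "C = D" if CD: "C \<in> L" "D \<in> L" for C D
  proof (rule ccontr)
    assume ne: "C \<noteq> D"
    obtain u v where uv: "u < n" "v < n" "C = gcomp E u" "D = gcomp E v" using CD unfolding L_def by blast
    have sub: "C \<subseteq> {..<n}" "D \<subseteq> {..<n}" using uv gcomp_subset[OF assms] by auto
    have "C \<inter> D = {}"
    proof (rule ccontr)
      assume "C \<inter> D \<noteq> {}"
      then obtain w where "w \<in> C" "w \<in> D" by blast
      hence "gcomp E w = C" "gcomp E w = D" using comp_eqI uv by metis+
      thus False using ne by simp
    qed
    hence "card C + card D = card (C \<union> D)"
      using sub by (intro card_Un_disjoint[symmetric]) (auto intro: finite_subset)
    also have "\<dots> \<le> n" using sub card_mono[of "{..<n}" "C \<union> D"] by simp
    finally show False using CD by (auto simp: L_def)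
  qed
  hence "card L \<le> 1" using card_le_Suc0_iff_eq[of L] by (simp add: L_def)
  have "?P \<subseteq> L \<union> gcomp E ` ?S" by (auto simp: L_def)
  hence "ncomp {..<n} E \<le> card (L \<union> gcomp E ` ?S)"
    unfolding ncomp_def by (intro card_mono) (auto simp: L_def)
  also have "\<dots> \<le> card L + card (gcomp E ` ?S)" by (rule card_Un_le)
  also have "\<dots> \<le> 1 + card ?S" by (intro add_mono \<open>card L \<le> 1\<close> card_image_le) simp
  finally have "real (ncomp {..<n} E) \<le> 1 + real (card ?S)" by linarith
  also have "real (card ?S) = (\<Sum>v<n. of_bool (2 * card (gcomp E v) \<le> n))"
    by (simp add: of_bool_def sum.If_cases Int_def)
  finally show ?thesis by simp
qed

text \<open>\<open>r = exp (- x / 6)\<close> satisfies the hypothesis of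
  \<open>bexp_reach_small\<close> for \<open>M = n div 2\<close>: since \<open>M\<close> is at least
  n/3 and \<open>1 - r\<close> at least 1/2, the power is at most exp (- (n/3) (x/n) / 2), which is
  \<open>r\<close> again. A vertex in a component of at most half the size leaves at least
  \<open>M\<close> vertices undiscovered.\<close>

lemma ecomp_tail:
  assumes "2 \<le> n" "6 * ln 2 \<le> x" "x \<le> real n"
  shows "ecomp n (x / real n) - 1 \<le> real n * exp (- x / 6)"
proof -
  define p where "p = x / real n"
  define r where "r = exp (- x / 6)"
  have "0 < ln (2 :: real)" by simp
  hence x0: "0 \<le> x" using assms(2) by linarith
  have p: "0 \<le> p" "p \<le> 1" using assms x0 by (auto simp: p_def)
  have "r \<le> exp (- ln 2)" unfolding r_def using assms(2) by simp
  hence r: "0 \<le> r" "r \<le> 1 / 2" by (auto simp: r_def exp_minus)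
  \<comment> \<open>Among all \<open>n\<close> from 2 on, equality holds for 3 only; this rounding
    loss is why the exponent has a 6 and not a 4.\<close>
  have M: "real (n div 2) \<ge> real n / 3"
  proof -
    have "3 * (n div 2) \<ge> n" using assms(1) by presburger
    hence "3 * real (n div 2) \<ge> real n" by (metis of_nat_le_iff of_nat_mult of_nat_numeral)
    thus ?thesis by simp
  qed
  have "(1 - p + p * r) ^ (n div 2) \<le> exp (- (p * (1 - r))) ^ (n div 2)"
  proof (rule power_mono)
    show "1 - p + p * r \<le> exp (- (p * (1 - r)))"
      using exp_ge_add_one_self[of "- (p * (1 - r))"] by (simp add: algebra_simps)
    show "0 \<le> 1 - p + p * r" using p r by (simp add: add_nonneg_nonneg)
  qed
  also have "\<dots> = exp (- (real (n div 2) * (p * (1 - r))))" by (simp flip: exp_of_nat_mult)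
  also have "\<dots> \<le> r"
  proof -
    have "real n / 3 * (p * (1 / 2)) \<le> real (n div 2) * (p * (1 - r))"
      by (intro mult_mono M) (use p r in auto)
    moreover have "real n / 3 * (p * (1 / 2)) = x / 6" using assms(1) by (simp add: p_def)
    ultimately show ?thesis unfolding r_def by simp
  qed
  finally have pow: "(1 - p + p * r) ^ (n div 2) \<le> r" .
  have "ecomp n p - 1 = bexp p (complete_edges n) (\<lambda>E. real (ncomp {..<n} E) - 1)"
    by (simp add: bexp_diff ecomp_def)
  also have "\<dots> \<le> bexp p (complete_edges n) (\<lambda>E. \<Sum>v<n. of_bool (2 * card (gcomp E v) \<le> n))"
    by (intro bexp_mono p ncomp_le_small_vertices)
  also have "\<dots> = (\<Sum>v<n. bexp p (complete_edges n) (\<lambda>E. of_bool (2 * card (gcomp E v) \<le> n)))"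
    by (rule bexp_sum)
  also have "\<dots> \<le> (\<Sum>v<n. r)"
  proof (rule sum_mono)
    fix v assume "v \<in> {..<n}"
    hence v: "v < n" by simp
    let ?U = "{..<n} - {v}"
    have "bexp p (complete_edges n) (\<lambda>E. of_bool (2 * card (gcomp E v) \<le> n)) \<le>
          bexp p (complete_edges n) (\<lambda>E. of_bool (card (reach E {v} ?U) + n div 2 \<le> card ?U))"
    proof (rule bexp_mono[OF p])
      fix E assume E: "E \<subseteq> complete_edges n"
      have "card (reach E {v} ?U) + n div 2 \<le> card ?U" if "2 * card (gcomp E v) \<le> n"
        using that v unfolding card_gcomp[OF E v] by simp
      thus "of_bool (2 * card (gcomp E v) \<le> n) \<le> (of_bool (card (reach E {v} ?U) + n div 2 \<le> card ?U) :: real)"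
        by (auto simp: of_bool_def)
    qed
    also have "\<dots> \<le> r ^ card {v}"
      unfolding explore_edges_complete[OF v, symmetric]
      by (rule bexp_reach_small) (use p r pow in auto)
    finally show "bexp p (complete_edges n) (\<lambda>E. of_bool (2 * card (gcomp E v) \<le> n)) \<le> r" by simp
  qed
  finally show ?thesis by (simp add: p_def r_def)
qed

lemma kfun_tail:
  assumes "6 * ln 2 \<le> x"
  shows "kfun x \<le> exp (- x / 6)"
proof -
  have "0 < ln (2 :: real)" by simp
  hence x0: "0 \<le> x" using assms by linarith
  have "(\<lambda>n. ecomp n (x / real n) / real n - 1 / real n) \<longlonglongrightarrow> kfun x - 0"
    by (intro tendsto_diff ecomp_limit x0 lim_const_over_n)
  hence "(\<lambda>n. ecomp n (x / real n) / real n - 1 / real n) \<longlonglongrightarrow> kfun x" by simp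
  thus ?thesis
  proof (rule LIMSEQ_le_const2)
    obtain N where N: "x \<le> real N" using real_arch_simple by blast
    show "\<exists>N. \<forall>n\<ge>N. ecomp n (x / real n) / real n - 1 / real n \<le> exp (- x / 6)"
    proof (intro exI[of _ "N + 2"] allI impI)
      fix n assume "n \<ge> N + 2"
      hence n: "x \<le> real n" "2 \<le> n" using N by linarith+
      thus "ecomp n (x / real n) / real n - 1 / real n \<le> exp (- x / 6)"
        using ecomp_tail[OF n(2) assms n(1)] by (simp add: field_simps)
    qed
  qed
qed

text \<open>The factor 2 covers \<open>x < 6 * ln 2\<close>, where the right-hand side exceeds the
  trivial bound 1.\<close>

lemma kfun_le_exp:
  assumes "0 \<le> x"
  shows "kfun x \<le> 2 * exp (- x / 6)"
proof (cases "6 * ln 2 \<le> x")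
  case True
  thus ?thesis using kfun_tail[OF True] exp_ge_zero[of "- x / 6"] by linarith
next
  case False
  hence "exp (- ln 2) \<le> exp (- x / 6)" by simp
  thus ?thesis using kfun_le_one[OF assms] by (simp add: exp_minus)
qed

section \<open>Mean deviation of the component count from its limit\<close>

text \<open>A function of \<open>n\<close> and the rate \<open>x\<close> alone, so that the same
  estimates serve every distribution of edge lengths; the distribution enters only through the rate
  at a level.\<close>

definition comp_deviation :: "nat \<Rightarrow> real \<Rightarrow> real" where
  "comp_deviation n x = bexp (x / real n) (complete_edges n)
     (\<lambda>E. \<bar>(real (ncomp {..<n} E) - 1) / real n - kfun x\<bar>)"

lemma ecomp_excess_le_exp:
  assumes "2 \<le> n" "0 \<le> x" "x \<le> real n"
  shows "(ecomp n (x / real n) - 1) / real n \<le> 2 * exp (- x / 6)"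
proof (cases "6 * ln 2 \<le> x")
  case True
  have "(ecomp n (x / real n) - 1) / real n \<le> (real n * exp (- x / 6)) / real n"
    by (intro divide_right_mono ecomp_tail assms True) simp
  also have "\<dots> = exp (- x / 6)" using assms(1) by simp
  also have "\<dots> \<le> 2 * exp (- x / 6)" by simp
  finally show ?thesis .
next
  case False
  have "ecomp n (x / real n) \<le> bexp (x / real n) (complete_edges n) (\<lambda>_. real n)"
    unfolding ecomp_def by (rule bexp_mono) (use assms in \<open>auto intro: ncomp_le\<close>)
  hence "(ecomp n (x / real n) - 1) / real n \<le> 1" using assms by simp
  moreover have "exp (- ln 2) \<le> exp (- x / 6)" using False by simp
  hence "1 \<le> 2 * exp (- x / 6)" by (simp add: exp_minus)
  ultimately show ?thesis by linarith
qed

text \<open>The majorant for dominated convergence over the levels. Excess and limit are both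
  nonnegative, so the deviation is at most their sum.\<close>

lemma comp_deviation_le:
  assumes "2 \<le> n" "0 \<le> x" "x \<le> real n"
  shows "comp_deviation n x \<le> 4 * exp (- x / 6)"
proof -
  have "comp_deviation n x \<le> bexp (x / real n) (complete_edges n)
     (\<lambda>E. 1 / real n * (real (ncomp {..<n} E) - 1) + kfun x)"
    unfolding comp_deviation_def
  proof (rule bexp_mono)
    fix E
    have "1 \<le> real (ncomp {..<n} E)" using ncomp_pos[of n E] assms(1) by simp
    hence "0 \<le> (real (ncomp {..<n} E) - 1) / real n" by simp
    thus "\<bar>(real (ncomp {..<n} E) - 1) / real n - kfun x\<bar> \<le> 1 / real n * (real (ncomp {..<n} E) - 1) + kfun x"
      using kfun_nonneg[OF assms(2)] by simp
  qed (use assms in auto)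
  also have "\<dots> = (ecomp n (x / real n) - 1) / real n + kfun x"
    unfolding bexp_add bexp_cmult bexp_diff ecomp_def by simp
  also have "\<dots> \<le> 2 * exp (- x / 6) + 2 * exp (- x / 6)"
    by (intro add_mono ecomp_excess_le_exp kfun_le_exp assms)
  finally show ?thesis by simp
qed

lemma card_complete_edges_le: "card (complete_edges n) \<le> n\<^sup>2"
proof -
  have "card (complete_edges n) = n choose 2"
    using n_subsets[of "{..<n}" 2] by (simp add: complete_edges_def)
  thus ?thesis using binomial_le_pow[of 2 n] by (cases "2 \<le> n") (auto simp: binomial_eq_0)
qed

text \<open>Three errors vanish: the fluctuation, at most \<open>sqrt (x * real n)\<close> before
  division by n; the subtracted 1; and the bias of the mean.\<close>

lemma comp_deviation_limit:
  assumes x: "0 \<le> x"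
  shows "(\<lambda>n. comp_deviation n x) \<longlonglongrightarrow> 0"
proof (rule tendsto_sandwich)
  obtain N where N: "x \<le> real N" using real_arch_simple by blast
  let ?b = "\<lambda>n. sqrt (x / real n) + 1 / real n + \<bar>ecomp n (x / real n) / real n - kfun x\<bar>"
  have ev: "\<forall>\<^sub>F n in sequentially. x \<le> real n \<and> 0 < n"
    using eventually_ge_at_top[of "Suc N"] by eventually_elim (use N in linarith)
  show "\<forall>\<^sub>F n in sequentially. 0 \<le> comp_deviation n x"
    using ev
  proof eventually_elim
    case (elim n)
    hence "bexp (x / real n) (complete_edges n) (\<lambda>_. 0) \<le> comp_deviation n x"
      unfolding comp_deviation_def using x by (intro bexp_mono) auto
    thus ?case by simp
  qed
  show "\<forall>\<^sub>F n in sequentially. comp_deviation n x \<le> ?b n"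
    using ev
  proof eventually_elim
    case (elim n)
    define p where "p = x / real n"
    have p: "0 \<le> p" "p \<le> 1" using x elim by (auto simp: p_def)
    let ?m = "ecomp n p"
    have "comp_deviation n x \<le> bexp p (complete_edges n)
       (\<lambda>E. 1 / real n * \<bar>real (ncomp {..<n} E) - ?m\<bar> + (1 / real n + \<bar>?m / real n - kfun x\<bar>))"
      unfolding comp_deviation_def p_def[symmetric]
    proof (rule bexp_mono[OF p])
      fix E
      have "(real (ncomp {..<n} E) - 1) / real n - kfun x =
         1 / real n * (real (ncomp {..<n} E) - ?m) + (- (1 / real n) + (?m / real n - kfun x))"
        by (simp add: diff_divide_distrib)
      moreover have "\<bar>1 / real n * (real (ncomp {..<n} E) - ?m)\<bar> = 1 / real n * \<bar>real (ncomp {..<n} E) - ?m\<bar>"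
        by (simp add: abs_mult)
      moreover have "0 \<le> 1 / real n" by simp
      ultimately show "\<bar>(real (ncomp {..<n} E) - 1) / real n - kfun x\<bar> \<le>
        1 / real n * \<bar>real (ncomp {..<n} E) - ?m\<bar> + (1 / real n + \<bar>?m / real n - kfun x\<bar>)" by linarith
    qed
    also have "\<dots> = 1 / real n * bexp p (complete_edges n) (\<lambda>E. \<bar>real (ncomp {..<n} E) - ?m\<bar>)
        + (1 / real n + \<bar>?m / real n - kfun x\<bar>)"
      unfolding bexp_add bexp_cmult by simp
    also have "bexp p (complete_edges n) (\<lambda>E. \<bar>real (ncomp {..<n} E) - ?m\<bar>) \<le> sqrt (p * real (card (complete_edges n)))"
      unfolding ecomp_def
    proof (rule bexp_abs_deviation[OF finite_complete_edges p])
      fix S e assume "e \<in> complete_edges n"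
      thus "\<bar>real (ncomp {..<n} (insert e S)) - real (ncomp {..<n} S)\<bar> \<le> 1"
        using ncomp_insert_le[of e n S] by linarith
    qed
    also have "\<dots> \<le> sqrt (p * (real n)\<^sup>2)"
      using card_complete_edges_le[of n] p by (intro real_sqrt_le_mono mult_left_mono) (simp_all flip: of_nat_power)
    also have "\<dots> = sqrt (x * real n)" using elim by (simp add: p_def power2_eq_square)
    also have "1 / real n * sqrt (x * real n) = sqrt (x / real n)"
      using elim by (simp add: real_sqrt_mult real_sqrt_divide real_div_sqrt field_simps)
    finally show ?case by (simp add: p_def mult_left_mono divide_right_mono)
  qed
  have "(\<lambda>n. sqrt (x / real n)) \<longlonglongrightarrow> sqrt 0" by (intro tendsto_real_sqrt lim_const_over_n)
  moreover have "(\<lambda>n. \<bar>ecomp n (x / real n) / real n - kfun x\<bar>) \<longlonglongrightarrow> \<bar>kfun x - kfun x\<bar>"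
    by (intro tendsto_rabs tendsto_diff ecomp_limit x tendsto_const)
  ultimately have "?b \<longlonglongrightarrow> sqrt 0 + 0 + \<bar>kfun x - kfun x\<bar>"
    by (intro tendsto_add lim_const_over_n)
  thus "?b \<longlonglongrightarrow> 0" by simp
qed simp

text \<open>Markov's inequality: on a disconnected graph the excess is at least 1.\<close>

lemma bexp_disconnected:
  assumes "2 \<le> n" "6 * ln 2 \<le> x" "x \<le> real n"
  shows "bexp (x / real n) (complete_edges n) (\<lambda>E. of_bool (ncomp {..<n} E \<noteq> 1)) \<le> real n * exp (- x / 6)"
proof -
  have "0 < ln (2 :: real)" by simp
  hence x0: "0 \<le> x" using assms(2) by linarith
  have "bexp (x / real n) (complete_edges n) (\<lambda>E. of_bool (ncomp {..<n} E \<noteq> 1)) \<le>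
      bexp (x / real n) (complete_edges n) (\<lambda>E. real (ncomp {..<n} E) - 1)"
  proof (rule bexp_mono)
    fix E
    have "1 \<le> ncomp {..<n} E" using ncomp_pos[of n E] assms(1) by simp
    thus "of_bool (ncomp {..<n} E \<noteq> 1) \<le> real (ncomp {..<n} E) - 1" by (cases "ncomp {..<n} E = 1") auto
  qed (use assms x0 in auto)
  also have "\<dots> = ecomp n (x / real n) - 1" by (simp add: bexp_diff ecomp_def)
  also have "\<dots> \<le> real n * exp (- x / 6)" by (rule ecomp_tail[OF assms])
  finally show ?thesis .
qed

section \<open>The functions of the theorem as integrals of the component density\<close>

lemma kfun_measurable [measurable]: "kfun \<in> borel_measurable borel"
  unfolding kfun_def[abs_def] kterm_def by measurable

lemma kterm_measurable [measurable]: "kterm k \<in> borel_measurable borel"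
  unfolding kterm_def by measurable

lemma set_integrable_exp:
  fixes a c :: real
  assumes "c > 0"
  shows "set_integrable lborel {a..} (\<lambda>x. exp (- c * x))"
proof -
  have "(\<lambda>x. exp (- c * x)) integrable_on {a..}"
    using has_integral_exp_minus_to_infinity[OF assms, of a] by (auto simp: integrable_on_def)
  hence "(\<lambda>x. exp (- c * x)) absolutely_integrable_on {a..}"
    by (rule nonnegative_absolutely_integrable_1) auto
  thus ?thesis unfolding set_integrable_def by (subst (asm) integrable_completion) auto
qed

lemma set_integrable_le_exp:
  fixes h :: "real \<Rightarrow> real"
  assumes "h \<in> borel_measurable borel" "S \<in> sets borel" "S \<subseteq> {a..}" "c > 0"
    and "\<And>x. x \<in> S \<Longrightarrow> \<bar>h x\<bar> \<le> D * exp (- c * x)"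
  shows "set_integrable lborel S h"
proof (rule set_integrable_bound)
  show "set_integrable lborel S (\<lambda>x. D * exp (- c * x))"
    by (intro set_integrable_mult_right set_integrable_subset[OF set_integrable_exp[OF assms(4)]] impI)
       (use assms in auto)
  show "set_borel_measurable lborel S h"
    unfolding set_borel_measurable_def using assms(1,2) by measurable
  show "AE x in lborel. x \<in> S \<longrightarrow> norm (h x) \<le> norm (D * exp (- c * x))"
    using assms(5) by (auto intro!: AE_I2 order_trans[OF assms(5)])
qed

lemma set_lebesgue_integral_nonneg:
  fixes h :: "real \<Rightarrow> real"
  assumes "\<And>x. x \<in> S \<Longrightarrow> 0 \<le> h x"
  shows "0 \<le> (LBINT x:S. h x)"
  unfolding set_lebesgue_integral_def
  by (rule Bochner_Integration.integral_nonneg) (use assms in \<open>auto simp: indicator_def\<close>)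

lemma set_integrable_kfun: "set_integrable lborel {0..} kfun"
  by (rule set_integrable_le_exp[of _ _ 0 "1/6" 2])
    (use kfun_nonneg kfun_le_exp in \<open>auto simp: abs_of_nonneg\<close>)

text \<open>The square of \<open>u - 3\<close> bounds the Gaussian exponent by a linear one, so that
  exponentials suffice as majorants.\<close>

lemma kfun_square_le: "kfun (u\<^sup>2) \<le> 2 * exp (3 / 2) * exp (- 1 * u)"
proof -
  have "- (u\<^sup>2) / 6 \<le> 3 / 2 + - 1 * u"
    using zero_le_power2[of "u - 3"] by (simp add: power2_eq_square algebra_simps)
  hence "exp (- (u\<^sup>2) / 6) \<le> exp (3 / 2) * exp (- 1 * u)" by (simp flip: exp_add)
  thus ?thesis using kfun_le_exp[of "u\<^sup>2"] by simp
qed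

lemma set_integrable_kfun_square: "set_integrable lborel {0..} (\<lambda>u. kfun (u\<^sup>2))"
  by (rule set_integrable_le_exp[of _ _ 0 1 "2 * exp (3 / 2)"])
    (use kfun_nonneg kfun_square_le in \<open>auto simp: abs_of_nonneg\<close>)

text \<open>Exchange of sum and integral for nonnegative terms. The weight 1 on the half-line leads
  to \<open>zeta3\<close>, the weight \<open>x powr (- (1 / 2))\<close> to \<open>c1\<close>, and
  the two weights on either side of \<open>\<beta>\<close> to \<open>f\<close>.\<close>

lemma sums_set_integral_kterm:
  assumes w: "w \<in> borel_measurable borel" "\<And>x. x \<in> S \<Longrightarrow> 0 \<le> w x"
    and S: "S \<in> sets borel" "S \<subseteq> {0..}"
    and int: "set_integrable lborel S (\<lambda>x. w x * kfun x)"
  shows "(\<lambda>k. LBINT x:S. w x * kterm k x) sums (LBINT x:S. w x * kfun x)"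
    and "set_integrable lborel S (\<lambda>x. w x * kterm k x)"
proof -
  let ?t = "\<lambda>k x. indicator S x *\<^sub>R (w x * kterm k x)"
  have nn: "0 \<le> ?t k x" for k x
    using w(2) S(2) by (auto simp: indicator_def intro!: mult_nonneg_nonneg kterm_nonneg)
  have sm: "summable (\<lambda>k. ?t k x)" and eq: "(\<Sum>k. ?t k x) = indicator S x *\<^sub>R (w x * kfun x)" for x
    using S(2) summable_kterm[of x] by (auto simp: indicator_def kfun_def suminf_mult)
  have le: "kterm k x \<le> kfun x" if "0 \<le> x" for k x
    using sum_le_suminf[OF summable_kterm[OF that], of "{k}"] kterm_nonneg[OF that] by (simp add: kfun_def)
  have tint: "set_integrable lborel S (\<lambda>x. w x * kterm k x)" for k
  proof (rule set_integrable_bound[OF int])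
    show "set_borel_measurable lborel S (\<lambda>x. w x * kterm k x)"
      unfolding set_borel_measurable_def using w(1) S(1) by measurable
    have "\<bar>w x * kterm k x\<bar> \<le> \<bar>w x * kfun x\<bar>" if "x \<in> S" for x
    proof -
      have x: "0 \<le> x" using that S(2) by auto
      have "w x * kterm k x \<le> w x * kfun x" using w(2)[OF that] le[OF x] by (intro mult_left_mono)
      moreover have "0 \<le> w x * kterm k x" using w(2)[OF that] kterm_nonneg[OF x] by simp
      ultimately show ?thesis by simp
    qed
    thus "AE x in lborel. x \<in> S \<longrightarrow> norm (w x * kterm k x) \<le> norm (w x * kfun x)" by simp
  qed
  thus "set_integrable lborel S (\<lambda>x. w x * kterm k x)" .
  have ti: "integrable lborel (?t k)" for k using tint unfolding set_integrable_def .
  have norm_eq: "norm (?t k x) = ?t k x" for k x using nn[of x k] by (simp only: real_norm_def abs_of_nonneg)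
  have "summable (\<lambda>k. \<integral>x. ?t k x \<partial>lborel)"
  proof (rule summableI_nonneg_bounded)
    fix n
    have "(\<Sum>k<n. \<integral>x. ?t k x \<partial>lborel) = (\<integral>x. (\<Sum>k<n. ?t k x) \<partial>lborel)"
      by (rule Bochner_Integration.integral_sum[symmetric]) (rule ti)
    also have "\<dots> \<le> (\<integral>x. indicator S x *\<^sub>R (w x * kfun x) \<partial>lborel)"
    proof (rule integral_mono)
      show "integrable lborel (\<lambda>x. indicator S x *\<^sub>R (w x * kfun x))" using int unfolding set_integrable_def .
      show "(\<Sum>k<n. ?t k x) \<le> indicator S x *\<^sub>R (w x * kfun x)" for x
        unfolding eq[symmetric] by (rule sum_le_suminf[OF sm]) (use nn in auto)
    qed (intro Bochner_Integration.integrable_sum ti)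
    finally show "(\<Sum>k<n. \<integral>x. ?t k x \<partial>lborel) \<le> (\<integral>x. indicator S x *\<^sub>R (w x * kfun x) \<partial>lborel)" .
  qed (intro Bochner_Integration.integral_nonneg nn)
  hence "(\<lambda>k. integral\<^sup>L lborel (?t k)) sums (\<integral>x. (\<Sum>k. ?t k x) \<partial>lborel)"
    by (intro sums_integral ti) (simp_all only: norm_eq sm AE_I2)
  thus "(\<lambda>k. LBINT x:S. w x * kterm k x) sums (LBINT x:S. w x * kfun x)"
    unfolding set_lebesgue_integral_def by (simp only: eq)
qed

lemma infsum_from_1_eq:
  fixes h :: "nat \<Rightarrow> real"
  assumes "(\<lambda>k. h (Suc k)) sums s" "\<And>k. 0 \<le> h (Suc k)"
  shows "infsum h {1..} = s"
proof -
  have "((h \<circ> Suc) has_sum s) UNIV"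
    unfolding o_def by (rule sums_nonneg_imp_has_sum[OF assms])
  hence "(h has_sum s) (Suc ` UNIV)" by (subst has_sum_reindex) auto
  moreover have "Suc ` UNIV = {1..}" by (auto simp: image_iff Suc_le_eq gr0_conv_Suc)
  ultimately show ?thesis by (simp add: infsumI)
qed

lemma gamma_integral_scaled:
  fixes a c :: real
  assumes "a > 0" "c > 0"
  shows "(LBINT t:{0..}. t powr (a - 1) * exp (- c * t)) = Gamma a / c powr a"
proof -
  let ?g = "\<lambda>t. indicator {0..} t * t powr (a - 1) / exp t"
  have G: "(\<integral>t. ?g t \<partial>lborel) = Gamma a"
  proof -
    have "(\<integral>t. ?g t \<partial>lborel) = enn2real (\<integral>\<^sup>+t. ennreal (?g t) \<partial>lborel)"
      by (rule integral_eq_nn_integral) auto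
    thus ?thesis using assms by (simp flip: Gamma_conv_nn_integral_real)
  qed
  have "(\<integral>t. ?g t \<partial>lborel) = \<bar>c\<bar> *\<^sub>R (\<integral>t. ?g (0 + c * t) \<partial>lborel)"
    by (rule lborel_integral_real_affine) (use assms in auto)
  also have "(\<lambda>t. ?g (0 + c * t)) = (\<lambda>t. c powr (a - 1) * (indicator {0..} t *\<^sub>R (t powr (a - 1) * exp (- c * t))))"
  proof
    fix t
    have "indicator {0..} (c * t) = (indicator {0..} t :: real)"
      using assms by (simp add: indicator_def zero_le_mult_iff)
    thus "?g (0 + c * t) = c powr (a - 1) * (indicator {0..} t *\<^sub>R (t powr (a - 1) * exp (- c * t)))"
      using assms by (cases "t \<ge> 0") (auto simp: powr_mult exp_minus field_simps)
  qed
  finally have "Gamma a = c * c powr (a - 1) * (LBINT t:{0..}. t powr (a - 1) * exp (- c * t))"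
    using assms G by (simp add: set_lebesgue_integral_def)
  also have "c * c powr (a - 1) = c powr a" using assms powr_mult_base[of c "a - 1"] by simp
  finally show ?thesis using assms by simp
qed

section \<open>Series for zeta(3) and c1 as integrals\<close>

text \<open>The coefficient of \<open>f\<close> at index \<open>Suc k\<close>, by Cayley's formula
  the number of labelled trees on \<open>Suc k\<close> vertices over \<open>fact (Suc k)\<close>.
  The integer power is due to the exponent -1 at \<open>k = 0\<close>.\<close>

definition kcoeff :: "nat \<Rightarrow> real" where
  "kcoeff k = real (Suc k) powi (int (Suc k) - 2) / fact (Suc k)"

lemma kterm_eq_kcoeff: "kterm k x = kcoeff k * (x ^ k * exp (- real (Suc k) * x))"
proof -
  define r where "r = real (Suc k)"
  have r: "r > 0" by (simp add: r_def)
  have "r powi (int (Suc k) - 2) = r powi (int k - 1)" by simp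
  also have "\<dots> = r ^ k / r" using r by (simp add: power_int_diff)
  finally have "kcoeff k = r ^ k / r / (r * fact k)" by (simp add: kcoeff_def r_def del: of_nat_Suc)
  thus ?thesis
    unfolding kterm_def r_def[symmetric] using r by (simp add: power_mult_distrib power2_eq_square mult_ac)
qed

text \<open>At \<open>x = 0\<close> both sides vanish, because \<open>0 powr a\<close> is 0 for
  every \<open>a\<close>; elsewhere the exponents add up.\<close>

lemma powr_half_kterm:
  assumes "0 \<le> x"
  shows "x powr (- (1 / 2)) * kterm k x = kcoeff k * (x powr (real k - 1 / 2) * exp (- real (Suc k) * x))"
proof (cases "x = 0")
  case False
  hence "x ^ k = x powr real k" using assms by (simp add: powr_realpow)
  hence eq: "x powr (- (1 / 2)) * x ^ k = x powr (- (1 / 2) + real k)"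
    by (simp only: powr_add)
  have "x powr (- (1 / 2)) * kterm k x = kcoeff k * ((x powr (- (1 / 2)) * x ^ k) * exp (- real (Suc k) * x))"
    by (simp only: kterm_eq_kcoeff mult_ac)
  thus ?thesis by (simp only: eq) (simp add: algebra_simps)
qed simp

text \<open>This is the summand of \<open>c1\<close> at index \<open>Suc k\<close>, so
  \<open>c1\<close> is \<open>1 / sqrt 2\<close> times the integral of
  \<open>x powr (- (1 / 2)) * kfun x\<close>.\<close>

lemma Gamma_half_integral:
  "(LBINT x:{0..}. x powr (- (1 / 2)) * kterm k x) =
     1 / real (Suc k) powr (3 / 2) * (Gamma (real (Suc k) - 1 / 2) / fact (Suc k))"
proof -
  define r where "r = real (Suc k)"
  have r: "r > 0" "r = real k + 1" by (simp_all add: r_def)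
  have "(LBINT x:{0..}. x powr (- (1 / 2)) * kterm k x) =
        (LBINT x:{0..}. kcoeff k * (x powr ((r - 1 / 2) - 1) * exp (- r * x)))"
    by (rule set_lebesgue_integral_cong) (simp_all add: powr_half_kterm r)
  also have "\<dots> = kcoeff k * (Gamma (r - 1 / 2) / r powr (r - 1 / 2))"
    by (subst set_integral_mult_right, subst gamma_integral_scaled) (use r in auto)
  also have "kcoeff k = r powr (r - 2) / fact (Suc k)"
  proof -
    have "r powr real_of_int (int (Suc k) - 2) = r powi (int (Suc k) - 2)"
      by (rule powr_real_of_int') (use r in auto)
    moreover have "real_of_int (int (Suc k) - 2) = r - 2" by (simp add: r)
    ultimately have "r powr (r - 2) = r powi (int (Suc k) - 2)" by (simp only:)
    thus ?thesis unfolding kcoeff_def r_def[symmetric] by (simp only:)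
  qed
  also have "r powr (r - 2) / fact (Suc k) * (Gamma (r - 1 / 2) / r powr (r - 1 / 2)) =
      r powr (r - 2) / r powr (r - 1 / 2) * (Gamma (r - 1 / 2) / fact (Suc k))" by simp
  also have "r powr (r - 2) / r powr (r - 1 / 2) = 1 / r powr (3 / 2)"
    by (simp add: powr_diff[symmetric] powr_minus_divide[symmetric])
  finally show ?thesis by (simp add: r_def)
qed

lemma kterm_integral: "(LBINT x:{0..}. 1 * kterm k x) = 1 / real (Suc k) ^ 3"
proof -
  define r where "r = real (Suc k)"
  have r: "r > 0" "r = real k + 1" by (simp_all add: r_def)
  \<comment> \<open>The point 0 is removed before \<open>x ^ k\<close> becomes a real power, because
    for \<open>k = 0\<close> the two differ there: \<open>0 ^ 0 = 1\<close> but
    \<open>0 powr 0 = 0\<close>.\<close>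
  have "(LBINT x:{0..}. 1 * kterm k x) = (LBINT x:{0<..}. 1 * kterm k x)"
    by (rule set_integral_discrete_difference[of "{0}"]) auto
  also have "\<dots> = (LBINT x:{0<..}. kcoeff k * (x powr (r - 1) * exp (- r * x)))"
    by (rule set_lebesgue_integral_cong) (auto simp: kterm_eq_kcoeff r powr_realpow)
  also have "\<dots> = (LBINT x:{0..}. kcoeff k * (x powr (r - 1) * exp (- r * x)))"
    by (rule set_integral_discrete_difference[of "{0}"]) auto
  also have "\<dots> = kcoeff k * (Gamma r / r powr r)"
    by (subst set_integral_mult_right, subst gamma_integral_scaled) (use r in auto)
  also have "Gamma r = fact k" using Gamma_fact[of k, where 'a = real] r by (simp add: add.commute)
  also have "r powr r = r ^ Suc k" using r powr_realpow[of r "Suc k"] by (simp add: r_def)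
  also have "kcoeff k = r ^ k / r / (r * fact k)"
  proof -
    have "r powi (int (Suc k) - 2) = r powi (int k - 1)" by simp
    also have "\<dots> = r ^ k / r" using r by (simp add: power_int_diff)
    finally show ?thesis by (simp add: kcoeff_def r_def del: of_nat_Suc)
  qed
  also have "r ^ k / r / (r * fact k) * (fact k / r ^ Suc k) = 1 / r ^ 3"
    using r by (simp add: power3_eq_cube)
  finally show ?thesis by (simp add: r_def)
qed

lemma zeta3_eq: "zeta3 = (LBINT x:{0..}. kfun x)"
proof -
  have "(\<lambda>k. LBINT x:{0..}. 1 * kterm k x) sums (LBINT x:{0..}. 1 * kfun x)"
    by (rule sums_set_integral_kterm) (use set_integrable_kfun in auto)
  hence "(\<lambda>k. 1 / real (Suc k) ^ 3) sums (LBINT x:{0..}. kfun x)"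
    unfolding kterm_integral by simp
  thus ?thesis unfolding zeta3_def by (rule infsum_from_1_eq) auto
qed

text \<open>The substitution x = u^2 removes the singularity at 0. With an extended real bound, one
  statement covers the half-line for \<open>c1\<close> and the interval up to \<open>\<beta>\<close>
  for \<open>f\<close>.\<close>

lemma kfun_sqrt_substitution:
  fixes b :: ereal
  assumes "0 < b"
  shows "set_integrable lborel (einterval 0 (b * b)) (\<lambda>x. x powr (- (1 / 2)) * kfun x)"
    and "(LBINT x=0..b * b. x powr (- (1 / 2)) * kfun x) = (LBINT u=0..b. 2 * kfun (u\<^sup>2))"
proof -
  let ?F = "\<lambda>x. x powr (- (1 / 2)) * kfun x"
  have simp: "?F (u\<^sup>2) * (2 * u) = 2 * kfun (u\<^sup>2)" if "0 < u" for u :: real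
  proof -
    have "(u\<^sup>2) powr (- (1 / 2)) = u powr (- 1)" using that by (simp add: powr_powr flip: powr_numeral)
    thus ?thesis using that by (simp add: powr_minus)
  qed
  have int: "set_integrable lborel (einterval 0 b) (\<lambda>u. ?F (u\<^sup>2) * (2 * u))"
  proof -
    have "set_integrable lborel (einterval 0 b) (\<lambda>u. 2 * kfun (u\<^sup>2))"
      by (intro set_integrable_mult_right set_integrable_subset[OF set_integrable_kfun_square])
        (auto simp: einterval_def)
    moreover have "set_integrable lborel (einterval 0 b) (\<lambda>u. ?F (u\<^sup>2) * (2 * u)) \<longleftrightarrow>
        set_integrable lborel (einterval 0 b) (\<lambda>u. 2 * kfun (u\<^sup>2))"
      by (intro set_integrable_cong refl simp) (auto simp: einterval_def)
    ultimately show ?thesis by simp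
  qed
  have A: "((ereal \<circ> (\<lambda>u. u\<^sup>2) \<circ> real_of_ereal) \<longlongrightarrow> 0) (at_right 0)"
  proof -
    have "((\<lambda>u::real. u\<^sup>2) \<longlongrightarrow> 0\<^sup>2) (at_right 0)" by (intro tendsto_intros)
    thus ?thesis by (simp add: zero_ereal_def ereal_tendsto_simps)
  qed
  have B: "((ereal \<circ> (\<lambda>u. u\<^sup>2) \<circ> real_of_ereal) \<longlongrightarrow> b * b) (at_left b)"
  proof (cases b)
    case (real r)
    have "((\<lambda>u::real. u\<^sup>2) \<longlongrightarrow> r\<^sup>2) (at_left r)" by (intro tendsto_intros)
    thus ?thesis by (simp add: real ereal_tendsto_simps power2_eq_square)
  next
    case PInf
    have "filterlim (\<lambda>u::real. u\<^sup>2) at_top at_top"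
      by (intro filterlim_pow_at_top filterlim_ident) simp
    thus ?thesis by (simp add: PInf ereal_tendsto_simps)
  qed (use assms in simp)
  have cont: "isCont ?F (u\<^sup>2)" if "0 < ereal u" for u
  proof -
    have u2: "u\<^sup>2 \<in> {0<..}" using that by simp
    have "continuous_on {0<..} ?F"
      by (intro continuous_intros continuous_on_subset[OF continuous_on_kfun]) auto
    thus ?thesis using u2 by (simp add: continuous_on_eq_continuous_at)
  qed
  note sub = interval_integral_substitution_nonneg[where g = "\<lambda>u. u\<^sup>2" and g' = "\<lambda>u. 2 * u" and f = ?F,
      OF assms _ cont _ _ _ A B int]
  show "set_integrable lborel (einterval 0 (b * b)) ?F"
    by (rule sub(1)) (auto intro!: derivative_eq_intros continuous_intros kfun_nonneg mult_nonneg_nonneg)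
  have "(LBINT x=0..b * b. ?F x) = (LBINT u=0..b. ?F (u\<^sup>2) * (2 * u))"
    by (rule sub(2)) (auto intro!: derivative_eq_intros continuous_intros kfun_nonneg mult_nonneg_nonneg)
  also have "\<dots> = (LBINT u=0..b. 2 * kfun (u\<^sup>2))"
  proof (rule interval_integral_cong)
    fix x assume "x \<in> einterval (min 0 b) (max 0 b)"
    hence "0 < x" using assms by (auto simp: einterval_def split: if_splits)
    thus "?F (x\<^sup>2) * (2 * x) = 2 * kfun (x\<^sup>2)" by (rule simp)
  qed
  finally show "(LBINT x=0..b * b. ?F x) = (LBINT u=0..b. 2 * kfun (u\<^sup>2))" .
qed

lemma set_integrable_powr_half_kfun: "set_integrable lborel {0..} (\<lambda>x. x powr (- (1 / 2)) * kfun x)"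
proof -
  have "set_integrable lborel {0<..} (\<lambda>x. x powr (- (1 / 2)) * kfun x)"
    using kfun_sqrt_substitution(1)[of \<infinity>] by (simp add: zero_ereal_def)
  thus ?thesis by (subst set_integrable_discrete_difference[of "{0}" _ "{0<..}"]) auto
qed

text \<open>The form that the random model produces: in the intermediate regime, U + l V is at most
  t on a triangle of area t^2 / (2 l), which for t = sqrt (l / n) s is the edge probability s^2 / (2
  n).\<close>

lemma c1_eq: "c1 = (LBINT s:{0..}. kfun (s\<^sup>2 / 2))"
proof -
  have "(\<lambda>k. LBINT x:{0..}. x powr (- (1 / 2)) * kterm k x) sums (LBINT x:{0..}. x powr (- (1 / 2)) * kfun x)"
    by (rule sums_set_integral_kterm) (use set_integrable_powr_half_kfun in auto)
  hence "(\<Sum>\<^sub>\<infinity>k\<in>{1::nat..}. 1 / real k powr (3 / 2) * (Gamma (real k - 1 / 2) / fact k)) =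
      (LBINT x:{0..}. x powr (- (1 / 2)) * kfun x)"
    unfolding Gamma_half_integral by (rule infsum_from_1_eq) (auto intro!: Gamma_real_nonneg)
  hence "c1 = 1 / sqrt 2 * (LBINT x:{0..}. x powr (- (1 / 2)) * kfun x)" by (simp add: c1_def)
  also have "(LBINT x:{0..}. x powr (- (1 / 2)) * kfun x) = (LBINT x:{0<..}. x powr (- (1 / 2)) * kfun x)"
    by (rule set_integral_discrete_difference[of "{0}"]) auto
  also have "\<dots> = (LBINT u:{0<..}. 2 * kfun (u\<^sup>2))"
    using kfun_sqrt_substitution(2)[of \<infinity>] by (simp add: zero_ereal_def interval_integral_to_infinity_eq)
  also have "\<dots> = (LBINT u:{0..}. 2 * kfun (u\<^sup>2))"
    by (rule set_integral_discrete_difference[of "{0}"]) auto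
  also have "1 / sqrt 2 * \<dots> = sqrt 2 * (LBINT u:{0..}. kfun (u\<^sup>2))"
    by (simp add: real_div_sqrt field_simps)
  also have "(LBINT s:{0..}. kfun (s\<^sup>2 / 2)) = sqrt 2 * (LBINT u:{0..}. kfun (u\<^sup>2))"
  proof -
    have "(LBINT s:{0..}. kfun (s\<^sup>2 / 2)) =
        \<bar>sqrt 2\<bar> *\<^sub>R (\<integral>u. indicator {0..} (0 + sqrt 2 * u) *\<^sub>R kfun ((0 + sqrt 2 * u)\<^sup>2 / 2) \<partial>lborel)"
      unfolding set_lebesgue_integral_def by (rule lborel_integral_real_affine) simp
    also have "(\<lambda>u. indicator {0..} (0 + sqrt 2 * u) *\<^sub>R kfun ((0 + sqrt 2 * u)\<^sup>2 / 2)) =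
        (\<lambda>u. indicator {0..} u *\<^sub>R kfun (u\<^sup>2))"
      by (auto simp: indicator_def power_mult_distrib zero_le_mult_iff)
    finally show ?thesis by (simp add: set_lebesgue_integral_def)
  qed
  finally show ?thesis by simp
qed

section \<open>The function f in terms of K, and its derivative\<close>

definition Pint :: "real \<Rightarrow> real" where
  "Pint y = (LBINT u:{0..y}. kfun (u\<^sup>2))"

lemma sqrt_integral_eq:
  assumes "0 \<le> \<beta>"
  shows "(LBINT x:{0..\<beta>}. x powr (- (1 / 2)) * kfun x) = 2 * Pint (sqrt \<beta>)"
proof (cases "\<beta> = 0")
  case True
  have "(LBINT x:{0..0::real}. h x) = (0 :: real)" for h :: "real \<Rightarrow> real"
    using set_integral_discrete_difference[of "{0}" "{0..0}" "{}" lborel h]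
    by (simp add: set_lebesgue_integral_def)
  thus ?thesis by (simp add: True Pint_def)
next
  case False
  have "(LBINT x:{0..\<beta>}. x powr (- (1 / 2)) * kfun x) = (LBINT x=0..ereal \<beta>. x powr (- (1 / 2)) * kfun x)"
    by (simp only: zero_ereal_def interval_integral_Icc[OF assms])
  also have "ereal \<beta> = ereal (sqrt \<beta>) * ereal (sqrt \<beta>)" using assms by simp
  also have "(LBINT x=0..ereal (sqrt \<beta>) * ereal (sqrt \<beta>). x powr (- (1 / 2)) * kfun x) =
      (LBINT u=0..ereal (sqrt \<beta>). 2 * kfun (u\<^sup>2))"
    by (rule kfun_sqrt_substitution(2)) (use assms False in simp)
  also have "\<dots> = (LBINT u:{0..sqrt \<beta>}. 2 * kfun (u\<^sup>2))"
    using assms by (simp only: zero_ereal_def interval_integral_Icc real_sqrt_ge_zero)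
  finally show ?thesis by (simp add: Pint_def)
qed

lemma f_eq:
  assumes "0 \<le> \<beta>"
  shows "f \<beta> = 2 * sqrt \<beta> * Pint (sqrt \<beta>) + (LBINT x:{\<beta>..}. kfun x)"
proof -
  have w1: "set_integrable lborel {0..\<beta>} (\<lambda>x. x powr (- (1 / 2)) * kfun x)"
    by (rule set_integrable_subset[OF set_integrable_powr_half_kfun]) auto
  have w2: "set_integrable lborel {\<beta>..} (\<lambda>x. 1 * kfun x)"
    using set_integrable_subset[OF set_integrable_kfun, of "{\<beta>..}"] assms by simp
  have s1: "(\<lambda>k. LBINT x:{0..\<beta>}. x powr (- (1 / 2)) * kterm k x) sums (LBINT x:{0..\<beta>}. x powr (- (1 / 2)) * kfun x)"
    by (rule sums_set_integral_kterm) (use w1 in auto)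
  have s2: "(\<lambda>k. LBINT x:{\<beta>..}. 1 * kterm k x) sums (LBINT x:{\<beta>..}. 1 * kfun x)"
    by (rule sums_set_integral_kterm) (use w2 assms in auto)
  have e1: "(LBINT x:{0..\<beta>}. x powr (- (1 / 2)) * kterm k x) =
       kcoeff k * (LBINT x:{0..\<beta>}. x powr (real (Suc k) - 3 / 2) * exp (- real (Suc k) * x))" for k
  proof -
    have "(LBINT x:{0..\<beta>}. x powr (- (1 / 2)) * kterm k x) =
       (LBINT x:{0..\<beta>}. kcoeff k * (x powr (real (Suc k) - 3 / 2) * exp (- real (Suc k) * x)))"
    proof (rule set_lebesgue_integral_cong)
      have "real (Suc k) - 3 / 2 = real k - 1 / 2" by simp
      thus "\<forall>x. x \<in> {0..\<beta>} \<longrightarrow> x powr (- (1 / 2)) * kterm k x =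
          kcoeff k * (x powr (real (Suc k) - 3 / 2) * exp (- real (Suc k) * x))"
        using powr_half_kterm[of _ k] by (simp only: atLeastAtMost_iff) blast
    qed simp
    thus ?thesis by simp
  qed
  have e2: "(LBINT x:{\<beta>..}. 1 * kterm k x) =
       kcoeff k * (LBINT x:{\<beta>..}. x ^ (Suc k - 1) * exp (- real (Suc k) * x))" for k
    by (simp only: kterm_eq_kcoeff set_integral_mult_right mult_1 diff_Suc_1)
  define h where "h k = real k powi (int k - 2) / fact k *
     (sqrt \<beta> * (LBINT x:{0..\<beta>}. x powr (real k - 3 / 2) * exp (- real k * x)) +
      (LBINT x:{\<beta>..}. x ^ (k - 1) * exp (- real k * x)))" for k
  have h: "h (Suc k) = sqrt \<beta> * (LBINT x:{0..\<beta>}. x powr (- (1 / 2)) * kterm k x) + (LBINT x:{\<beta>..}. 1 * kterm k x)" for k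
    unfolding e1 e2 h_def kcoeff_def by (simp add: algebra_simps)
  have "(\<lambda>k. h (Suc k)) sums (sqrt \<beta> * (LBINT x:{0..\<beta>}. x powr (- (1 / 2)) * kfun x) + (LBINT x:{\<beta>..}. 1 * kfun x))"
    unfolding h by (intro sums_add sums_mult s1 s2)
  moreover have "0 \<le> h (Suc k)" for k
    unfolding h using assms
    by (intro add_nonneg_nonneg mult_nonneg_nonneg) (auto intro!: set_lebesgue_integral_nonneg kterm_nonneg mult_nonneg_nonneg)
  ultimately have "infsum h {1..} = sqrt \<beta> * (LBINT x:{0..\<beta>}. x powr (- (1 / 2)) * kfun x) + (LBINT x:{\<beta>..}. 1 * kfun x)"
    by (rule infsum_from_1_eq)
  thus ?thesis unfolding f_def h_def sqrt_integral_eq[OF assms] by (simp add: mult_ac)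
qed

lemma continuous_on_kfun_square: "continuous_on S (\<lambda>u. kfun (u\<^sup>2))"
  by (rule continuous_on_compose2[OF continuous_on_kfun]) (auto intro!: continuous_intros)

lemma set_integrable_kfun_Icc: "0 \<le> a \<Longrightarrow> set_integrable lborel {a..b} kfun"
  by (rule set_integrable_subset[OF set_integrable_kfun]) auto

lemma set_integrable_kfun_square_Icc: "0 \<le> a \<Longrightarrow> set_integrable lborel {a..b} (\<lambda>u. kfun (u\<^sup>2))"
  by (rule set_integrable_subset[OF set_integrable_kfun_square]) auto

lemma Pint_eq_integral: "Pint y = integral {0..y} (\<lambda>u. kfun (u\<^sup>2))"
  unfolding Pint_def by (rule set_borel_integral_eq_integral(2)[OF set_integrable_kfun_square_Icc]) simp

lemma Pint_deriv:
  assumes "0 \<le> y"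
  shows "(Pint has_real_derivative kfun (y\<^sup>2)) (at y within {0..})"
proof -
  have "(Pint has_real_derivative kfun (y\<^sup>2)) (at y within {0..y + 1})"
    unfolding Pint_eq_integral[abs_def]
    by (rule integral_has_real_derivative[OF continuous_on_kfun_square]) (use assms in auto)
  moreover have "at y within {0..y + 1} = at y within {0..}"
    by (rule at_within_nhd[of _ "{..<y + 1}"]) auto
  ultimately show ?thesis by simp
qed

lemma Pint_0: "Pint 0 = 0"
  by (simp add: Pint_eq_integral)

lemma kfun_pos: "0 \<le> x \<Longrightarrow> 0 < kfun x"
proof -
  assume x: "0 \<le> x"
  have "0 < kterm 0 x" by (simp add: kterm_def)
  also have "\<dots> \<le> kfun x"
    using sum_le_suminf[OF summable_kterm[OF x], of "{0}"] kterm_nonneg[OF x] by (simp add: kfun_def)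
  finally show "0 < kfun x" .
qed

lemma Pint_split:
  assumes "0 \<le> y" "y \<le> z"
  shows "Pint z = Pint y + integral {y..z} (\<lambda>u. kfun (u\<^sup>2))"
  unfolding Pint_eq_integral
  by (rule Henstock_Kurzweil_Integration.integral_combine[symmetric])
    (use assms in \<open>auto intro!: integrable_continuous_interval continuous_on_kfun_square\<close>)

lemma integral_kfun_square_le:
  assumes "0 \<le> y" "y \<le> z"
  shows "integral {y..z} (\<lambda>u. kfun (u\<^sup>2)) \<le> (z - y) * kfun (y\<^sup>2)"
proof -
  have "integral {y..z} (\<lambda>u. kfun (u\<^sup>2)) \<le> integral {y..z} (\<lambda>u. kfun (y\<^sup>2))"
    by (rule Henstock_Kurzweil_Integration.integral_le)
      (use assms in \<open>auto intro!: integrable_continuous_interval continuous_on_kfun_square kfun_antimono power_mono\<close>)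
  thus ?thesis using assms by simp
qed

text \<open>The integrand is continuous and nonincreasing. Strictness comes from its left end alone,
  where \<open>kfun 0 = 1\<close> exceeds \<open>kfun (y\<^sup>2)\<close>.\<close>

lemma Pint_gt:
  assumes "0 < y"
  shows "y * kfun (y\<^sup>2) < Pint y"
proof -
  let ?d = "\<lambda>u. kfun (u\<^sup>2) - kfun (y\<^sup>2)"
  have nn: "0 \<le> ?d u" if "u \<in> {0..y}" for u
    using that kfun_antimono[of "u\<^sup>2" "y\<^sup>2"] by (auto intro: power_mono)
  have cont: "continuous_on {0..y} ?d" by (intro continuous_intros continuous_on_kfun_square)
  have int: "(?d has_integral (Pint y - y * kfun (y\<^sup>2))) {0..y}"
  proof -
    have "((\<lambda>u. kfun (u\<^sup>2)) has_integral Pint y) {0..y}"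
      unfolding Pint_eq_integral by (intro integrable_integral integrable_continuous_interval continuous_on_kfun_square)
    moreover have "((\<lambda>u. kfun (y\<^sup>2)) has_integral y * kfun (y\<^sup>2)) {0..y}"
      using has_integral_const_real[of "kfun (y\<^sup>2)" 0 y] assms by simp
    ultimately show ?thesis by (rule has_integral_diff)
  qed
  have "0 \<le> Pint y - y * kfun (y\<^sup>2)" by (rule has_integral_nonneg[OF int nn])
  moreover have "Pint y - y * kfun (y\<^sup>2) \<noteq> 0"
  proof
    assume "Pint y - y * kfun (y\<^sup>2) = 0"
    hence "(?d has_integral 0) (cbox 0 y)" using int by simp
    hence "?d 0 = 0"
      by (rule has_integral_0_cbox_imp_0[rotated 2]) (use cont nn assms in auto)
    thus False using kfun_less_one[of "y\<^sup>2"] assms by (simp add: kfun_0)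
  qed
  ultimately show ?thesis by linarith
qed

text \<open>The derivative of \<open>f\<close>: the mean of \<open>kfun (u\<^sup>2)\<close> over u
  between 0 and \<open>sqrt \<beta>\<close>, continued by its limit 1 at 0. As a mean over growing
  intervals of a nonincreasing function it decreases.\<close>

definition gfun :: "real \<Rightarrow> real" where
  "gfun \<beta> = (if \<beta> = 0 then 1 else Pint (sqrt \<beta>) / sqrt \<beta>)"

lemma gfun_0: "gfun 0 = 1"
  by (simp add: gfun_def)

text \<open>Beyond \<open>y\<close> the integrand is at most \<open>kfun (y\<^sup>2)\<close>, which
  by \<open>Pint_gt\<close> lies strictly below the mean up to \<open>y\<close>. For
  \<open>a = 0\<close> the mean is compared with 1 instead, after a cut at half of
  \<open>sqrt b\<close>.\<close>

lemma gfun_strict_antimono: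
  assumes "0 \<le> a" "a < b"
  shows "gfun b < gfun a"
proof (cases "a = 0")
  case True
  have "Pint (sqrt b) \<le> (sqrt b - 0) * kfun (0\<^sup>2)"
    unfolding Pint_eq_integral by (rule integral_kfun_square_le) (use assms in auto)
  moreover have "Pint (sqrt b) \<noteq> sqrt b"
  proof
    assume eq: "Pint (sqrt b) = sqrt b"
    define y where "y = sqrt b / 2"
    have y: "0 < y" "sqrt b = 2 * y" using assms by (auto simp: y_def)
    have "Pint (sqrt b) \<le> Pint y + y * kfun (y\<^sup>2)"
      using Pint_split[of y "2 * y"] integral_kfun_square_le[of y "2 * y"] y by simp
    moreover have "Pint y \<le> y" using integral_kfun_square_le[of 0 y] y by (simp add: Pint_eq_integral kfun_0)
    moreover have "y * kfun (y\<^sup>2) < y * 1" using kfun_less_one[of "y\<^sup>2"] y by (intro mult_strict_left_mono) auto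
    ultimately show False using eq unfolding y(2) by linarith
  qed
  ultimately have "Pint (sqrt b) < sqrt b" by (simp add: kfun_0)
  thus ?thesis using assms True by (simp add: gfun_def)
next
  case False
  define y z where "y = sqrt a" and "z = sqrt b"
  have y: "0 < y" "y < z" using assms False by (auto simp: y_def z_def)
  have "Pint z \<le> Pint y + (z - y) * kfun (y\<^sup>2)"
    using Pint_split[of y z] integral_kfun_square_le[of y z] y by simp
  hence "y * Pint z \<le> y * (Pint y + (z - y) * kfun (y\<^sup>2))"
    by (rule mult_left_mono) (use y in simp)
  also have "\<dots> = y * Pint y + (z - y) * (y * kfun (y\<^sup>2))" by (simp add: algebra_simps)
  also have "\<dots> < y * Pint y + (z - y) * Pint y"
    using Pint_gt[OF y(1)] y by (intro add_strict_left_mono mult_strict_left_mono) auto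
  also have "\<dots> = z * Pint y" by (simp add: algebra_simps)
  finally have "Pint z / z < Pint y / y" using y by (simp add: divide_less_eq less_divide_eq mult_ac)
  thus ?thesis using assms False by (simp add: gfun_def y_def z_def)
qed

lemma Pint_nonneg: "0 \<le> Pint y"
  unfolding Pint_def by (intro set_lebesgue_integral_nonneg kfun_nonneg) auto

lemma gfun_nonneg: "0 \<le> gfun \<beta>"
proof (cases "\<beta> \<ge> 0")
  case False
  have "Pint y = 0" if "y < 0" for y using that by (simp add: Pint_def set_lebesgue_integral_def)
  thus ?thesis using False by (simp add: gfun_def)
qed (simp add: gfun_def Pint_nonneg)

lemma gfun_pos: "0 \<le> \<beta> \<Longrightarrow> 0 < gfun \<beta>"
  using gfun_strict_antimono[of \<beta> "\<beta> + 1"] gfun_nonneg[of "\<beta> + 1"] by linarith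

lemma continuous_on_gfun: "continuous_on {0..} gfun"
proof -
  define A where "A = (\<lambda>y. if y = 0 then 1 else Pint y / y)"
  have cP: "continuous_on {0..} Pint"
    by (rule DERIV_continuous_on[where D = "\<lambda>y. kfun (y\<^sup>2)"]) (use Pint_deriv in auto)
  have "continuous_on {0..} A"
    unfolding continuous_on_eq_continuous_within
  proof
    fix y :: real assume y: "y \<in> {0..}"
    show "continuous (at y within {0..}) A"
    proof (cases "y = 0")
      case True
      have "((\<lambda>u. (Pint u - Pint 0) / (u - 0)) \<longlongrightarrow> kfun (0\<^sup>2)) (at 0 within {0..})"
        using Pint_deriv[of 0] unfolding has_field_derivative_iff by simp
      moreover have "\<forall>\<^sub>F u in at 0 within {0..}. (Pint u - Pint 0) / (u - 0) = A u"
        by (auto simp: A_def Pint_0 eventually_at_filter)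
      ultimately have "(A \<longlongrightarrow> 1) (at 0 within {0..})"
        by (simp add: kfun_0 tendsto_cong)
      thus ?thesis by (simp add: True continuous_within A_def)
    next
      case False
      have "(Pint \<longlongrightarrow> Pint y) (at y within {0..})" using cP y by (simp add: continuous_on_def)
      hence "((\<lambda>u. Pint u / u) \<longlongrightarrow> Pint y / y) (at y within {0..})"
        by (rule tendsto_divide[OF _ tendsto_ident_at False])
      moreover have "\<forall>\<^sub>F u in at y within {0..}. Pint u / u = A u"
        using eventually_neq_at_within[of 0 y "{0..}"] by eventually_elim (auto simp: A_def)
      ultimately show ?thesis using False by (simp add: continuous_within A_def tendsto_cong)
    qed
  qed
  hence "continuous_on {0..} (\<lambda>\<beta>. A (sqrt \<beta>))"
    by (rule continuous_on_compose2) (auto intro!: continuous_intros)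
  moreover have "A (sqrt \<beta>) = gfun \<beta>" for \<beta> by (simp add: A_def gfun_def)
  ultimately show ?thesis by simp
qed

lemma kfun_tail_integral:
  assumes "0 \<le> \<beta>"
  shows "(LBINT x:{\<beta>..}. kfun x) = (LBINT x:{0..}. kfun x) - integral {0..\<beta>} kfun"
proof -
  have "(LBINT x:{0..}. kfun x) = (LBINT x:{0..<\<beta>} \<union> {\<beta>..}. kfun x)"
    using assms by (intro arg_cong2[where f = "set_lebesgue_integral lborel"]) auto
  also have "\<dots> = (LBINT x:{0..<\<beta>}. kfun x) + (LBINT x:{\<beta>..}. kfun x)"
    by (rule set_integral_Un) (use assms in \<open>auto intro!: set_integrable_subset[OF set_integrable_kfun]\<close>)
  also have "(LBINT x:{0..<\<beta>}. kfun x) = (LBINT x:{0..\<beta>}. kfun x)"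
    by (rule set_integral_discrete_difference[of "{\<beta>}"]) auto
  also have "\<dots> = integral {0..\<beta>} kfun"
    by (rule set_borel_integral_eq_integral(2)[OF set_integrable_kfun_Icc]) simp
  finally show ?thesis by simp
qed

lemma integral_kfun_deriv:
  assumes "0 \<le> y"
  shows "((\<lambda>y. integral {0..y} kfun) has_real_derivative kfun y) (at y within {0..})"
proof -
  have "((\<lambda>y. integral {0..y} kfun) has_real_derivative kfun y) (at y within {0..y + 1})"
    by (rule integral_has_real_derivative[OF continuous_on_subset[OF continuous_on_kfun]]) (use assms in auto)
  moreover have "at y within {0..y + 1} = at y within {0..}"
    by (rule at_within_nhd[of _ "{..<y + 1}"]) auto
  ultimately show ?thesis by simp
qed

text \<open>For positive \<open>\<beta>\<close> the term \<open>kfun \<beta>\<close> from the upper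
  limit of \<open>Pint\<close> cancels that of the tail integral. At 0, where \<open>sqrt\<close>
  has no derivative, the difference quotient is treated directly and tends to 2 - 1 = 1.\<close>

lemma f_has_deriv:
  assumes "0 \<le> \<beta>"
  shows "(f has_real_derivative gfun \<beta>) (at \<beta> within {0..})"
proof -
  define F where "F = (\<lambda>\<beta>. 2 * (sqrt \<beta> * Pint (sqrt \<beta>)) + ((LBINT x:{0..}. kfun x) - integral {0..\<beta>} kfun))"
  have fF: "f x = F x" if "0 \<le> x" for x
    using f_eq[OF that] kfun_tail_integral[OF that] by (simp add: F_def)
  have "(F has_real_derivative gfun \<beta>) (at \<beta> within {0..})"
  proof (cases "\<beta> = 0")
    case True
    have "((\<lambda>u. 2 * gfun u - (integral {0..u} kfun - integral {0..0} kfun) / (u - 0)) \<longlongrightarrow> 2 * 1 - kfun 0) (at 0 within {0..})"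
    proof (intro tendsto_intros)
      show "(gfun \<longlongrightarrow> 1) (at 0 within {0..})"
        using continuous_on_gfun unfolding continuous_on_def gfun_0[symmetric] by simp
      show "((\<lambda>u. (integral {0..u} kfun - integral {0..0} kfun) / (u - 0)) \<longlongrightarrow> kfun 0) (at 0 within {0..})"
        using integral_kfun_deriv[of 0] unfolding has_field_derivative_iff by simp
    qed
    moreover have "\<forall>\<^sub>F u in at 0 within {0..}.
        2 * gfun u - (integral {0..u} kfun - integral {0..0} kfun) / (u - 0) = (F u - F 0) / (u - 0)"
      unfolding eventually_at_filter
    proof (intro always_eventually allI impI)
      fix u :: real assume u: "u \<noteq> 0" "u \<in> {0..}"
      have "2 * (sqrt u * Pint (sqrt u)) / u = 2 * (Pint (sqrt u) / sqrt u)"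
        using u by (simp add: field_simps)
      thus "2 * gfun u - (integral {0..u} kfun - integral {0..0} kfun) / (u - 0) = (F u - F 0) / (u - 0)"
        using u by (simp add: F_def gfun_def diff_divide_distrib)
    qed
    ultimately have "((\<lambda>u. (F u - F 0) / (u - 0)) \<longlongrightarrow> 2 * 1 - kfun 0) (at 0 within {0..})"
      by (rule Lim_transform_eventually)
    thus ?thesis by (simp add: True has_field_derivative_iff kfun_0 gfun_def)
  next
    case False
    hence b: "0 < \<beta>" using assms by simp
    have at: "at \<beta> within {0..} = at \<beta>" using b by (intro at_within_interior) (simp add: interior_Ici[of "-1"])
    have dP: "(Pint has_real_derivative kfun \<beta>) (at (sqrt \<beta>))"
      using Pint_deriv[of "sqrt \<beta>"] b at_within_interior[of "sqrt \<beta>" "{0..}"] by (simp add: interior_Ici[of "-1"])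
    have ds: "(sqrt has_real_derivative inverse (sqrt \<beta>) / 2) (at \<beta>)" by (rule DERIV_real_sqrt[OF b])
    have di: "((\<lambda>y. integral {0..y} kfun) has_real_derivative kfun \<beta>) (at \<beta>)"
      using integral_kfun_deriv[OF assms] at by simp
    have "(F has_real_derivative
        2 * (inverse (sqrt \<beta>) / 2 * Pint (sqrt \<beta>) + kfun \<beta> * (inverse (sqrt \<beta>) / 2) * sqrt \<beta>) + (0 - kfun \<beta>)) (at \<beta>)"
      unfolding F_def
      by (intro DERIV_add DERIV_cmult DERIV_mult DERIV_diff DERIV_const DERIV_chain2[OF dP ds] ds di)
    also have "2 * (inverse (sqrt \<beta>) / 2 * Pint (sqrt \<beta>) + kfun \<beta> * (inverse (sqrt \<beta>) / 2) * sqrt \<beta>) + (0 - kfun \<beta>) = gfun \<beta>"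
      using b by (simp add: gfun_def field_simps)
    finally show ?thesis by (simp add: at)
  qed
  thus ?thesis
    by (rule has_field_derivative_transform_within[of _ _ _ _ 1]) (use assms fF in auto)
qed

text \<open>A derivative within the half-line is unique: restricted to the right of
  \<open>\<beta>\<close>, the filter is nontrivial also for \<open>\<beta> = 0\<close>.\<close>

lemma f_deriv_iff: "f_deriv \<beta> d \<longleftrightarrow> 0 \<le> \<beta> \<and> d = gfun \<beta>"
proof -
  have "d = gfun \<beta>" if b: "0 \<le> \<beta>" and d: "(f has_real_derivative d) (at \<beta> within {0..})"
  proof (rule tendsto_unique)
    have sub: "{\<beta>..} \<subseteq> {0..}" using b by auto
    show "((\<lambda>y. (f y - f \<beta>) / (y - \<beta>)) \<longlongrightarrow> d) (at \<beta> within {\<beta>..})"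
      using DERIV_subset[OF d sub] by (simp add: has_field_derivative_iff)
    show "((\<lambda>y. (f y - f \<beta>) / (y - \<beta>)) \<longlongrightarrow> gfun \<beta>) (at \<beta> within {\<beta>..})"
      using DERIV_subset[OF f_has_deriv[OF b] sub] by (simp add: has_field_derivative_iff)
  qed (simp add: at_within_Ici_at_right)
  thus ?thesis unfolding f_deriv_def using f_has_deriv by blast
qed

lemma f_0: "f 0 = zeta3"
  by (simp add: f_eq zeta3_eq)

lemma f_mvt:
  assumes "0 \<le> a" "a < b"
  obtains \<xi> where "a < \<xi>" "\<xi> < b" "f b - f a = (b - a) * gfun \<xi>"
proof -
  have d: "(f has_real_derivative gfun x) (at x)" if "a < x" for x
    using f_has_deriv[of x] at_within_interior[of x "{0..}"] that assms by (simp add: interior_Ici[of "-1"])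
  have "continuous_on {0..} f"
    by (rule DERIV_continuous_on[where D = gfun]) (use f_has_deriv in auto)
  hence "continuous_on {a..b} f" by (rule continuous_on_subset) (use assms in auto)
  then obtain \<xi> where "a < \<xi>" "\<xi> < b" "f b - f a = (b - a) * gfun \<xi>"
    using mvt_simple[of a b f "\<lambda>x h. h * gfun x"] d assms
    by (metis MVT2 MVT has_field_derivative_unique real_differentiable_def DERIV_unique)
  thus ?thesis ..
qed

section \<open>Existence and uniqueness of the optimal multipliers\<close>

text \<open>The intercept of the tangent to \<open>f\<close> at \<open>\<beta>\<close>. It is the
  dual value at an interior optimum and also the derivative of g f(1/g) at g = 1/\<beta>.\<close>

definition hfun :: "real \<Rightarrow> real" where
  "hfun \<beta> = f \<beta> - \<beta> * gfun \<beta>"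

text \<open>With the slope at an intermediate point \<open>\<xi>\<close>, the increment is
  \<open>b * (gfun \<xi> - gfun b) + a * (gfun a - gfun \<xi>)\<close>, so strict decrease of
  \<open>gfun\<close> suffices and no second derivative enters.\<close>

lemma hfun_strict_mono:
  assumes "0 \<le> a" "a < b"
  shows "hfun a < hfun b"
proof -
  obtain \<xi> where \<xi>: "a < \<xi>" "\<xi> < b" "f b - f a = (b - a) * gfun \<xi>" by (rule f_mvt[OF assms])
  have "gfun b < gfun \<xi>" "gfun \<xi> < gfun a" using \<xi> assms by (auto intro: gfun_strict_antimono)
  hence "0 < b * (gfun \<xi> - gfun b)" "0 \<le> a * (gfun a - gfun \<xi>)" using assms by simp_all
  moreover have "hfun b - hfun a = b * (gfun \<xi> - gfun b) + a * (gfun a - gfun \<xi>)"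
    using \<xi>(3) by (simp add: hfun_def algebra_simps)
  ultimately show ?thesis by linarith
qed

lemma continuous_on_f: "continuous_on {0..} f"
  by (rule DERIV_continuous_on[where D = gfun]) (use f_has_deriv in auto)

lemma continuous_on_hfun: "continuous_on {0..} hfun"
  unfolding hfun_def by (intro continuous_intros continuous_on_f continuous_on_gfun)

lemma hfun_0: "hfun 0 = zeta3"
  by (simp add: hfun_def f_0)

lemma Pint_mono:
  assumes "0 \<le> y" "y \<le> z"
  shows "Pint y \<le> Pint z"
proof -
  have "0 \<le> integral {y..z} (\<lambda>u. kfun (u\<^sup>2))"
    by (intro integral_nonneg integrable_continuous_interval continuous_on_kfun_square kfun_nonneg) simp
  thus ?thesis using Pint_split[OF assms] by simp
qed

text \<open>Growth of order \<open>sqrt \<beta>\<close>, so that every value above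
  \<open>zeta3\<close> is attained.\<close>

lemma hfun_ge:
  assumes "1 \<le> \<beta>"
  shows "sqrt \<beta> * Pint 1 \<le> hfun \<beta>"
proof -
  have "sqrt \<beta> * sqrt \<beta> = \<beta>" using assms by simp
  hence "\<beta> * (Pint (sqrt \<beta>) / sqrt \<beta>) = sqrt \<beta> * Pint (sqrt \<beta>)" using assms by (simp add: field_simps)
  hence "hfun \<beta> = sqrt \<beta> * Pint (sqrt \<beta>) + (LBINT x:{\<beta>..}. kfun x)"
    using assms by (simp add: hfun_def f_eq gfun_def)
  moreover have "0 \<le> (LBINT x:{\<beta>..}. kfun x)" using assms by (intro set_lebesgue_integral_nonneg kfun_nonneg) auto
  moreover have "sqrt \<beta> * Pint 1 \<le> sqrt \<beta> * Pint (sqrt \<beta>)"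
    using assms by (intro mult_left_mono Pint_mono) auto
  ultimately show ?thesis by linarith
qed

lemma ex1_hfun:
  assumes "zeta3 < \<alpha>"
  shows "\<exists>!\<beta>. 0 \<le> \<beta> \<and> hfun \<beta> = \<alpha>"
proof -
  have P1: "0 < Pint 1" using Pint_gt[of 1] kfun_nonneg[of "1\<^sup>2"] by simp
  define b where "b = max 1 ((\<alpha> / Pint 1)\<^sup>2)"
  have b: "1 \<le> b" by (simp add: b_def)
  have "\<alpha> / Pint 1 \<le> sqrt b" by (rule real_le_rsqrt) (simp only: b_def max.cobounded2)
  hence "\<alpha> \<le> sqrt b * Pint 1" using P1 by (simp add: divide_le_eq)
  hence "\<alpha> \<le> hfun b" using hfun_ge[OF b] by linarith
  moreover have "continuous_on {0..b} hfun" by (rule continuous_on_subset[OF continuous_on_hfun]) auto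
  ultimately obtain \<beta> where "0 \<le> \<beta>" "hfun \<beta> = \<alpha>"
    using IVT'[of hfun 0 \<alpha> b] assms b by (auto simp: hfun_0)
  moreover have "x = y" if "0 \<le> x" "0 \<le> y" "hfun x = hfun y" for x y
    using hfun_strict_mono[of x y] hfun_strict_mono[of y x] that by (cases x y rule: linorder_cases) auto
  ultimately show ?thesis by (intro ex_ex1I) auto
qed

lemma ex1_gfun:
  assumes "0 < a" "a \<le> 1"
  shows "\<exists>!\<beta>. 0 \<le> \<beta> \<and> gfun \<beta> = a"
proof -
  define C where "C = (LBINT u:{0..}. kfun (u\<^sup>2))"
  have PC: "Pint y \<le> C" for y
    unfolding Pint_def C_def set_lebesgue_integral_def
  proof (rule integral_mono)
    show "integrable lborel (\<lambda>u. indicator {0..y} u *\<^sub>R kfun (u\<^sup>2))"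
      using set_integrable_kfun_square_Icc[of 0 y] unfolding set_integrable_def by simp
    show "integrable lborel (\<lambda>u. indicator {0..} u *\<^sub>R kfun (u\<^sup>2))"
      using set_integrable_kfun_square unfolding set_integrable_def .
    show "indicator {0..y} u *\<^sub>R kfun (u\<^sup>2) \<le> indicator {0..} u *\<^sub>R kfun (u\<^sup>2)" for u
      by (auto simp: indicator_def kfun_nonneg)
  qed
  have C: "0 \<le> C" using PC[of 0] by (simp add: Pint_0)
  \<comment> \<open>\<open>Pint\<close> is bounded by \<open>C\<close>, so \<open>gfun b\<close> is
    at most \<open>C / sqrt b\<close>, here \<open>C * a / (C + 1)\<close>. The summand 1 keeps
    \<open>b\<close> positive when \<open>C\<close> is only known to be nonnegative.\<close>
  define b where "b = ((C + 1) / a)\<^sup>2"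
  have sb: "sqrt b = (C + 1) / a" "0 < b" using C assms by (simp_all add: b_def)
  have "gfun b = Pint (sqrt b) / sqrt b" using sb by (simp add: gfun_def)
  also have "\<dots> \<le> C / sqrt b" by (intro divide_right_mono PC) (simp add: b_def)
  also have "\<dots> \<le> a" using C assms by (simp add: sb field_simps)
  finally have "gfun b \<le> a" .
  moreover have "continuous_on {0..b} gfun" by (rule continuous_on_subset[OF continuous_on_gfun]) auto
  ultimately obtain \<beta> where "0 \<le> \<beta>" "gfun \<beta> = a"
    using IVT2'[of gfun b a 0] assms sb by (auto simp: gfun_0)
  moreover have "x = y" if "0 \<le> x" "0 \<le> y" "gfun x = gfun y" for x y
    using gfun_strict_antimono[of x y] gfun_strict_antimono[of y x] that by (cases x y rule: linorder_cases) auto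
  ultimately show ?thesis by (intro ex_ex1I) auto
qed

lemma zeta3_pos: "0 < zeta3"
proof -
  have "zeta3 = hfun 0" by (simp add: hfun_0)
  also have "hfun 0 = integral {0..1} kfun + (LBINT x:{1..}. kfun x)"
    using kfun_tail_integral[of 1] by (simp add: hfun_0 zeta3_eq)
  finally have eq: "zeta3 = integral {0..1} kfun + (LBINT x:{1..}. kfun x)" .
  have "integral {0..1::real} (\<lambda>x. kfun 1) \<le> integral {0..1} kfun"
    by (rule Henstock_Kurzweil_Integration.integral_le)
      (auto intro!: kfun_antimono integrable_continuous_interval continuous_on_subset[OF continuous_on_kfun])
  hence "0 < integral {0..1} kfun" using kfun_pos[of 1] by simp
  moreover have "0 \<le> (LBINT x:{1..}. kfun x)" by (intro set_lebesgue_integral_nonneg kfun_nonneg) auto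
  ultimately show ?thesis using eq by linarith
qed

lemma c1_pos: "0 < c1"
proof -
  have "(LBINT s:{0..1}. kfun (s\<^sup>2 / 2)) \<le> c1"
    unfolding c1_eq set_lebesgue_integral_def
  proof (rule integral_mono)
    have c: "continuous_on S (\<lambda>s. kfun (s\<^sup>2 / 2))" for S
      by (rule continuous_on_compose2[OF continuous_on_kfun]) (auto intro!: continuous_intros)
    have i: "integrable lborel (\<lambda>u. indicator {0..} u *\<^sub>R kfun (u\<^sup>2 / 2))"
    proof -
      have "integrable lborel (\<lambda>u. indicator {0..} u *\<^sub>R kfun (u\<^sup>2))"
        using set_integrable_kfun_square unfolding set_integrable_def .
      hence "integrable lborel (\<lambda>u. indicator {0..} (0 + 1 / sqrt 2 * u) *\<^sub>R kfun ((0 + 1 / sqrt 2 * u)\<^sup>2))"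
        by (rule lborel_integrable_real_affine) simp
      also have "(\<lambda>u. indicator {0..} (0 + 1 / sqrt 2 * u) *\<^sub>R kfun ((0 + 1 / sqrt 2 * u)\<^sup>2)) =
          (\<lambda>u. indicator {0..} u *\<^sub>R kfun (u\<^sup>2 / 2))"
        by (auto simp: indicator_def power_divide zero_le_divide_iff)
      finally show ?thesis .
    qed
    thus "integrable lborel (\<lambda>u. indicator {0..} u *\<^sub>R kfun (u\<^sup>2 / 2))" .
    have "set_integrable lborel {0..1} (\<lambda>u. kfun (u\<^sup>2 / 2))"
      by (rule set_integrable_subset[of _ "{0..}"]) (use i in \<open>auto simp: set_integrable_def\<close>)
    thus "integrable lborel (\<lambda>u. indicator {0..1} u *\<^sub>R kfun (u\<^sup>2 / 2))" unfolding set_integrable_def .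
    show "indicator {0..1} u *\<^sub>R kfun (u\<^sup>2 / 2) \<le> indicator {0..} u *\<^sub>R kfun (u\<^sup>2 / 2)" for u
      by (auto simp: indicator_def kfun_nonneg)
  qed
  moreover have "(LBINT s:{0..1::real}. kfun 1) \<le> (LBINT s:{0..1}. kfun (s\<^sup>2 / 2))"
  proof (rule set_integral_mono)
    show "set_integrable lborel {0..1} (\<lambda>s. kfun (s\<^sup>2 / 2))"
      by (rule borel_integrable_atLeastAtMost') (auto intro!: continuous_on_compose2[OF continuous_on_kfun] continuous_intros)
    show "set_integrable lborel {0..1::real} (\<lambda>s. kfun 1)"
      by (rule borel_integrable_atLeastAtMost') (intro continuous_intros)
    fix s :: real assume "s \<in> {0..1}"
    hence "s\<^sup>2 \<le> 1" by (simp add: power_le_one)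
    thus "kfun 1 \<le> kfun (s\<^sup>2 / 2)" by (intro kfun_antimono) auto
  qed
  moreover have "(LBINT s:{0..1::real}. kfun 1) = kfun 1" by (simp add: set_lebesgue_integral_def)
  ultimately show ?thesis using kfun_pos[of 1] by simp
qed

text \<open>\<open>edge_rate \<beta> s / n\<close> is the probability of \<open>W + (2 \<beta> / n) C \<le> s / n\<close>.\<close>
definition edge_rate :: "real \<Rightarrow> real \<Rightarrow> real" where
  "edge_rate \<beta> s = (if s < 2 * \<beta> then s\<^sup>2 / (4 * \<beta>) else s - \<beta>)"

lemma edge_rate_measurable [measurable]: "edge_rate \<beta> \<in> borel_measurable borel"
  unfolding edge_rate_def by measurable

text \<open>The line \<open>s - \<beta>\<close> is tangent to the parabola at
  \<open>2 * \<beta>\<close>, where the branches meet. If \<open>\<beta> = 0\<close>, the parabolic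
  branch has \<open>s < 0\<close> and the value 0 of a division by zero.\<close>

lemma edge_rate_ge: "0 \<le> \<beta> \<Longrightarrow> s - \<beta> \<le> edge_rate \<beta> s"
proof (cases "s < 2 * \<beta>")
  case True
  assume "0 \<le> \<beta>"
  moreover have "0 \<noteq> \<beta> \<or> s < 0" using True by auto
  moreover have "(s - \<beta>) * (4 * \<beta>) \<le> s\<^sup>2"
    using zero_le_power2[of "s - 2 * \<beta>"] by (simp add: power2_eq_square algebra_simps)
  ultimately show ?thesis using True by (cases "\<beta> = 0") (auto simp: edge_rate_def pos_le_divide_eq)
qed (simp add: edge_rate_def)

lemma edge_rate_nonneg: "0 \<le> \<beta> \<Longrightarrow> 0 \<le> s \<Longrightarrow> 0 \<le> edge_rate \<beta> s"
  by (simp add: edge_rate_def)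

text \<open>The origin of the two terms of \<open>f\<close>: the parabolic branch, where C is not
  yet restricted by its upper end 1, is parametrised by s = 2 sqrt \<beta> u, and the linear branch
  by s = \<beta> + x.\<close>

lemma edge_rate_integral:
  assumes "0 \<le> \<beta>"
  shows "(LBINT s:{0..}. kfun (edge_rate \<beta> s)) = f \<beta>"
proof -
  have int: "set_integrable lborel {0..} (\<lambda>s. kfun (edge_rate \<beta> s))"
  proof (rule set_integrable_le_exp[of _ _ 0 "1/6" "2 * exp (\<beta> / 6)"])
    fix s :: real assume s: "s \<in> {0..}"
    have "kfun (edge_rate \<beta> s) \<le> 2 * exp (- edge_rate \<beta> s / 6)"
      using assms s by (intro kfun_le_exp edge_rate_nonneg) auto
    also have "\<dots> \<le> 2 * exp (\<beta> / 6 + - (1 / 6) * s)" using edge_rate_ge[OF assms, of s] by simp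
    also have "\<dots> = 2 * exp (\<beta> / 6) * exp (- (1 / 6) * s)" by (simp only: exp_add mult.assoc)
    finally show "\<bar>kfun (edge_rate \<beta> s)\<bar> \<le> 2 * exp (\<beta> / 6) * exp (- (1 / 6) * s)"
      using kfun_nonneg[of "edge_rate \<beta> s"] edge_rate_nonneg[OF assms, of s] s by simp
  qed auto
  have "(LBINT s:{0..}. kfun (edge_rate \<beta> s)) = (LBINT s:{0..<2 * \<beta>} \<union> {2 * \<beta>..}. kfun (edge_rate \<beta> s))"
    using assms by (intro arg_cong2[where f = "set_lebesgue_integral lborel"]) auto
  also have "\<dots> = (LBINT s:{0..<2 * \<beta>}. kfun (edge_rate \<beta> s)) + (LBINT s:{2 * \<beta>..}. kfun (edge_rate \<beta> s))"
    by (rule set_integral_Un) (use assms in \<open>auto intro!: set_integrable_subset[OF int]\<close>)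
  also have "(LBINT s:{2 * \<beta>..}. kfun (edge_rate \<beta> s)) = (LBINT x:{\<beta>..}. kfun x)"
  proof -
    have "(LBINT s:{2 * \<beta>..}. kfun (edge_rate \<beta> s)) = (LBINT s:{2 * \<beta>..}. kfun (s - \<beta>))"
      by (rule set_lebesgue_integral_cong) (auto simp: edge_rate_def)
    also have "\<dots> = \<bar>1\<bar> *\<^sub>R (\<integral>x. indicator {2 * \<beta>..} (\<beta> + 1 * x) *\<^sub>R kfun (\<beta> + 1 * x - \<beta>) \<partial>lborel)"
      unfolding set_lebesgue_integral_def by (rule lborel_integral_real_affine) simp
    also have "(\<lambda>x. indicator {2 * \<beta>..} (\<beta> + 1 * x) *\<^sub>R kfun (\<beta> + 1 * x - \<beta>)) = (\<lambda>x. indicator {\<beta>..} x *\<^sub>R kfun x)"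
      by (auto simp: indicator_def)
    finally show ?thesis by (simp add: set_lebesgue_integral_def)
  qed
  also have "(LBINT s:{0..<2 * \<beta>}. kfun (edge_rate \<beta> s)) = 2 * sqrt \<beta> * Pint (sqrt \<beta>)"
  proof (cases "\<beta> = 0")
    case True
    thus ?thesis by (simp add: set_lebesgue_integral_def)
  next
    case False
    hence b: "0 < \<beta>" using assms by simp
    have "(LBINT s:{0..<2 * \<beta>}. kfun (edge_rate \<beta> s)) = (LBINT s:{0..<2 * \<beta>}. kfun (s\<^sup>2 / (4 * \<beta>)))"
      by (rule set_lebesgue_integral_cong) (auto simp: edge_rate_def)
    also have "\<dots> = \<bar>2 * sqrt \<beta>\<bar> *\<^sub>R (\<integral>u. indicator {0..<2 * \<beta>} (0 + 2 * sqrt \<beta> * u) *\<^sub>R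
        kfun ((0 + 2 * sqrt \<beta> * u)\<^sup>2 / (4 * \<beta>)) \<partial>lborel)"
      unfolding set_lebesgue_integral_def by (rule lborel_integral_real_affine) (use b in simp)
    also have "(\<lambda>u. indicator {0..<2 * \<beta>} (0 + 2 * sqrt \<beta> * u) *\<^sub>R kfun ((0 + 2 * sqrt \<beta> * u)\<^sup>2 / (4 * \<beta>))) =
        (\<lambda>u. indicator {0..<sqrt \<beta>} u *\<^sub>R kfun (u\<^sup>2))"
    proof
      fix u
      have "2 * sqrt \<beta> * u < 2 * \<beta> \<longleftrightarrow> sqrt \<beta> * u < sqrt \<beta> * sqrt \<beta>" using b by simp
      also have "\<dots> \<longleftrightarrow> u < sqrt \<beta>" using b by (subst mult_less_cancel_left_pos) auto
      finally have "2 * sqrt \<beta> * u < 2 * \<beta> \<longleftrightarrow> u < sqrt \<beta>" .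
      moreover have "0 \<le> 2 * sqrt \<beta> * u \<longleftrightarrow> 0 \<le> u" using b by (simp add: zero_le_mult_iff)
      moreover have "(2 * sqrt \<beta> * u)\<^sup>2 / (4 * \<beta>) = u\<^sup>2" using b by (simp add: power_mult_distrib)
      ultimately show "indicator {0..<2 * \<beta>} (0 + 2 * sqrt \<beta> * u) *\<^sub>R kfun ((0 + 2 * sqrt \<beta> * u)\<^sup>2 / (4 * \<beta>)) =
        indicator {0..<sqrt \<beta>} u *\<^sub>R kfun (u\<^sup>2)" by (simp add: indicator_def)
    qed
    also have "(\<integral>u. indicator {0..<sqrt \<beta>} u *\<^sub>R kfun (u\<^sup>2) \<partial>lborel) = Pint (sqrt \<beta>)"
      unfolding Pint_def set_lebesgue_integral_def[symmetric]
      by (rule set_integral_discrete_difference[of "{sqrt \<beta>}"]) auto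
    finally show ?thesis using b by simp
  qed
  finally show ?thesis by (simp add: f_eq[OF assms])
qed

section \<open>Random edge lengths\<close>

lemma level_graph_eq_iff:
  assumes "S \<subseteq> complete_edges n"
  shows "level_graph n x t = S \<longleftrightarrow> (\<forall>e\<in>complete_edges n. x e \<le> t \<longleftrightarrow> e \<in> S)"
  using assms by (auto simp: level_graph_def)

lemma level_graph_event:
  assumes "\<And>e. e \<in> complete_edges n \<Longrightarrow> (\<lambda>z. X e z) \<in> borel_measurable N" "t \<in> borel_measurable N"
    and "S \<subseteq> complete_edges n"
  shows "{z\<in>space N. level_graph n (\<lambda>e. X e z) (t z) = S} \<in> sets N"
proof -
  have [measurable]: "Measurable.pred N (\<lambda>z. X e z \<le> t z)" if "e \<in> complete_edges n" for e
    using assms(1)[OF that] assms(2) by measurable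
  have "Measurable.pred N (\<lambda>z. \<forall>e\<in>complete_edges n. X e z \<le> t z \<longleftrightarrow> e \<in> S)"
    by (intro pred_intros_finite) (auto intro!: pred_intros_logic \<open>\<And>e. e \<in> complete_edges n \<Longrightarrow> Measurable.pred N (\<lambda>z. X e z \<le> t z)\<close>)
  thus ?thesis by (simp add: level_graph_eq_iff[OF assms(3)] pred_def)
qed

text \<open>The level graph takes finitely many values, so every function of it is a finite
  combination of indicators; expectations and measurability reduce to the events that it equals a
  given \<open>S\<close>.\<close>

lemma sum_over_level_graph:
  fixes \<phi> :: "nat set set \<Rightarrow> real"
  assumes "z \<in> \<Omega>"
  shows "\<phi> (level_graph n (\<lambda>e. X e z) t) =
    (\<Sum>S\<in>Pow (complete_edges n). \<phi> S * indicator {z\<in>\<Omega>. level_graph n (\<lambda>e. X e z) t = S} z)"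
proof -
  have "(\<Sum>S\<in>Pow (complete_edges n). \<phi> S * indicator {z\<in>\<Omega>. level_graph n (\<lambda>e. X e z) t = S} z) =
    (\<Sum>S\<in>Pow (complete_edges n). if level_graph n (\<lambda>e. X e z) t = S then \<phi> S else 0)"
    using assms by (intro sum.cong) (auto simp: indicator_def)
  also have "\<dots> = \<phi> (level_graph n (\<lambda>e. X e z) t)"
    using level_graph_subset[of n "\<lambda>e. X e z" t] by (subst sum.delta') auto
  finally show ?thesis ..
qed

text \<open>The level \<open>t\<close> may itself be a function of the point. On the product of the
  probability space with the line of levels this gives the joint measurability for Fubini's
  theorem.\<close>

lemma level_graph_measurable:
  fixes \<phi> :: "nat set set \<Rightarrow> real"
  assumes "\<And>e. e \<in> complete_edges n \<Longrightarrow> (\<lambda>z. X e z) \<in> borel_measurable N" "t \<in> borel_measurable N"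
  shows "(\<lambda>z. \<phi> (level_graph n (\<lambda>e. X e z) (t z))) \<in> borel_measurable N"
proof -
  let ?f = "\<lambda>z. \<Sum>S\<in>Pow (complete_edges n). \<phi> S * indicator {z\<in>space N. level_graph n (\<lambda>e. X e z) (t z) = S} z"
  have "?f \<in> borel_measurable N"
    by (intro borel_measurable_sum borel_measurable_times borel_measurable_const borel_measurable_indicator
        level_graph_event assms) auto
  moreover have "\<phi> (level_graph n (\<lambda>e. X e z) (t z)) = ?f z" if z: "z \<in> space N" for z
  proof -
    have "?f z = (\<Sum>S\<in>Pow (complete_edges n). if level_graph n (\<lambda>e. X e z) (t z) = S then \<phi> S else 0)"
      using z by (intro sum.cong) (auto simp: indicator_def)
    also have "\<dots> = \<phi> (level_graph n (\<lambda>e. X e z) (t z))"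
      using level_graph_subset[of n "\<lambda>e. X e z" "t z"] by (subst sum.delta') auto
    finally show ?thesis ..
  qed
  ultimately show ?thesis by (simp cong: measurable_cong)
qed

context prob_space
begin

text \<open>The bridge to \<open>bexp\<close>: by independence, the level graph equals a given
  \<open>S\<close> with the product probability.\<close>

lemma expectation_level_graph:
  fixes X :: "nat set \<Rightarrow> 'a \<Rightarrow> real" and \<phi> :: "nat set set \<Rightarrow> real"
  assumes ind: "indep_vars (\<lambda>_. borel) X (complete_edges n)"
    and p: "\<And>e. e \<in> complete_edges n \<Longrightarrow> prob {\<omega>\<in>space M. X e \<omega> \<le> t} = p"
  shows "expectation (\<lambda>\<omega>. \<phi> (level_graph n (\<lambda>e. X e \<omega>) t)) = bexp p (complete_edges n) \<phi>"
proof -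
  let ?F = "complete_edges n"
  let ?A = "\<lambda>S. {\<omega>\<in>space M. level_graph n (\<lambda>e. X e \<omega>) t = S}"
  have rv: "X e \<in> borel_measurable M" if "e \<in> ?F" for e using ind that by (auto simp: indep_vars_def)
  have ev: "?A S \<in> events" if "S \<subseteq> ?F" for S
    by (rule level_graph_event) (use rv that in auto)
  have pS: "prob (?A S) = p ^ card S * (1 - p) ^ card (?F - S)" if S: "S \<subseteq> ?F" for S
  \<comment> \<open>With at most one vertex there is no edge, whereas the product formula for
    independent variables is applied to a nonempty index set.\<close>
  proof (cases "?F = {}")
    case True
    hence "?A S = space M" using S by (auto simp: level_graph_def)
    thus ?thesis using True S by (simp add: prob_space)
  next
    case False
    define B where "B = (\<lambda>e. if e \<in> S then {..t} else {t<..})"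
    have "?A S = (\<Inter>e\<in>?F. X e -` B e \<inter> space M)"
      using False unfolding level_graph_eq_iff[OF S] B_def by (auto split: if_splits)
    hence "prob (?A S) = (\<Prod>e\<in>?F. prob (X e -` B e \<inter> space M))"
      using indep_varsD_finite[OF ind False, of B] by (simp add: B_def)
    also have "\<dots> = (\<Prod>e\<in>?F. if e \<in> S then p else 1 - p)"
    proof (rule prod.cong[OF refl])
      fix e assume e: "e \<in> ?F"
      have eq: "X e -` {..t} \<inter> space M = {\<omega>\<in>space M. X e \<omega> \<le> t}" by auto
      have "{\<omega>\<in>space M. X e \<omega> \<le> t} \<in> events" using rv[OF e] by measurable
      moreover have "X e -` {t<..} \<inter> space M = space M - {\<omega>\<in>space M. X e \<omega> \<le> t}" by auto
      ultimately show "prob (X e -` B e \<inter> space M) = (if e \<in> S then p else 1 - p)"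
        using p[OF e] eq by (simp add: B_def prob_compl)
    qed
    also have "\<dots> = (\<Prod>e\<in>S. p) * (\<Prod>e\<in>?F - S. 1 - p)"
      using S by (subst prod.If_cases) (auto simp: Int_absorb1 Diff_eq Collect_mem_eq)
    finally show ?thesis by simp
  qed
  have "expectation (\<lambda>\<omega>. \<phi> (level_graph n (\<lambda>e. X e \<omega>) t)) =
      expectation (\<lambda>\<omega>. \<Sum>S\<in>Pow ?F. \<phi> S * indicator (?A S) \<omega>)"
    by (rule Bochner_Integration.integral_cong[OF refl]) (rule sum_over_level_graph)
  also have "\<dots> = (\<Sum>S\<in>Pow ?F. \<phi> S * prob (?A S))"
    by (subst Bochner_Integration.integral_sum) (use ev in \<open>auto simp: emeasure_eq_measure\<close>)
  also have "\<dots> = bexp p ?F \<phi>" unfolding bexp_def by (rule sum.cong) (auto simp: pS)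
  finally show ?thesis .
qed

text \<open>The error of the integral is at most the L1 distance \<open>U\<close> of the integrands
  over the levels. Fubini's theorem turns the expectation of \<open>U\<close> into the integral of
  \<open>comp_deviation\<close>, and Markov's inequality provides the event. The factor
  \<open>b\<close> comes from substituting \<open>b * s\<close> for the level.\<close>

lemma excess_deviation:
  fixes X :: "nat set \<Rightarrow> 'a \<Rightarrow> real" and q :: "real \<Rightarrow> real"
  assumes ind: "indep_vars (\<lambda>_. borel) X (complete_edges n)"
    and n: "2 \<le> n" and b: "0 < b" and S: "0 \<le> S" and \<epsilon>: "0 < \<epsilon>"
    and q: "q \<in> borel_measurable borel" "\<And>s. 0 \<le> s \<Longrightarrow> 0 \<le> q s"
    and rate: "\<And>s e. 0 \<le> s \<Longrightarrow> s \<le> S \<Longrightarrow> e \<in> complete_edges n \<Longrightarrow> prob {\<omega>\<in>space M. X e \<omega> \<le> b * s} = q s / real n"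
  shows "\<exists>A\<in>events. (\<forall>\<omega>\<in>A. \<bar>excess_integral n (\<lambda>e. X e \<omega>) (b * S) / (real n * b) - (LBINT s:{0..S}. kfun (q s))\<bar> < \<epsilon>)
     \<and> 1 - (LBINT s:{0..S}. comp_deviation n (q s)) / \<epsilon> \<le> prob A"
proof -
  let ?F = "complete_edges n"
  have rv: "X e \<in> borel_measurable M" if "e \<in> ?F" for e using ind that by (auto simp: indep_vars_def)
  define D where "D \<omega> s = (real (ncomp {..<n} (level_graph n (\<lambda>e. X e \<omega>) (b * s))) - 1) / real n - kfun (q s)" for \<omega> s
  \<comment> \<open>Bounded by 2 and supported on a set of finite product measure, hence integrable
    for Fubini's theorem.\<close>
  define K where "K = (\<lambda>\<omega> s. indicator {0..S} s * \<bar>D \<omega> s\<bar>)"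
  have ncm: "1 \<le> real (ncomp {..<n} (level_graph n x t))" "real (ncomp {..<n} (level_graph n x t)) \<le> real n" for x t
    using ncomp_pos[of n "level_graph n x t"] ncomp_le[OF level_graph_subset, of n x t] n by simp_all
  have Dbound: "\<bar>D \<omega> s\<bar> \<le> 2" if "0 \<le> s" for \<omega> s
  proof -
    let ?a = "(real (ncomp {..<n} (level_graph n (\<lambda>e. X e \<omega>) (b * s))) - 1) / real n"
    have "0 \<le> ?a" "?a \<le> 1" using ncm[of "\<lambda>e. X e \<omega>" "b * s"] n by (auto simp: divide_le_eq)
    moreover have "0 \<le> kfun (q s)" "kfun (q s) \<le> 1" using q(2)[OF that] kfun_nonneg kfun_le_one by auto
    ultimately show ?thesis unfolding D_def by linarith
  qed
  have meas: "(\<lambda>(\<omega>, s). real (ncomp {..<n} (level_graph n (\<lambda>e. X e \<omega>) (b * s)))) \<in> borel_measurable (M \<Otimes>\<^sub>M lborel)"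
  proof -
    have "(\<lambda>z. real (ncomp {..<n} (level_graph n (\<lambda>e. X e (fst z)) (b * snd z)))) \<in> borel_measurable (M \<Otimes>\<^sub>M lborel)"
    proof (rule level_graph_measurable)
      fix e assume "e \<in> ?F"
      note [measurable] = rv[OF this]
      show "(\<lambda>z. X e (fst z)) \<in> borel_measurable (M \<Otimes>\<^sub>M lborel)" by measurable
    qed measurable
    thus ?thesis by (simp add: case_prod_beta')
  qed
  have Dmeas: "(\<lambda>(\<omega>, s). D \<omega> s) \<in> borel_measurable (M \<Otimes>\<^sub>M lborel)"
  proof -
    have "(\<lambda>z. (\<lambda>(\<omega>, s). real (ncomp {..<n} (level_graph n (\<lambda>e. X e \<omega>) (b * s)))) z) \<in> borel_measurable (M \<Otimes>\<^sub>M lborel)"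
      using meas by simp
    hence "(\<lambda>z. ((\<lambda>(\<omega>, s). real (ncomp {..<n} (level_graph n (\<lambda>e. X e \<omega>) (b * s)))) z - 1) / real n - kfun (q (snd z)))
        \<in> borel_measurable (M \<Otimes>\<^sub>M lborel)"
      using q(1) by measurable
    thus ?thesis by (simp add: D_def case_prod_beta')
  qed
  have Kmeas: "case_prod K \<in> borel_measurable (M \<Otimes>\<^sub>M lborel)"
  proof -
    have "(\<lambda>z. indicator {0..S} (snd z) * \<bar>(\<lambda>(\<omega>, s). D \<omega> s) z\<bar>) \<in> borel_measurable (M \<Otimes>\<^sub>M lborel)"
      using Dmeas by measurable
    thus ?thesis by (simp add: K_def case_prod_beta')
  qed
  interpret P: pair_sigma_finite M lborel ..
  have Kint: "integrable (M \<Otimes>\<^sub>M lborel) (case_prod K)"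
  proof (rule integrableI_bounded_set[of "space M \<times> {0..S}" _ _ 2])
    have "emeasure (M \<Otimes>\<^sub>M lborel) (space M \<times> {0..S}) = emeasure M (space M) * emeasure lborel {0..S}"
      by (rule lborel.emeasure_pair_measure_Times) auto
    thus "emeasure (M \<Otimes>\<^sub>M lborel) (space M \<times> {0..S}) < \<infinity>"
      using S by (simp add: emeasure_space_1)
    show "AE x in M \<Otimes>\<^sub>M lborel. x \<in> space M \<times> {0..S} \<longrightarrow> norm (case_prod K x) \<le> 2"
      using Dbound by (intro AE_I2) (auto simp: K_def)
    show "AE x in M \<Otimes>\<^sub>M lborel. x \<notin> space M \<times> {0..S} \<longrightarrow> case_prod K x = 0"
      by (intro AE_I2) (auto simp: K_def space_pair_measure indicator_def)
  qed (use Kmeas in auto)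
  define U where "U = (\<lambda>\<omega>. \<integral>s. K \<omega> s \<partial>lborel)"
  have Uint: "integrable M U" unfolding U_def using P.integrable_fst'[OF Kint] by simp
  have U0: "0 \<le> U \<omega>" for \<omega> unfolding U_def by (intro Bochner_Integration.integral_nonneg) (auto simp: K_def)
  have EU: "expectation U = (LBINT s:{0..S}. comp_deviation n (q s))"
  proof -
    have "expectation U = (\<integral>s. (\<integral>\<omega>. K \<omega> s \<partial>M) \<partial>lborel)"
      unfolding U_def by (rule P.Fubini_integral[OF Kint, symmetric])
    also have "\<dots> = (\<integral>s. indicator {0..S} s *\<^sub>R comp_deviation n (q s) \<partial>lborel)"
    proof (rule Bochner_Integration.integral_cong[OF refl])
      fix s :: real
      show "(\<integral>\<omega>. K \<omega> s \<partial>M) = indicator {0..S} s *\<^sub>R comp_deviation n (q s)"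
      proof (cases "s \<in> {0..S}")
        case True
        have "(\<integral>\<omega>. K \<omega> s \<partial>M) = expectation (\<lambda>\<omega>. \<bar>(real (ncomp {..<n} (level_graph n (\<lambda>e. X e \<omega>) (b * s))) - 1) / real n - kfun (q s)\<bar>)"
          using True by (simp add: K_def D_def)
        also have "\<dots> = bexp (q s / real n) ?F (\<lambda>E. \<bar>(real (ncomp {..<n} E) - 1) / real n - kfun (q s)\<bar>)"
          by (rule expectation_level_graph[OF ind]) (use True rate in auto)
        finally show ?thesis using True by (simp add: comp_deviation_def)
      qed (simp add: K_def)
    qed
    finally show ?thesis by (simp add: set_lebesgue_integral_def)
  qed
  define A where "A = {\<omega>\<in>space M. U \<omega> < \<epsilon>}"
  have Um: "U \<in> borel_measurable M" using Uint by auto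
  have Aev: "A \<in> events" unfolding A_def using Um by measurable
  have "prob {\<omega>\<in>space M. U \<omega> \<ge> \<epsilon>} \<le> expectation U / \<epsilon>"
    by (rule integral_Markov_inequality_measure[OF Uint, of "{}"]) (use U0 \<epsilon> in auto)
  moreover have "prob {\<omega>\<in>space M. U \<omega> \<ge> \<epsilon>} = 1 - prob A"
  proof -
    have "{\<omega>\<in>space M. U \<omega> \<ge> \<epsilon>} = space M - A" by (auto simp: A_def)
    thus ?thesis using prob_compl[OF Aev] by simp
  qed
  ultimately have pA: "1 - (LBINT s:{0..S}. comp_deviation n (q s)) / \<epsilon> \<le> prob A" by (simp add: EU)
  have "\<bar>excess_integral n (\<lambda>e. X e \<omega>) (b * S) / (real n * b) - (LBINT s:{0..S}. kfun (q s))\<bar> \<le> U \<omega>" for \<omega>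
  proof -
    let ?c = "\<lambda>t. real (ncomp {..<n} (level_graph n (\<lambda>e. X e \<omega>) t)) - 1"
    have cm: "?c \<in> borel_measurable borel"
      by (intro borel_measurable_diff borel_measurable_const level_graph_measurable) auto
    have bset: "set_integrable lborel {0..S} h"
      if "h \<in> borel_measurable borel" "\<And>s. s \<in> {0..S} \<Longrightarrow> \<bar>h s\<bar> \<le> B" for h :: "real \<Rightarrow> real" and B
      unfolding set_integrable_def
    proof (rule integrableI_bounded_set[of "{0..S}" _ _ B])
      show "(\<lambda>s. indicator {0..S} s *\<^sub>R h s) \<in> borel_measurable lborel" using that(1) by measurable
    qed (use that S in auto)
    have i1: "set_integrable lborel {0..S} (\<lambda>s. ?c (b * s) / real n)"
    proof (rule bset[of _ 1])
      show "(\<lambda>s. ?c (b * s) / real n) \<in> borel_measurable borel" using cm by measurable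
      fix s
      show "\<bar>?c (b * s) / real n\<bar> \<le> 1" using ncm[of "\<lambda>e. X e \<omega>" "b * s"] n by (simp add: abs_le_iff divide_le_eq)
    qed
    have i2: "set_integrable lborel {0..S} (\<lambda>s. kfun (q s))"
    proof (rule bset[of _ 1])
      show "(\<lambda>s. kfun (q s)) \<in> borel_measurable borel" using q(1) by measurable
    qed (use q(2) kfun_nonneg kfun_le_one in auto)
    have "excess_integral n (\<lambda>e. X e \<omega>) (b * S) = \<bar>b\<bar> *\<^sub>R (\<integral>s. indicator {0..b * S} (0 + b * s) *\<^sub>R ?c (0 + b * s) \<partial>lborel)"
      unfolding excess_integral_def set_lebesgue_integral_def
      by (rule lborel_integral_real_affine) (use b in simp)
    also have "(\<lambda>s. indicator {0..b * S} (0 + b * s) *\<^sub>R ?c (0 + b * s)) = (\<lambda>s. real n * (indicator {0..S} s *\<^sub>R (?c (b * s) / real n)))"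
      using b n by (auto simp: indicator_def zero_le_mult_iff)
    finally have "excess_integral n (\<lambda>e. X e \<omega>) (b * S) = b * (real n * (LBINT s:{0..S}. ?c (b * s) / real n))"
      using b by (simp add: set_lebesgue_integral_def)
    hence "excess_integral n (\<lambda>e. X e \<omega>) (b * S) / (real n * b) - (LBINT s:{0..S}. kfun (q s)) =
       (LBINT s:{0..S}. ?c (b * s) / real n) - (LBINT s:{0..S}. kfun (q s))"
      using b n by simp
    also have "\<dots> = (LBINT s:{0..S}. D \<omega> s)"
      unfolding D_def by (rule set_integral_diff(2)[OF i1 i2, symmetric])
    also have "\<bar>\<dots>\<bar> \<le> (\<integral>s. \<bar>indicator {0..S} s *\<^sub>R D \<omega> s\<bar> \<partial>lborel)"
      unfolding set_lebesgue_integral_def by (rule integral_abs_bound)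
    also have "(\<lambda>s. \<bar>indicator {0..S} s *\<^sub>R D \<omega> s\<bar>) = K \<omega>" by (auto simp: K_def abs_mult)
    finally show ?thesis by (simp add: U_def)
  qed
  hence "\<forall>\<omega>\<in>A. \<bar>excess_integral n (\<lambda>e. X e \<omega>) (b * S) / (real n * b) - (LBINT s:{0..S}. kfun (q s))\<bar> < \<epsilon>"
    by (auto simp: A_def intro: order.strict_trans1)
  thus ?thesis using Aev pA by blast
qed

text \<open>The constant 12 makes \<open>exp (- x / 6)\<close> at most 1/n^2, so the probability of
  being disconnected is at most n/n^2.\<close>

lemma prob_connected:
  fixes X :: "nat set \<Rightarrow> 'a \<Rightarrow> real"
  assumes ind: "indep_vars (\<lambda>_. borel) X (complete_edges n)"
    and n: "2 \<le> n" and x: "12 * ln (real n) \<le> x" "x \<le> real n"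
    and p: "\<And>e. e \<in> complete_edges n \<Longrightarrow> prob {\<omega>\<in>space M. X e \<omega> \<le> t} = x / real n"
  shows "{\<omega>\<in>space M. ncomp {..<n} (level_graph n (\<lambda>e. X e \<omega>) t) = 1} \<in> events"
    and "1 - 1 / real n \<le> prob {\<omega>\<in>space M. ncomp {..<n} (level_graph n (\<lambda>e. X e \<omega>) t) = 1}"
proof -
  let ?N = "\<lambda>\<omega>. ncomp {..<n} (level_graph n (\<lambda>e. X e \<omega>) t)"
  let ?C = "{\<omega>\<in>space M. ?N \<omega> = 1}"
  have rv: "X e \<in> borel_measurable M" if "e \<in> complete_edges n" for e using ind that by (auto simp: indep_vars_def)
  have m: "(\<lambda>\<omega>. of_bool (?N \<omega> \<noteq> 1) :: real) \<in> borel_measurable M"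
    by (rule level_graph_measurable) (use rv in auto)
  have "{\<omega>\<in>space M. (of_bool (?N \<omega> \<noteq> 1) :: real) = 0} \<in> events" using m by measurable
  thus ev: "?C \<in> events" by (simp cong: conj_cong)
  have "ln 2 \<le> ln (real n)" using n by simp
  moreover have "0 < ln (2::real)" by simp
  ultimately have x6: "6 * ln 2 \<le> x" using x by linarith
  have "1 - prob ?C = prob (space M - ?C)" using prob_compl[OF ev] by simp
  also have "\<dots> = expectation (indicator (space M - ?C))" using ev by (simp add: Int_absorb1)
  also have "\<dots> = expectation (\<lambda>\<omega>. of_bool (?N \<omega> \<noteq> 1))"
    by (rule Bochner_Integration.integral_cong) (auto simp: indicator_def of_bool_def)
  also have "\<dots> = bexp (x / real n) (complete_edges n) (\<lambda>E. of_bool (ncomp {..<n} E \<noteq> 1))"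
    by (rule expectation_level_graph[OF ind p])
  also have "\<dots> \<le> real n * exp (- x / 6)" by (rule bexp_disconnected[OF n x6 x(2)])
  also have "\<dots> \<le> real n * exp (- (2 * ln (real n)))" using x by (intro mult_left_mono) auto
  also have "exp (- (2 * ln (real n))) = 1 / (real n)\<^sup>2"
    using n by (simp add: exp_minus exp_double inverse_eq_divide)
  also have "real n * (1 / (real n)\<^sup>2) = 1 / real n" using n by (simp add: power2_eq_square)
  finally show "1 - 1 / real n \<le> prob ?C" by linarith
qed

text \<open>\<open>c\<close> is the range of V within which the event can occur, and
  \<open>t \<le> 1\<close> makes the upper end of U irrelevant. The area below u = t - l v is a
  triangle if \<open>l * c = t\<close> and a trapezoid if \<open>c = 1\<close>. Describing
  \<open>c\<close> by conditions instead of a quotient includes \<open>l = 0\<close>.\<close>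

lemma prob_sum_uniform:
  fixes U V :: "'a \<Rightarrow> real"
  assumes ind: "indep_var borel U borel V"
    and dU: "distr M borel U = uniform_measure lborel {0..1}"
    and dV: "distr M borel V = uniform_measure lborel {0..1}"
    and c: "0 \<le> l" "0 \<le> t" "t \<le> 1" "0 \<le> c" "c \<le> 1" "l * c \<le> t" "c = 1 \<or> l * c = t"
  shows "prob {\<omega>\<in>space M. U \<omega> + l * V \<omega> \<le> t} = t * c - l * c\<^sup>2 / 2"
proof -
  let ?u = "uniform_measure lborel {0..1} :: real measure"
  interpret u: prob_space ?u by (rule prob_space_uniform_measure) auto
  let ?A = "{z :: real \<times> real. fst z + l * snd z \<le> t}"
  have "{z \<in> space (borel \<Otimes>\<^sub>M borel). fst z + l * snd z \<le> t} \<in> sets (borel \<Otimes>\<^sub>M borel)" by measurable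
  hence A: "?A \<in> sets (borel \<Otimes>\<^sub>M borel)" by (simp add: space_pair_measure)
  have su: "sets ?u = sets borel" by simp
  have A': "?A \<in> sets (?u \<Otimes>\<^sub>M ?u)" using A sets_pair_measure_cong[OF su su] by simp
  have rvs: "U \<in> borel_measurable M" "V \<in> borel_measurable M"
    using ind by (auto dest: indep_var_rv1 indep_var_rv2)
  have joint: "?u \<Otimes>\<^sub>M ?u = distr M (borel \<Otimes>\<^sub>M borel) (\<lambda>x. (U x, V x))"
    using ind dU dV unfolding indep_var_distribution_eq by simp
  interpret P: pair_sigma_finite ?u ?u ..
  have "emeasure M {\<omega>\<in>space M. U \<omega> + l * V \<omega> \<le> t} = emeasure (distr M (borel \<Otimes>\<^sub>M borel) (\<lambda>x. (U x, V x))) ?A"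
    using A rvs by (subst emeasure_distr) (auto intro!: arg_cong[where f = "emeasure M"])
  also have "\<dots> = (\<integral>\<^sup>+v. emeasure ?u ((\<lambda>u. (u, v)) -` ?A) \<partial>?u)"
    unfolding joint[symmetric] by (rule P.emeasure_pair_measure_alt2[OF A'])
  also have "\<dots> = (\<integral>\<^sup>+v. emeasure ?u {..t - l * v} \<partial>?u)"
    by (intro nn_integral_cong arg_cong[where f = "emeasure ?u"]) (auto simp: le_diff_eq)
  also have "\<dots> = (\<integral>\<^sup>+v. emeasure lborel ({0..1} \<inter> {..t - l * v}) * indicator {0..1} v \<partial>lborel)"
  proof -
    have eq: "emeasure ?u {..t - l * v} = emeasure lborel ({0..1} \<inter> {..t - l * v})" for v
      by (subst emeasure_uniform_measure) (auto simp: divide_ennreal_def)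
    have "{0..1} \<inter> {..t - l * v} = {0..min 1 (t - l * v)}" for v :: real by auto
    hence "(\<lambda>v. emeasure lborel ({0..1} \<inter> {..t - l * v})) = (\<lambda>v. ennreal (max 0 (min 1 (t - l * v))))"
      by (auto simp: fun_eq_iff emeasure_lborel_Icc_eq max_def)
    hence "(\<lambda>v. emeasure lborel ({0..1} \<inter> {..t - l * v})) \<in> borel_measurable lborel" by simp
    thus ?thesis unfolding eq by (subst nn_integral_uniform_measure) (auto simp: divide_ennreal_def)
  qed
  also have "\<dots> = (\<integral>\<^sup>+v. ennreal (t - l * v) * indicator {0..c} v \<partial>lborel)"
  proof (rule nn_integral_cong)
    fix v :: real
    show "emeasure lborel ({0..1} \<inter> {..t - l * v}) * indicator {0..1} v = ennreal (t - l * v) * indicator {0..c} v"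
    proof (cases "0 \<le> v \<and> v \<le> 1")
      case True
      have Icc: "{0..1} \<inter> {..t - l * v} = {0..t - l * v}"
      proof -
        have "t - l * v \<le> 1" using True c mult_nonneg_nonneg[of l v] by linarith
        thus ?thesis by (auto simp: min_absorb2)
      qed
      show ?thesis
      proof (cases "v \<le> c")
        case le: True
        hence "l * v \<le> t" using c mult_left_mono[of v c l] by linarith
        thus ?thesis unfolding Icc using True le by simp
      next
        case False
        hence "l * c = t" using c True by auto
        hence "t - l * v \<le> 0" using False c mult_left_mono[of c v l] by linarith
        hence "emeasure lborel {0..t - l * v} = 0" by (simp add: emeasure_lborel_Icc_eq)
        thus ?thesis unfolding Icc using False by simp
      qed
    qed (use c in \<open>auto simp: indicator_def\<close>)
  qed
  also have "\<dots> = ennreal ((t * c - l * c\<^sup>2 / 2) - (t * 0 - l * 0\<^sup>2 / 2))"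
  proof (rule nn_integral_FTC_Icc)
    fix v assume "v \<in> {0..c}"
    hence v: "0 \<le> v" "v \<le> c" by auto
    show "((\<lambda>v. t * v - l * v\<^sup>2 / 2) has_real_derivative t - l * v) (at v)"
      by (auto intro!: derivative_eq_intros)
    show "0 \<le> t - l * v" using v c mult_left_mono[of v c l] by linarith
  qed (use c in auto)
  also have "(t * c - l * c\<^sup>2 / 2) - (t * 0 - l * 0\<^sup>2 / 2) = t * c - l * c\<^sup>2 / 2" by simp
  finally have "ennreal (prob {\<omega>\<in>space M. U \<omega> + l * V \<omega> \<le> t}) = ennreal (t * c - l * c\<^sup>2 / 2)"
    by (simp add: emeasure_eq_measure)
  moreover have "0 \<le> t * c - l * c\<^sup>2 / 2"
  proof -
    have "(l * c) * c \<le> t * c" using c by (intro mult_right_mono) auto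
    moreover have "0 \<le> t * c" using c by simp
    ultimately show ?thesis by (simp add: power2_eq_square)
  qed
  ultimately show ?thesis by simp
qed

text \<open>The independent family is grouped into the pairs \<open>{Inl e, Inr e}\<close>, and a
  function of disjoint groups stays independent. Both orders of a pair are recorded because the
  roles of weight and cost are exchanged later.\<close>

lemma indep_edge_lengths:
  fixes W C :: "nat set \<Rightarrow> 'a \<Rightarrow> real"
  assumes ind: "indep_vars (\<lambda>_. borel) (case_sum W C) (F <+> F)"
  shows "indep_vars (\<lambda>_. borel) (\<lambda>e \<omega>. a * W e \<omega> + b * C e \<omega>) F"
    and "e \<in> F \<Longrightarrow> indep_var borel (W e) borel (C e)"
    and "e \<in> F \<Longrightarrow> indep_var borel (C e) borel (W e)"
proof -
  let ?K = "\<lambda>e. {Inl e, Inr e} :: (nat set + nat set) set"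
  let ?Y = "\<lambda>e (x :: nat set + nat set \<Rightarrow> real). a * x (Inl e) + b * x (Inr e)"
  have "indep_vars (\<lambda>e. PiM (?K e) (\<lambda>_. borel)) (\<lambda>e \<omega>. restrict (\<lambda>i. case_sum W C i \<omega>) (?K e)) F"
    by (rule indep_vars_restrict[OF ind]) (auto simp: disjoint_family_on_def)
  hence "indep_vars (\<lambda>_. borel) (\<lambda>e \<omega>. ?Y e (restrict (\<lambda>i. case_sum W C i \<omega>) (?K e))) F"
    by (rule indep_vars_compose2) measurable
  thus "indep_vars (\<lambda>_. borel) (\<lambda>e \<omega>. a * W e \<omega> + b * C e \<omega>) F" by simp
  assume e: "e \<in> F"
  have "indep_var borel ((\<lambda>x. x (Inl e)) \<circ> (\<lambda>\<omega>. restrict (\<lambda>i. case_sum W C i \<omega>) {Inl e}))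
     borel ((\<lambda>x. x (Inr e)) \<circ> (\<lambda>\<omega>. restrict (\<lambda>i. case_sum W C i \<omega>) {Inr e}))"
    by (rule indep_var_compose[OF indep_var_restrict[OF ind]]) (use e in auto)
  thus "indep_var borel (W e) borel (C e)" by (simp add: o_def)
  have "indep_var borel ((\<lambda>x. x (Inr e)) \<circ> (\<lambda>\<omega>. restrict (\<lambda>i. case_sum W C i \<omega>) {Inr e}))
     borel ((\<lambda>x. x (Inl e)) \<circ> (\<lambda>\<omega>. restrict (\<lambda>i. case_sum W C i \<omega>) {Inl e}))"
    by (rule indep_var_compose[OF indep_var_restrict[OF ind]]) (use e in auto)
  thus "indep_var borel (C e) borel (W e)" by (simp add: o_def)
qed

lemma AE_uniform_nonneg:
  assumes "U \<in> borel_measurable M" "distr M borel U = uniform_measure lborel {0..1::real}"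
  shows "AE \<omega> in M. 0 \<le> U \<omega>"
proof -
  have "AE x in uniform_measure lborel {0..1::real}. 0 \<le> x"
    by (rule AE_uniform_measureI) auto
  thus ?thesis unfolding assms(2)[symmetric] using assms(1) by (subst (asm) AE_distr_iff) auto
qed

end

section \<open>Events of probability tending to one\<close>

text \<open>Unlike \<open>whp\<close>, this notion needs no measurability and hence is closed under weakening.\<close>
definition aas :: "(nat \<Rightarrow> 'a measure) \<Rightarrow> (nat \<Rightarrow> 'a \<Rightarrow> bool) \<Rightarrow> bool" where
  "aas M P \<longleftrightarrow> (\<exists>A. (\<forall>n. A n \<in> sets (M n)) \<and> (\<forall>n. \<forall>\<omega>\<in>A n. P n \<omega>) \<and> (\<lambda>n. measure (M n) (A n)) \<longlonglongrightarrow> 1)"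

text \<open>For each \<open>n\<close> an event meeting the bound is chosen if there is one, and the
  empty set otherwise, which happens for finitely many \<open>n\<close> only.\<close>

lemma aasI:
  assumes "\<And>n. prob_space (M n)" "g \<longlonglongrightarrow> 1"
    and "\<forall>\<^sub>F n in sequentially. \<exists>A\<in>sets (M n). (\<forall>\<omega>\<in>A. P n \<omega>) \<and> g n \<le> measure (M n) A"
  shows "aas M P"
proof -
  let ?Q = "\<lambda>n A. A \<in> sets (M n) \<and> (\<forall>\<omega>\<in>A. P n \<omega>) \<and> g n \<le> measure (M n) A"
  define A where "A n = (if \<exists>A. ?Q n A then SOME A. ?Q n A else {})" for n
  have A: "?Q n (A n)" if "\<exists>A. ?Q n A" for n
    unfolding A_def using someI_ex[OF that] that by simp
  have A0: "A n = {}" if "\<not> (\<exists>A. ?Q n A)" for n unfolding A_def if_not_P[OF that] ..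
  have ev: "\<forall>\<^sub>F n in sequentially. g n \<le> measure (M n) (A n)"
    using assms(3) by eventually_elim (use A in blast)
  have "(\<lambda>n. measure (M n) (A n)) \<longlonglongrightarrow> 1"
    by (rule tendsto_sandwich[OF ev _ assms(2) tendsto_const])
      (use prob_space.prob_le_1[OF assms(1)] in auto)
  moreover have "A n \<in> sets (M n) \<and> (\<forall>\<omega>\<in>A n. P n \<omega>)" for n
    using A[of n] A0[of n] by (cases "\<exists>A. ?Q n A") auto
  ultimately show ?thesis unfolding aas_def by blast
qed

lemma aas_conj:
  assumes M: "\<And>n. prob_space (M n)" and "aas M P" "aas M Q"
  shows "aas M (\<lambda>n \<omega>. P n \<omega> \<and> Q n \<omega>)"
proof -
  obtain A where A: "\<And>n. A n \<in> sets (M n)" "\<And>n \<omega>. \<omega> \<in> A n \<Longrightarrow> P n \<omega>" "(\<lambda>n. measure (M n) (A n)) \<longlonglongrightarrow> 1"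
    using assms(2) unfolding aas_def by auto
  obtain B where B: "\<And>n. B n \<in> sets (M n)" "\<And>n \<omega>. \<omega> \<in> B n \<Longrightarrow> Q n \<omega>" "(\<lambda>n. measure (M n) (B n)) \<longlonglongrightarrow> 1"
    using assms(3) unfolding aas_def by auto
  have "(\<lambda>n. measure (M n) (A n) + measure (M n) (B n) - 1) \<longlonglongrightarrow> 1 + 1 - 1"
    by (intro tendsto_intros A B)
  hence lim: "(\<lambda>n. measure (M n) (A n) + measure (M n) (B n) - 1) \<longlonglongrightarrow> 1" by simp
  have "measure (M n) (A n) + measure (M n) (B n) - 1 \<le> measure (M n) (A n \<inter> B n)" for n
  proof -
    interpret prob_space "M n" by (rule M)
    have "measure (M n) (A n \<union> B n) = measure (M n) (A n) + measure (M n) (B n) - measure (M n) (A n \<inter> B n)"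
      by (rule measure_Un3) (use A(1)[of n] B(1)[of n] in \<open>auto simp: fmeasurable_eq_sets\<close>)
    moreover have "measure (M n) (A n \<union> B n) \<le> 1" by simp
    ultimately show ?thesis by linarith
  qed
  thus ?thesis
    using A B by (intro aasI[OF M lim] always_eventually allI bexI[of _ "A _ \<inter> B _"]) auto
qed

lemma aas_mono:
  assumes M: "\<And>n. prob_space (M n)" and "aas M P" "\<forall>\<^sub>F n in sequentially. \<forall>\<omega>\<in>space (M n). P n \<omega> \<longrightarrow> Q n \<omega>"
  shows "aas M Q"
proof -
  obtain A where A: "\<And>n. A n \<in> sets (M n)" "\<And>n \<omega>. \<omega> \<in> A n \<Longrightarrow> P n \<omega>" "(\<lambda>n. measure (M n) (A n)) \<longlonglongrightarrow> 1"
    using assms(2) unfolding aas_def by auto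
  show ?thesis
  proof (rule aasI[OF M A(3)])
    show "\<forall>\<^sub>F n in sequentially. \<exists>B\<in>sets (M n). (\<forall>\<omega>\<in>B. Q n \<omega>) \<and> measure (M n) (A n) \<le> measure (M n) B"
      using assms(3)
    proof eventually_elim
      case (elim n)
      thus ?case using A sets.sets_into_space[OF A(1)[of n]] by (intro bexI[of _ "A n"]) auto
    qed
  qed
qed

text \<open>The measurability assumption is essential, as \<open>measure\<close> assigns 0 to a
  nonmeasurable set.\<close>

lemma aas_imp_whp:
  assumes M: "\<And>n. prob_space (M n)" and "aas M P"
    and meas: "\<forall>\<^sub>F n in sequentially. {\<omega>\<in>space (M n). P n \<omega>} \<in> sets (M n)"
  shows "whp M P"
proof -
  obtain A where A: "\<And>n. A n \<in> sets (M n)" "\<And>n \<omega>. \<omega> \<in> A n \<Longrightarrow> P n \<omega>" "(\<lambda>n. measure (M n) (A n)) \<longlonglongrightarrow> 1"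
    using assms(2) unfolding aas_def by auto
  have le: "\<forall>\<^sub>F n in sequentially. measure (M n) (A n) \<le> measure (M n) {\<omega>\<in>space (M n). P n \<omega>}"
    using meas
  proof eventually_elim
    case (elim n)
    interpret prob_space "M n" by (rule M)
    show ?case using A(2)[of _ n] sets.sets_into_space[OF A(1)[of n]] elim
      by (intro finite_measure_mono) auto
  qed
  show ?thesis unfolding whp_def
    by (rule tendsto_sandwich[OF le _ A(3) tendsto_const])
      (use prob_space.prob_le_1[OF M] in auto)
qed

section \<open>Convergence of the minimum spanning tree length\<close>

lemma comp_deviation_measurable [measurable]: "comp_deviation n \<in> borel_measurable borel"
  unfolding comp_deviation_def[abs_def] bexp_def by measurable

lemma comp_deviation_nonneg:
  assumes "0 \<le> x" "x \<le> real n"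
  shows "0 \<le> comp_deviation n x"
proof -
  have "bexp (x / real n) (complete_edges n) (\<lambda>_. 0) \<le> comp_deviation n x"
    unfolding comp_deviation_def using assms by (intro bexp_mono) (auto simp: divide_le_eq)
  thus ?thesis by simp
qed

definition is_mst_value :: "nat \<Rightarrow> (nat set \<Rightarrow> real) \<Rightarrow> real \<Rightarrow> bool" where
  "is_mst_value n X m \<longleftrightarrow>
     (\<forall>T\<in>spanning_trees n. m \<le> (\<Sum>e\<in>T. X e)) \<and> (\<exists>T\<in>spanning_trees n. (\<Sum>e\<in>T. X e) = m)"

text \<open>Levels are measured in the unit \<open>b n\<close>; at level \<open>b n * s\<close> an
  edge is present with probability \<open>q s / real n\<close>. Three events are combined: the
  integral up to the cutoff \<open>S n\<close> is close to its limit, the graph at the cutoff is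
  connected, and all lengths are nonnegative. On them the truncated integral is the length of a
  minimum spanning tree.\<close>

theorem mst_limit:
  fixes M :: "nat \<Rightarrow> 'a measure" and X :: "nat \<Rightarrow> nat set \<Rightarrow> 'a \<Rightarrow> real" and q :: "real \<Rightarrow> real"
  assumes M: "\<And>n. prob_space (M n)"
    and ind: "\<And>n. prob_space.indep_vars (M n) (\<lambda>_. borel) (X n) (complete_edges n)"
    and X0: "\<And>n e. e \<in> complete_edges n \<Longrightarrow> AE \<omega> in M n. 0 \<le> X n e \<omega>"
    and q: "q \<in> borel_measurable borel" "\<And>s. 0 \<le> s \<Longrightarrow> 0 \<le> q s"
    and qint: "set_integrable lborel {0..} (\<lambda>s. exp (- q s / 6))"
    and S: "filterlim S at_top sequentially"
    and ev: "\<forall>\<^sub>F n in sequentially. 0 < b n \<and> 12 * ln (real n) \<le> q (S n) \<and>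
       (\<forall>s. 0 \<le> s \<longrightarrow> s \<le> S n \<longrightarrow> q s \<le> real n \<and>
          (\<forall>e\<in>complete_edges n. measure (M n) {\<omega>\<in>space (M n). X n e \<omega> \<le> b n * s} = q s / real n))"
    and \<epsilon>: "0 < \<epsilon>"
  shows "aas M (\<lambda>n \<omega>. \<exists>m. is_mst_value n (\<lambda>e. X n e \<omega>) m \<and> \<bar>m / (real n * b n) - (LBINT s:{0..}. kfun (q s))\<bar> < \<epsilon>)"
proof -
  define ok where "ok n \<longleftrightarrow> 2 \<le> n \<and> 0 \<le> S n \<and> 0 < b n \<and> 12 * ln (real n) \<le> q (S n) \<and>
       (\<forall>s. 0 \<le> s \<longrightarrow> s \<le> S n \<longrightarrow> q s \<le> real n \<and>
          (\<forall>e\<in>complete_edges n. measure (M n) {\<omega>\<in>space (M n). X n e \<omega> \<le> b n * s} = q s / real n))" for n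
  have S0: "\<forall>\<^sub>F n in sequentially. 0 \<le> S n" using S by (auto simp: filterlim_at_top)
  have ok: "\<forall>\<^sub>F n in sequentially. ok n"
    using ev S0 eventually_ge_at_top[of 2] by eventually_elim (auto simp: ok_def)
  let ?I = "LBINT s:{0..}. kfun (q s)"
  let ?In = "\<lambda>n. LBINT s:{0..S n}. kfun (q s)"
  let ?Z = "\<lambda>n \<omega>. excess_integral n (\<lambda>e. X n e \<omega>) (b n * S n)"
  have wint: "integrable lborel (\<lambda>s. c * (indicator {0..} s *\<^sub>R exp (- q s / 6)))" for c
    using qint unfolding set_integrable_def by (rule integrable_mult_right)
  have lim_ind: "(\<lambda>n. indicator {0..S n} s :: real) \<longlonglongrightarrow> indicator {0..} s" for s
  proof -
    have "\<forall>\<^sub>F n in sequentially. s \<le> S n" using S by (auto simp: filterlim_at_top)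
    hence "\<forall>\<^sub>F n in sequentially. indicator {0..S n} s = (indicator {0..} s :: real)"
      by eventually_elim (auto simp: indicator_def)
    thus ?thesis by (rule tendsto_eventually)
  qed
  have In_lim: "?In \<longlonglongrightarrow> ?I"
    unfolding set_lebesgue_integral_def
  proof (rule integral_dominated_convergence[OF _ _ wint[of 2]])
    show "(\<lambda>s. indicator {0..} s *\<^sub>R kfun (q s)) \<in> borel_measurable lborel"
      "(\<lambda>s. indicator {0..S i} s *\<^sub>R kfun (q s)) \<in> borel_measurable lborel" for i
      using q(1) by measurable
    show "AE x in lborel. (\<lambda>i. indicator {0..S i} x *\<^sub>R kfun (q x)) \<longlonglongrightarrow> indicator {0..} x *\<^sub>R kfun (q x)"
      by (intro AE_I2 tendsto_scaleR lim_ind tendsto_const)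
    have "\<bar>kfun (q s)\<bar> \<le> 2 * exp (- q s / 6)" if "0 \<le> s" for s
      using kfun_le_exp[OF q(2)[OF that]] kfun_nonneg[OF q(2)[OF that]] by simp
    thus "AE x in lborel. norm (indicator {0..S i} x *\<^sub>R kfun (q x)) \<le> 2 * (indicator {0..} x *\<^sub>R exp (- q x / 6))" for i
      by (intro AE_I2) (auto simp: indicator_def)
  qed
  \<comment> \<open>Set to 0 for the finitely many \<open>n\<close> that violate the hypotheses, so
    that the majorant holds for every \<open>n\<close>.\<close>
  define u where "u n s = (if ok n then indicator {0..S n} s * comp_deviation n (q s) else 0)" for n s
  have u_lim: "(\<lambda>n. \<integral>s. u n s \<partial>lborel) \<longlonglongrightarrow> (\<integral>s. (0::real) \<partial>(lborel :: real measure))"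
  proof (rule integral_dominated_convergence[OF _ _ wint[of 4]])
    show "u i \<in> borel_measurable lborel" for i
      unfolding u_def using q(1) by (cases "ok i") (simp_all, measurable)
    show "AE x in lborel. (\<lambda>i. u i x) \<longlonglongrightarrow> 0"
    proof (rule AE_I2)
      fix s :: real
      show "(\<lambda>n. u n s) \<longlonglongrightarrow> 0"
      proof (cases "0 \<le> s")
        case True
        have "(\<lambda>n. indicator {0..S n} s * comp_deviation n (q s)) \<longlonglongrightarrow> indicator {0..} s * 0"
          by (intro tendsto_mult lim_ind comp_deviation_limit q(2) True)
        moreover have "\<forall>\<^sub>F n in sequentially. indicator {0..S n} s * comp_deviation n (q s) = u n s"
          using ok by eventually_elim (simp add: u_def)
        ultimately show ?thesis by (simp add: Lim_transform_eventually)
      next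
        case False
        hence "u n s = 0" for n by (auto simp: u_def indicator_def)
        thus ?thesis by simp
      qed
    qed
    show "AE x in lborel. norm (u i x) \<le> 4 * (indicator {0..} x *\<^sub>R exp (- q x / 6))" for i
    proof (intro AE_I2)
      fix s :: real
      show "norm (u i s) \<le> 4 * (indicator {0..} s *\<^sub>R exp (- q s / 6))"
      proof (cases "ok i \<and> 0 \<le> s \<and> s \<le> S i")
        case True
        hence "0 \<le> q s" "q s \<le> real i" "2 \<le> i" using q(2) by (auto simp: ok_def)
        thus ?thesis using True comp_deviation_le[of i "q s"] comp_deviation_nonneg[of "q s" i]
          by (simp add: u_def)
      next
        case False
        hence "u i s = 0" by (auto simp: u_def indicator_def)
        thus ?thesis by simp
      qed
    qed
  qed auto
  have "aas M (\<lambda>n \<omega>. \<bar>?Z n \<omega> / (real n * b n) - ?In n\<bar> < \<epsilon> / 2)"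
  proof (rule aasI[OF M])
    have "(\<lambda>n. 1 - (\<integral>s. u n s \<partial>lborel) / (\<epsilon> / 2)) \<longlonglongrightarrow> 1 - (\<integral>s. (0::real) \<partial>(lborel :: real measure)) / (\<epsilon> / 2)"
      using \<epsilon> by (intro tendsto_diff tendsto_divide u_lim tendsto_const) simp
    thus "(\<lambda>n. 1 - (\<integral>s. u n s \<partial>lborel) / (\<epsilon> / 2)) \<longlonglongrightarrow> 1" by simp
    show "\<forall>\<^sub>F n in sequentially. \<exists>A\<in>sets (M n). (\<forall>\<omega>\<in>A. \<bar>?Z n \<omega> / (real n * b n) - ?In n\<bar> < \<epsilon> / 2) \<and>
        1 - (\<integral>s. u n s \<partial>lborel) / (\<epsilon> / 2) \<le> measure (M n) A"
      using ok
    proof eventually_elim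
      case (elim n)
      interpret prob_space "M n" by (rule M)
      have "(\<integral>s. u n s \<partial>lborel) = (LBINT s:{0..S n}. comp_deviation n (q s))"
        using elim by (simp add: u_def set_lebesgue_integral_def)
      moreover have "\<exists>A\<in>events. (\<forall>\<omega>\<in>A. \<bar>?Z n \<omega> / (real n * b n) - ?In n\<bar> < \<epsilon> / 2) \<and>
          1 - (LBINT s:{0..S n}. comp_deviation n (q s)) / (\<epsilon> / 2) \<le> prob A"
        by (rule excess_deviation[OF ind]) (use elim q \<epsilon> in \<open>auto simp: ok_def\<close>)
      ultimately show ?case by simp
    qed
  qed
  moreover have "aas M (\<lambda>n \<omega>. ncomp {..<n} (level_graph n (\<lambda>e. X n e \<omega>) (b n * S n)) = 1)"
  proof (rule aasI[OF M])
    have "(\<lambda>n. 1 - 1 / real n) \<longlonglongrightarrow> 1 - 0" by (intro tendsto_intros lim_const_over_n)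
    thus "(\<lambda>n. 1 - 1 / real n) \<longlonglongrightarrow> 1" by simp
    show "\<forall>\<^sub>F n in sequentially. \<exists>A\<in>sets (M n). (\<forall>\<omega>\<in>A. ncomp {..<n} (level_graph n (\<lambda>e. X n e \<omega>) (b n * S n)) = 1) \<and>
        1 - 1 / real n \<le> measure (M n) A"
      using ok
    proof eventually_elim
      case (elim n)
      interpret prob_space "M n" by (rule M)
      show ?case
        using prob_connected[OF ind[of n], where x = "q (S n)" and t = "b n * S n"] elim
        by (intro bexI[of _ "{\<omega>\<in>space (M n). ncomp {..<n} (level_graph n (\<lambda>e. X n e \<omega>) (b n * S n)) = 1}"])
          (auto simp: ok_def)
    qed
  qed
  \<comment> \<open>The lemmas on trees are deterministic and ask for nonnegative lengths, which
    hold only almost surely; this becomes a third event, of probability 1.\<close>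
  moreover have "aas M (\<lambda>n \<omega>. \<forall>e\<in>complete_edges n. 0 \<le> X n e \<omega>)"
  proof (rule aasI[OF M tendsto_const[of 1]], rule always_eventually, rule allI)
    fix n
    interpret prob_space "M n" by (rule M)
    have rv: "X n e \<in> borel_measurable (M n)" if "e \<in> complete_edges n" for e
      using ind[of n] that by (auto simp: indep_vars_def)
    have "{\<omega>\<in>space (M n). \<forall>e\<in>complete_edges n. 0 \<le> X n e \<omega>} \<in> events"
    proof (rule sets.sets_Collect_finite_All)
      fix e assume "e \<in> complete_edges n"
      note [measurable] = rv[OF this]
      show "{\<omega>\<in>space (M n). 0 \<le> X n e \<omega>} \<in> events" by measurable
    qed auto
    moreover have "AE \<omega> in M n. \<forall>e\<in>complete_edges n. 0 \<le> X n e \<omega>"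
      using X0 by (intro AE_finite_allI) auto
    ultimately have "prob {\<omega>\<in>space (M n). \<forall>e\<in>complete_edges n. 0 \<le> X n e \<omega>} = 1"
      by (subst prob_Collect_eq_1) auto
    thus "\<exists>A\<in>events. (\<forall>\<omega>\<in>A. \<forall>e\<in>complete_edges n. 0 \<le> X n e \<omega>) \<and> 1 \<le> prob A"
      using \<open>{\<omega>\<in>space (M n). \<forall>e\<in>complete_edges n. 0 \<le> X n e \<omega>} \<in> events\<close> by (intro bexI) auto
  qed
  ultimately have "aas M (\<lambda>n \<omega>. \<bar>?Z n \<omega> / (real n * b n) - ?In n\<bar> < \<epsilon> / 2 \<and>
      ncomp {..<n} (level_graph n (\<lambda>e. X n e \<omega>) (b n * S n)) = 1 \<and> (\<forall>e\<in>complete_edges n. 0 \<le> X n e \<omega>))"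
    by (intro aas_conj[OF M])
  thus ?thesis
  proof (rule aas_mono[OF M])
    have "\<forall>\<^sub>F n in sequentially. dist (?In n) ?I < \<epsilon> / 2" using \<epsilon> by (intro tendstoD[OF In_lim]) simp
    with ok show "\<forall>\<^sub>F n in sequentially. \<forall>\<omega>\<in>space (M n). \<bar>?Z n \<omega> / (real n * b n) - ?In n\<bar> < \<epsilon> / 2 \<and>
      ncomp {..<n} (level_graph n (\<lambda>e. X n e \<omega>) (b n * S n)) = 1 \<and> (\<forall>e\<in>complete_edges n. 0 \<le> X n e \<omega>) \<longrightarrow>
      (\<exists>m. is_mst_value n (\<lambda>e. X n e \<omega>) m \<and> \<bar>m / (real n * b n) - ?I\<bar> < \<epsilon>)"
    proof eventually_elim
      case (elim n)
      have tri: "\<bar>x - z\<bar> < e" if "\<bar>x - y\<bar> < e / 2" "\<bar>y - z\<bar> < e / 2" for x y z e :: real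
        using that by argo
      show ?case
      proof (intro ballI impI exI[of _ "?Z n _"] conjI)
        fix \<omega> assume *: "\<bar>?Z n \<omega> / (real n * b n) - ?In n\<bar> < \<epsilon> / 2 \<and>
          ncomp {..<n} (level_graph n (\<lambda>e. X n e \<omega>) (b n * S n)) = 1 \<and> (\<forall>e\<in>complete_edges n. 0 \<le> X n e \<omega>)"
        have n: "0 < n" "0 \<le> b n * S n" using elim(1) by (auto simp: ok_def)
        show "is_mst_value n (\<lambda>e. X n e \<omega>) (?Z n \<omega>)"
          unfolding is_mst_value_def
          using excess_integral_le_tree[OF n(1) _ n(2), of "\<lambda>e. X n e \<omega>"]
            excess_integral_tree[OF n(1) _ n(2), of "\<lambda>e. X n e \<omega>"] * by auto
        show "\<bar>?Z n \<omega> / (real n * b n) - ?I\<bar> < \<epsilon>" by (rule tri[OF conjunct1[OF *] elim(2)[unfolded dist_real_def]])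
      qed
    qed
  qed
qed

section \<open>Lagrangian relaxation of the cost constraint\<close>

lemma min_weight_eqI:
  assumes lower: "\<And>T. T \<in> spanning_trees n \<Longrightarrow> (\<Sum>e\<in>T. c e) \<le> c0 \<Longrightarrow> L \<le> (\<Sum>e\<in>T. w e)"
    and T: "T \<in> spanning_trees n" "(\<Sum>e\<in>T. c e) \<le> c0" "(\<Sum>e\<in>T. w e) \<le> R"
  shows "\<exists>x. min_weight n w c c0 = ereal x \<and> L \<le> x \<and> x \<le> R"
proof -
  have 1: "ereal L \<le> min_weight n w c c0"
    unfolding min_weight_def by (rule INF_greatest) (use lower in auto)
  have "min_weight n w c c0 \<le> ereal (\<Sum>e\<in>T. w e)"
    unfolding min_weight_def by (rule INF_lower) (use T in auto)
  also have "\<dots> \<le> ereal R" using T by simp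
  finally have 2: "min_weight n w c c0 \<le> ereal R" .
  obtain x where x: "min_weight n w c c0 = ereal x" using 1 2 by (cases "min_weight n w c c0") auto
  show ?thesis using 1 2 unfolding x by auto
qed

text \<open>If \<open>T\<close> is optimal for the multiplier \<open>\<mu>\<^sub>2\<close>, then its cost lies between the slopes of the
  concave dual function on \<open>[\<mu>\<^sub>2, \<mu>\<^sub>3]\<close> and on \<open>[\<mu>\<^sub>1, \<mu>\<^sub>2]\<close>.\<close>
lemma lagrange_sandwich:
  fixes w c :: "nat set \<Rightarrow> real"
  assumes m0: "is_mst_value n (\<lambda>e. w e + \<mu>0 * c e) m0" and "0 \<le> \<mu>0"
    and m1: "is_mst_value n (\<lambda>e. w e + (\<mu> - \<delta>) * c e) m1"
    and m2: "is_mst_value n (\<lambda>e. w e + \<mu> * c e) m2"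
    and m3: "is_mst_value n (\<lambda>e. w e + (\<mu> + \<delta>) * c e) m3"
    and \<delta>: "0 < \<delta>" and \<mu>: "0 \<le> \<mu>" and feas: "(m2 - m1) / \<delta> \<le> \<gamma>"
  shows "\<exists>x. min_weight n w c \<gamma> = ereal x \<and> m0 - \<mu>0 * \<gamma> \<le> x \<and> x \<le> m2 - \<mu> * ((m3 - m2) / \<delta>)"
proof -
  have lin: "(\<Sum>e\<in>T. w e + b * c e) = (\<Sum>e\<in>T. w e) + b * (\<Sum>e\<in>T. c e)" for T b
    by (simp add: sum.distrib sum_distrib_left)
  obtain T where T: "T \<in> spanning_trees n" "(\<Sum>e\<in>T. w e) + \<mu> * (\<Sum>e\<in>T. c e) = m2"
    using m2 by (auto simp: is_mst_value_def lin)
  let ?c = "\<Sum>e\<in>T. c e" and ?w = "\<Sum>e\<in>T. w e"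
  have "m1 \<le> ?w + (\<mu> - \<delta>) * ?c" "m3 \<le> ?w + (\<mu> + \<delta>) * ?c"
    using m1 m3 T(1) by (auto simp: is_mst_value_def lin)
  hence "\<delta> * ?c \<le> m2 - m1" "m3 - m2 \<le> \<delta> * ?c" using T(2) by (simp_all add: algebra_simps)
  hence c: "?c \<le> (m2 - m1) / \<delta>" "(m3 - m2) / \<delta> \<le> ?c" using \<delta> by (simp_all add: field_simps)
  show ?thesis
  proof (rule min_weight_eqI[OF _ T(1)])
    show "?c \<le> \<gamma>" using c feas by linarith
    have "\<mu> * ((m3 - m2) / \<delta>) \<le> \<mu> * ?c" using c \<mu> by (intro mult_left_mono) auto
    thus "?w \<le> m2 - \<mu> * ((m3 - m2) / \<delta>)" using T(2) by linarith
    \<comment> \<open>Weak duality, at the multiplier \<open>\<mu>0\<close>, which may differ from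
      the one that produced \<open>T\<close>.\<close>
    fix T' assume T': "T' \<in> spanning_trees n" "(\<Sum>e\<in>T'. c e) \<le> \<gamma>"
    have "m0 \<le> (\<Sum>e\<in>T'. w e) + \<mu>0 * (\<Sum>e\<in>T'. c e)" using m0 T'(1) by (auto simp: is_mst_value_def lin)
    moreover have "\<mu>0 * (\<Sum>e\<in>T'. c e) \<le> \<mu>0 * \<gamma>" using T'(2) assms(2) by (rule mult_left_mono)
    ultimately show "m0 - \<mu>0 * \<gamma> \<le> (\<Sum>e\<in>T'. w e)" by linarith
  qed
qed

lemma min_weight_scale:
  assumes "0 < a" "0 < d"
  shows "min_weight n (\<lambda>e. w e / a) (\<lambda>e. c e / d) \<gamma> = ereal x \<Longrightarrow> min_weight n w c (\<gamma> * d) = ereal (a * x)"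
proof -
  assume x: "min_weight n (\<lambda>e. w e / a) (\<lambda>e. c e / d) \<gamma> = ereal x"
  have set_eq: "{T \<in> spanning_trees n. (\<Sum>e\<in>T. c e) \<le> \<gamma> * d} = {T \<in> spanning_trees n. (\<Sum>e\<in>T. c e / d) \<le> \<gamma>}"
    using assms by (simp add: pos_divide_le_eq flip: sum_divide_distrib)
  let ?S = "{T \<in> spanning_trees n. (\<Sum>e\<in>T. c e / d) \<le> \<gamma>}"
  have le: "ereal x \<le> ereal ((\<Sum>e\<in>T. w e) / a)" if "T \<in> ?S" for T
    unfolding x[symmetric] min_weight_def sum_divide_distrib using that by (rule INF_lower)
  have "ereal (a * x) \<le> min_weight n w c (\<gamma> * d)"
    unfolding min_weight_def set_eq
  proof (rule INF_greatest)
    fix T assume "T \<in> ?S"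
    hence "x \<le> (\<Sum>e\<in>T. w e) / a" using le by simp
    thus "ereal (a * x) \<le> ereal (\<Sum>e\<in>T. w e)" using assms by (simp add: pos_le_divide_eq mult.commute)
  qed
  moreover have "min_weight n w c (\<gamma> * d) \<le> ereal (a * x)"
  proof (rule ereal_le_epsilon2)
    fix e :: real assume e: "0 < e"
    have "(INF T\<in>?S. ereal (\<Sum>e\<in>T. w e / a)) < ereal (x + e / a)"
      using x e assms by (simp add: min_weight_def)
    then obtain T where T: "T \<in> ?S" "ereal (\<Sum>e\<in>T. w e / a) < ereal (x + e / a)"
      unfolding INF_less_iff by blast
    have "(\<Sum>e\<in>T. w e) / a < x + e / a" using T(2) by (simp flip: sum_divide_distrib)
    hence "(\<Sum>e\<in>T. w e) < a * x + e" using assms by (simp add: field_simps)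
    hence "ereal (\<Sum>e\<in>T. w e) \<le> ereal (a * x) + ereal e" by simp
    moreover have "min_weight n w c (\<gamma> * d) \<le> ereal (\<Sum>e\<in>T. w e)"
      unfolding min_weight_def set_eq by (rule INF_lower[OF T(1)])
    ultimately show "min_weight n w c (\<gamma> * d) \<le> ereal (a * x) + ereal e" by (rule order_trans[rotated])
  qed
  ultimately show ?thesis by (rule antisym[rotated])
qed

lemma filterlim_at_right_affine:
  fixes b k :: real
  assumes "0 < k"
  shows "filterlim (\<lambda>x. b + k * x) (at_right b) (at_right 0)"
proof -
  have "((\<lambda>x. b + k * x) \<longlongrightarrow> b + k * 0) (at_right 0)" by (intro tendsto_intros)
  moreover have "\<forall>\<^sub>F x in at_right 0. b + k * x \<in> {b<..} \<and> b + k * x \<noteq> b"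
    using eventually_at_right_less[of 0] by eventually_elim (use assms in simp)
  ultimately show ?thesis by (simp add: filterlim_at)
qed

text \<open>The conditions on \<open>\<gamma>\<close> say that \<open>\<rho>\<close> maximises
  \<phi>(\<beta>) - \<beta> \<gamma>, either as a stationary point or at the boundary 0. The
  feasible tree is optimal for \<open>\<rho> + 2 * \<delta>\<close>: by strict decrease of the slope
  its cost stays below \<open>\<gamma>\<close> by a constant, and the loss of weight vanishes with
  \<delta>.\<close>

theorem lagrange_limit:
  fixes M :: "nat \<Rightarrow> 'a measure" and W C :: "nat \<Rightarrow> nat set \<Rightarrow> 'a \<Rightarrow> real"
  assumes M: "\<And>n. prob_space (M n)"
    and conv: "\<And>\<beta> \<epsilon>. \<rho> \<le> \<beta> \<Longrightarrow> \<beta> \<le> \<rho> + 1 \<Longrightarrow> 0 < \<epsilon> \<Longrightarrow>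
       aas M (\<lambda>n \<omega>. \<exists>m. is_mst_value n (\<lambda>e. W n e \<omega> / a n + \<beta> * (C n e \<omega> / d n)) m \<and> \<bar>m - \<phi> \<beta>\<bar> < \<epsilon>)"
    and \<rho>: "0 \<le> \<rho>"
    and deriv: "\<And>\<beta>. \<rho> < \<beta> \<Longrightarrow> (\<phi> has_real_derivative \<phi>' \<beta>) (at \<beta>)"
    and strict: "\<And>x y. \<rho> \<le> x \<Longrightarrow> x < y \<Longrightarrow> \<phi>' y < \<phi>' x"
    and cont: "(\<phi> \<longlongrightarrow> \<phi> \<rho>) (at_right \<rho>)" "(\<phi>' \<longlongrightarrow> \<phi>' \<rho>) (at_right \<rho>)"
    and \<gamma>: "\<phi>' \<rho> \<le> \<gamma>" "\<rho> = 0 \<or> \<phi>' \<rho> = \<gamma>"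
    and pos: "\<forall>\<^sub>F n in sequentially. 0 < a n \<and> 0 < d n"
    and \<epsilon>: "0 < \<epsilon>"
  shows "aas M (\<lambda>n \<omega>. \<exists>x. min_weight n (\<lambda>e. W n e \<omega>) (\<lambda>e. C n e \<omega>) (\<gamma> * d n) = ereal x \<and>
            \<bar>x / a n - (\<phi> \<rho> - \<rho> * \<gamma>)\<bar> < \<epsilon>)"
proof -
  let ?L = "\<phi> \<rho> - \<rho> * \<gamma>"
  \<comment> \<open>The upper bound that the multiplier \<open>\<rho> + 2 * \<delta>\<close> will
    give, with the slope at \<open>\<rho> + 3 * \<delta>\<close> as a lower estimate for the cost of
    its tree.\<close>
  have lim0: "((\<lambda>\<delta>. \<phi> (\<rho> + 2 * \<delta>) - (\<rho> + 2 * \<delta>) * \<phi>' (\<rho> + 3 * \<delta>)) \<longlongrightarrow> \<phi> \<rho> - (\<rho> + 2 * 0) * \<phi>' \<rho>) (at_right 0)"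
    by (intro tendsto_diff tendsto_mult tendsto_add tendsto_const tendsto_ident_at
        filterlim_compose[OF cont(1) filterlim_at_right_affine] filterlim_compose[OF cont(2) filterlim_at_right_affine]) auto
  \<comment> \<open>At the boundary \<open>\<phi>' \<rho>\<close> may be smaller than
    \<open>\<gamma>\<close>, but there it is multiplied by 0.\<close>
  have L: "\<phi> \<rho> - (\<rho> + 2 * 0) * \<phi>' \<rho> = ?L" using \<gamma>(2) by auto
  have lim: "((\<lambda>\<delta>. \<phi> (\<rho> + 2 * \<delta>) - (\<rho> + 2 * \<delta>) * \<phi>' (\<rho> + 3 * \<delta>)) \<longlongrightarrow> ?L) (at_right 0)"
    by (rule lim0[unfolded L])
  have ev1: "\<forall>\<^sub>F \<delta> in at_right 0. \<phi> (\<rho> + 2 * \<delta>) - (\<rho> + 2 * \<delta>) * \<phi>' (\<rho> + 3 * \<delta>) < ?L + \<epsilon> / 2"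
    by (rule order_tendstoD(2)[OF lim]) (use \<epsilon> in simp)
  \<comment> \<open>This keeps \<open>\<rho> + 3 * \<delta>\<close> inside the interval on which
    \<open>conv\<close> is assumed.\<close>
  have ev2: "\<forall>\<^sub>F \<delta> in at_right 0. \<delta> \<in> {0<..<1 / 3 :: real}" by (rule eventually_at_right_real) simp
  from eventually_happens'[OF trivial_limit_at_right_real eventually_conj[OF ev1 ev2]] obtain \<delta>
    where \<delta>1: "\<phi> (\<rho> + 2 * \<delta>) - (\<rho> + 2 * \<delta>) * \<phi>' (\<rho> + 3 * \<delta>) < ?L + \<epsilon> / 2"
      and \<delta>: "0 < \<delta>" "3 * \<delta> < 1"
    by auto
  \<comment> \<open>The points \<open>\<mu> - \<delta>\<close>, \<open>\<mu>\<close>,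
    \<open>\<mu> + \<delta>\<close> all lie strictly to the right of \<open>\<rho>\<close>, where
    \<open>\<phi>\<close> is differentiable, so the mean value theorem applies between them.\<close>
  define \<mu> where "\<mu> = \<rho> + 2 * \<delta>"
  have \<mu>: "\<mu> - \<delta> = \<rho> + \<delta>" "\<mu> + \<delta> = \<rho> + 3 * \<delta>" "0 < \<mu>" using \<rho> \<delta> by (auto simp: \<mu>_def)
  obtain \<xi>1 where \<xi>1: "\<rho> + \<delta> < \<xi>1" "\<xi>1 < \<mu>" "\<phi> \<mu> - \<phi> (\<mu> - \<delta>) = \<delta> * \<phi>' \<xi>1"
    using MVT2[of "\<mu> - \<delta>" \<mu> \<phi> \<phi>'] deriv \<delta> \<mu> by auto
  obtain \<xi>2 where \<xi>2: "\<mu> < \<xi>2" "\<xi>2 < \<mu> + \<delta>" "\<phi> (\<mu> + \<delta>) - \<phi> \<mu> = \<delta> * \<phi>' \<xi>2"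
    using MVT2[of \<mu> "\<mu> + \<delta>" \<phi> \<phi>'] deriv \<delta> \<mu> by (auto simp: \<mu>_def)
  have sl1: "\<phi>' \<xi>1 < \<gamma>" using strict[of \<rho> \<xi>1] \<xi>1 \<delta> \<gamma>(1) by linarith
  have sl2: "\<phi>' (\<mu> + \<delta>) < \<phi>' \<xi>2" using strict[of \<xi>2 "\<mu> + \<delta>"] \<xi>2 \<delta> by (simp add: \<mu>_def)
  \<comment> \<open>The first term makes random errors smaller than the gap between the slope at
    \<open>\<xi>1\<close> and \<open>\<gamma>\<close>, which gives feasibility. The second bounds by
    \<epsilon>/2 the error \<open>\<eta>\<close> of \<open>m2\<close> plus the error
    \<open>2 * \<mu> * \<eta> / \<delta>\<close> of the cost term.\<close>
  define \<eta> where "\<eta> = min (\<delta> * (\<gamma> - \<phi>' \<xi>1) / 2) (\<epsilon> / 2 / (1 + 2 * \<mu> / \<delta>))"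
  have den: "1 \<le> 1 + 2 * \<mu> / \<delta>" using \<mu> \<delta> by simp
  have \<eta>: "0 < \<eta>" using sl1 \<delta> \<epsilon> den by (auto simp: \<eta>_def)
  have \<eta>1: "2 * \<eta> \<le> \<delta> * (\<gamma> - \<phi>' \<xi>1)" by (simp add: \<eta>_def)
  have "\<eta> \<le> \<epsilon> / 2 / (1 + 2 * \<mu> / \<delta>)" by (simp add: \<eta>_def)
  moreover have "0 < 1 + 2 * \<mu> / \<delta>" using den by linarith
  ultimately have \<eta>2: "\<eta> * (1 + 2 * \<mu> / \<delta>) \<le> \<epsilon> / 2" by (simp only: pos_le_divide_eq)
  have \<eta>3: "\<eta> \<le> \<epsilon> / 2" using \<eta>2 mult_left_mono[OF den, of \<eta>] \<eta> by linarith
  let ?P = "\<lambda>\<beta> n \<omega>. \<exists>m. is_mst_value n (\<lambda>e. W n e \<omega> / a n + \<beta> * (C n e \<omega> / d n)) m \<and> \<bar>m - \<phi> \<beta>\<bar> < \<eta>"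
  have P: "aas M (?P \<beta>)" if "\<rho> \<le> \<beta>" "\<beta> \<le> \<rho> + 1" for \<beta>
    using conv[OF that \<eta>] .
  have "aas M (?P \<rho>)" "aas M (?P (\<mu> - \<delta>))" "aas M (?P \<mu>)" "aas M (?P (\<mu> + \<delta>))"
    by (rule P; use \<delta> in \<open>simp add: \<mu>_def\<close>)+
  hence "aas M (\<lambda>n \<omega>. ?P \<rho> n \<omega> \<and> ?P (\<mu> - \<delta>) n \<omega> \<and> ?P \<mu> n \<omega> \<and> ?P (\<mu> + \<delta>) n \<omega>)"
    by (intro aas_conj[OF M])
  thus ?thesis
  proof (rule aas_mono[OF M])
    show "\<forall>\<^sub>F n in sequentially. \<forall>\<omega>\<in>space (M n). ?P \<rho> n \<omega> \<and> ?P (\<mu> - \<delta>) n \<omega> \<and> ?P \<mu> n \<omega> \<and> ?P (\<mu> + \<delta>) n \<omega> \<longrightarrow>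
      (\<exists>x. min_weight n (\<lambda>e. W n e \<omega>) (\<lambda>e. C n e \<omega>) (\<gamma> * d n) = ereal x \<and> \<bar>x / a n - ?L\<bar> < \<epsilon>)"
      using pos
    proof eventually_elim
      case (elim n)
      show ?case
      proof (intro ballI impI)
        fix \<omega>
        let ?w = "\<lambda>e. W n e \<omega> / a n" and ?c = "\<lambda>e. C n e \<omega> / d n"
        assume "?P \<rho> n \<omega> \<and> ?P (\<mu> - \<delta>) n \<omega> \<and> ?P \<mu> n \<omega> \<and> ?P (\<mu> + \<delta>) n \<omega>"
        then obtain m0 m1 m2 m3 where
          m: "is_mst_value n (\<lambda>e. ?w e + \<rho> * ?c e) m0" "is_mst_value n (\<lambda>e. ?w e + (\<mu> - \<delta>) * ?c e) m1"
            "is_mst_value n (\<lambda>e. ?w e + \<mu> * ?c e) m2" "is_mst_value n (\<lambda>e. ?w e + (\<mu> + \<delta>) * ?c e) m3"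
          and m': "\<bar>m0 - \<phi> \<rho>\<bar> < \<eta>" "\<bar>m1 - \<phi> (\<mu> - \<delta>)\<bar> < \<eta>" "\<bar>m2 - \<phi> \<mu>\<bar> < \<eta>" "\<bar>m3 - \<phi> (\<mu> + \<delta>)\<bar> < \<eta>"
          by blast
        have "m2 - m1 \<le> \<delta> * \<phi>' \<xi>1 + 2 * \<eta>" using m' \<xi>1(3) by linarith
        also have "\<dots> \<le> \<gamma> * \<delta>" using \<eta>1 by (simp add: algebra_simps)
        finally have feas: "(m2 - m1) / \<delta> \<le> \<gamma>" using \<delta> by (simp add: pos_divide_le_eq)
        obtain x where x: "min_weight n ?w ?c \<gamma> = ereal x" "m0 - \<rho> * \<gamma> \<le> x" "x \<le> m2 - \<mu> * ((m3 - m2) / \<delta>)"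
          using lagrange_sandwich[OF m(1) \<rho> m(2,3,4) \<delta>(1) _ feas] \<mu> by auto
        have "\<phi>' (\<mu> + \<delta>) - 2 * \<eta> / \<delta> \<le> (m3 - m2) / \<delta>"
        proof -
          have "\<delta> * \<phi>' (\<mu> + \<delta>) \<le> \<delta> * \<phi>' \<xi>2" using sl2 \<delta> by simp
          hence "\<delta> * \<phi>' (\<mu> + \<delta>) - 2 * \<eta> \<le> m3 - m2" using m' \<xi>2(3) by linarith
          hence "(\<delta> * \<phi>' (\<mu> + \<delta>) - 2 * \<eta>) / \<delta> \<le> (m3 - m2) / \<delta>"
            using \<delta> by (intro divide_right_mono) auto
          thus ?thesis using \<delta> by (simp add: diff_divide_distrib)
        qed
        hence "\<mu> * (\<phi>' (\<mu> + \<delta>) - 2 * \<eta> / \<delta>) \<le> \<mu> * ((m3 - m2) / \<delta>)"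
          by (rule mult_left_mono) (use \<mu>(3) in simp)
        hence "x \<le> m2 - \<mu> * (\<phi>' (\<mu> + \<delta>) - 2 * \<eta> / \<delta>)" using x(3) by linarith
        also have "\<dots> < (\<phi> \<mu> + \<eta>) - \<mu> * (\<phi>' (\<mu> + \<delta>) - 2 * \<eta> / \<delta>)" using m' by linarith
        also have "\<dots> = (\<phi> \<mu> - \<mu> * \<phi>' (\<mu> + \<delta>)) + \<eta> * (1 + 2 * \<mu> / \<delta>)" by (simp add: algebra_simps)
        also have "\<dots> < (?L + \<epsilon> / 2) + \<epsilon> / 2" using \<delta>1 \<eta>2 unfolding \<mu>(2) unfolding \<mu>_def by linarith
        finally have "x < ?L + \<epsilon>" by simp
        moreover have "?L - \<epsilon> < x" using x(2) m'(1) \<eta>3 \<epsilon> by linarith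
        ultimately have "\<bar>x - ?L\<bar> < \<epsilon>" by linarith
        moreover have "min_weight n (\<lambda>e. W n e \<omega>) (\<lambda>e. C n e \<omega>) (\<gamma> * d n) = ereal (a n * x)"
          by (rule min_weight_scale[OF _ _ x(1)]) (use elim in auto)
        ultimately show "\<exists>x. min_weight n (\<lambda>e. W n e \<omega>) (\<lambda>e. C n e \<omega>) (\<gamma> * d n) = ereal x \<and> \<bar>x / a n - ?L\<bar> < \<epsilon>"
          using elim by (intro exI[of _ "a n * x"]) auto
      qed
    qed
  qed
qed

section \<open>From fixed to vanishing relative error\<close>

text \<open>\<open>K n\<close> is the largest k up to n + 1 for which accuracy 1/k is reached with
  probability at least 1 - 1/k. The value k = 1 always qualifies, and each fixed k qualifies
  eventually.\<close>

lemma diagonal_probability: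
  fixes P :: "nat \<Rightarrow> real \<Rightarrow> real"
  assumes "\<And>\<epsilon>. 0 < \<epsilon> \<Longrightarrow> (\<lambda>n. P n \<epsilon>) \<longlonglongrightarrow> 1" and P: "\<And>n \<epsilon>. 0 \<le> P n \<epsilon>" "\<And>n \<epsilon>. P n \<epsilon> \<le> 1"
  shows "\<exists>\<delta>. \<delta> \<longlonglongrightarrow> 0 \<and> (\<lambda>n. P n (\<delta> n)) \<longlonglongrightarrow> 1"
proof -
  define A where "A n = {k\<in>{1..Suc n}. 1 - 1 / real k \<le> P n (1 / real k)}" for n
  define K where "K n = Max (A n)" for n
  define \<delta> where "\<delta> n = 1 / real (K n)" for n
  have fin: "finite (A n)" for n by (simp add: A_def)
  have "1 \<in> A n" for n using P by (simp add: A_def)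
  hence K: "K n \<in> A n" for n unfolding K_def by (intro Max_in fin) auto
  have ge: "\<forall>\<^sub>F n in sequentially. k \<le> K n" if "1 \<le> k" for k
  proof -
    have "\<forall>\<^sub>F n in sequentially. 1 - 1 / real k < P n (1 / real k)"
      using that by (intro order_tendstoD(1)[OF assms(1)]) auto
    thus ?thesis using eventually_ge_at_top[of k]
    proof eventually_elim
      case (elim n)
      hence "k \<in> A n" using that by (simp add: A_def)
      thus ?case unfolding K_def by (rule Max_ge[OF fin])
    qed
  qed
  have "filterlim K at_top sequentially"
    unfolding filterlim_at_top
  proof
    fix k
    show "\<forall>\<^sub>F n in sequentially. k \<le> K n" using ge[of "max 1 k"] by (auto elim: eventually_mono)
  qed
  hence d0: "\<delta> \<longlonglongrightarrow> 0" unfolding \<delta>_def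
    by (rule filterlim_compose[OF lim_const_over_n])
  have "(\<lambda>n. 1 - \<delta> n) \<longlonglongrightarrow> 1 - 0" by (intro tendsto_intros d0)
  hence lim: "(\<lambda>n. 1 - \<delta> n) \<longlonglongrightarrow> 1" by simp
  have le: "1 - \<delta> n \<le> P n (\<delta> n)" for n using K[of n] by (simp add: A_def \<delta>_def)
  have "(\<lambda>n. P n (\<delta> n)) \<longlonglongrightarrow> 1"
    by (rule tendsto_sandwich[OF always_eventually always_eventually lim tendsto_const])
      (use le P in blast)+
  thus ?thesis using d0 by blast
qed

text \<open>\<open>whp_approx\<close> asks for one sequence of errors tending to 0, so a fixed
  relative error comes first and the diagonal choice afterwards.\<close>

lemma whp_approxI:
  fixes M :: "nat \<Rightarrow> 'a measure" and Y :: "nat \<Rightarrow> 'a \<Rightarrow> ereal"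
  assumes M: "\<And>n. prob_space (M n)"
    and Y: "\<And>n. Y n \<in> borel_measurable (M n)"
    and lim: "\<And>\<epsilon>. 0 < \<epsilon> \<Longrightarrow> aas M (\<lambda>n \<omega>. \<exists>x. Y n \<omega> = ereal x \<and> \<bar>x / a n - L\<bar> < \<epsilon>)"
    and pos: "\<forall>\<^sub>F n in sequentially. 0 < a n \<and> b n = a n * L" and L: "0 < L"
  shows "whp_approx M Y b"
proof -
  let ?Q = "\<lambda>\<epsilon> n \<omega>. \<exists>\<eta>. \<bar>\<eta>\<bar> \<le> \<epsilon> \<and> Y n \<omega> = ereal ((1 + \<eta>) * b n)"
  let ?P = "\<lambda>n \<epsilon>. measure (M n) {\<omega>\<in>space (M n). ?Q \<epsilon> n \<omega>}"
  have "(\<lambda>n. ?P n \<epsilon>) \<longlonglongrightarrow> 1" if \<epsilon>: "0 < \<epsilon>" for \<epsilon>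
  proof -
    have "aas M (?Q \<epsilon>)"
    proof (rule aas_mono[OF M lim])
      show "0 < \<epsilon> * L" using \<epsilon> L by simp
      show "\<forall>\<^sub>F n in sequentially. \<forall>\<omega>\<in>space (M n). (\<exists>x. Y n \<omega> = ereal x \<and> \<bar>x / a n - L\<bar> < \<epsilon> * L) \<longrightarrow> ?Q \<epsilon> n \<omega>"
        using pos
      proof eventually_elim
        case (elim n)
        show ?case
        proof (intro ballI impI)
          fix \<omega> assume "\<exists>x. Y n \<omega> = ereal x \<and> \<bar>x / a n - L\<bar> < \<epsilon> * L"
          then obtain x where x: "Y n \<omega> = ereal x" "\<bar>x / a n - L\<bar> < \<epsilon> * L" by blast
          define \<eta> where "\<eta> = (x / a n - L) / L"
          have "\<bar>\<eta>\<bar> \<le> \<epsilon>" using x(2) L by (simp add: \<eta>_def abs_divide divide_le_eq)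
          moreover have "(1 + \<eta>) * b n = x" using elim L by (simp add: \<eta>_def field_simps)
          ultimately show "?Q \<epsilon> n \<omega>" using x(1) by auto
        qed
      qed
    qed
    moreover have "\<forall>\<^sub>F n in sequentially. {\<omega>\<in>space (M n). ?Q \<epsilon> n \<omega>} \<in> sets (M n)"
      using pos
    proof eventually_elim
      case (elim n)
      have b: "0 < b n" using elim L by simp
      \<comment> \<open>Without the quantifier over \<eta> the event is the preimage of a bounded
        interval, hence measurable; the bounds also force a finite value.\<close>
      have "?Q \<epsilon> n \<omega> \<longleftrightarrow> ereal ((1 - \<epsilon>) * b n) \<le> Y n \<omega> \<and> Y n \<omega> \<le> ereal ((1 + \<epsilon>) * b n)" for \<omega>
      proof
        assume "?Q \<epsilon> n \<omega>"
        then obtain \<eta> where "\<bar>\<eta>\<bar> \<le> \<epsilon>" "Y n \<omega> = ereal ((1 + \<eta>) * b n)" by blast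
        thus "ereal ((1 - \<epsilon>) * b n) \<le> Y n \<omega> \<and> Y n \<omega> \<le> ereal ((1 + \<epsilon>) * b n)"
          using b by (auto simp: abs_le_iff)
      next
        assume *: "ereal ((1 - \<epsilon>) * b n) \<le> Y n \<omega> \<and> Y n \<omega> \<le> ereal ((1 + \<epsilon>) * b n)"
        then obtain x where x: "Y n \<omega> = ereal x" by (cases "Y n \<omega>") auto
        have "(1 - \<epsilon>) \<le> x / b n" "x / b n \<le> 1 + \<epsilon>" using * b unfolding x by (auto simp: field_simps)
        hence "\<bar>x / b n - 1\<bar> \<le> \<epsilon>" by linarith
        moreover have "Y n \<omega> = ereal ((1 + (x / b n - 1)) * b n)" using b x by simp
        ultimately show "?Q \<epsilon> n \<omega>" by blast
      qed
      moreover have "{\<omega>\<in>space (M n). ereal ((1 - \<epsilon>) * b n) \<le> Y n \<omega> \<and> Y n \<omega> \<le> ereal ((1 + \<epsilon>) * b n)} \<in> sets (M n)"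
        using Y[of n] by measurable
      ultimately show ?case by simp
    qed
    ultimately have "whp M (?Q \<epsilon>)" by (rule aas_imp_whp[OF M])
    thus ?thesis unfolding whp_def .
  qed
  hence "\<exists>\<delta>. \<delta> \<longlonglongrightarrow> 0 \<and> (\<lambda>n. ?P n (\<delta> n)) \<longlonglongrightarrow> 1"
    by (rule diagonal_probability) (auto intro: prob_space.prob_le_1[OF M])
  thus ?thesis unfolding whp_approx_def whp_def .
qed

lemma finite_spanning_trees: "finite (spanning_trees n)"
  by (rule finite_subset[of _ "Pow (complete_edges n)"]) (auto simp: spanning_trees_def)

text \<open>Infeasible trees receive the value \<infinity>, so that the infimum ranges over a set of
  trees that is not random.\<close>

lemma min_weight_measurable:
  assumes "\<And>e. e \<in> complete_edges n \<Longrightarrow> W e \<in> borel_measurable N" "\<And>e. e \<in> complete_edges n \<Longrightarrow> C e \<in> borel_measurable N"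
  shows "(\<lambda>\<omega>. min_weight n (\<lambda>e. W e \<omega>) (\<lambda>e. C e \<omega>) c0) \<in> borel_measurable N"
proof -
  have eq: "min_weight n (\<lambda>e. W e \<omega>) (\<lambda>e. C e \<omega>) c0 =
      (INF T\<in>spanning_trees n. if (\<Sum>e\<in>T. C e \<omega>) \<le> c0 then ereal (\<Sum>e\<in>T. W e \<omega>) else \<infinity>)" for \<omega>
    unfolding min_weight_def
  proof (rule antisym)
    show "(INF T\<in>{T \<in> spanning_trees n. (\<Sum>e\<in>T. C e \<omega>) \<le> c0}. ereal (\<Sum>e\<in>T. W e \<omega>)) \<le>
      (INF T\<in>spanning_trees n. if (\<Sum>e\<in>T. C e \<omega>) \<le> c0 then ereal (\<Sum>e\<in>T. W e \<omega>) else \<infinity>)"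
      by (rule INF_greatest) (auto intro: INF_lower2)
    show "(INF T\<in>spanning_trees n. if (\<Sum>e\<in>T. C e \<omega>) \<le> c0 then ereal (\<Sum>e\<in>T. W e \<omega>) else \<infinity>) \<le>
      (INF T\<in>{T \<in> spanning_trees n. (\<Sum>e\<in>T. C e \<omega>) \<le> c0}. ereal (\<Sum>e\<in>T. W e \<omega>))"
    proof (rule INF_greatest)
      fix T assume "T \<in> {T \<in> spanning_trees n. (\<Sum>e\<in>T. C e \<omega>) \<le> c0}"
      thus "(INF T\<in>spanning_trees n. if (\<Sum>e\<in>T. C e \<omega>) \<le> c0 then ereal (\<Sum>e\<in>T. W e \<omega>) else \<infinity>) \<le>
          ereal (\<Sum>e\<in>T. W e \<omega>)"
        by (intro INF_lower2[of T]) simp_all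
    qed
  qed
  have "(\<lambda>\<omega>. if (\<Sum>e\<in>T. C e \<omega>) \<le> c0 then ereal (\<Sum>e\<in>T. W e \<omega>) else \<infinity>) \<in> borel_measurable N"
    if T: "T \<in> spanning_trees n" for T
  proof -
    have sub: "T \<subseteq> complete_edges n" using T by (simp add: spanning_trees_def)
    have [measurable]: "(\<lambda>\<omega>. \<Sum>e\<in>T. C e \<omega>) \<in> borel_measurable N" "(\<lambda>\<omega>. \<Sum>e\<in>T. W e \<omega>) \<in> borel_measurable N"
      using assms sub by (auto intro!: borel_measurable_sum)
    show ?thesis by measurable
  qed
  thus ?thesis unfolding eq
    by (intro borel_measurable_INF countable_finite finite_spanning_trees)
qed

lemma ln_bound_eventually:
  fixes k c :: real
  shows "\<forall>\<^sub>F n in sequentially. k * ln (real n) + c \<le> real n"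
proof -
  have "(\<lambda>n. k * (ln (real n) / real n) + c / real n) \<longlonglongrightarrow> k * 0 + 0"
    by (intro tendsto_intros lim_ln_over_n lim_const_over_n)
  hence "\<forall>\<^sub>F n in sequentially. k * (ln (real n) / real n) + c / real n < 1"
    by (rule order_tendstoD(2)) simp
  thus ?thesis using eventually_gt_at_top[of 0]
    by eventually_elim (simp add: field_simps)
qed

section \<open>Minimum spanning trees for \<open>U + l V\<close> with independent uniform \<open>U\<close> and \<open>V\<close>\<close>

text \<open>Instantiated both with weight and cost and with the roles exchanged; the second instance
  serves the regime of bounded total cost.\<close>

locale uniform_lengths =
  fixes M :: "nat \<Rightarrow> 'a measure" and U V :: "nat \<Rightarrow> nat set \<Rightarrow> 'a \<Rightarrow> real"
  assumes M: "\<And>n. prob_space (M n)"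
    and indep_sum: "\<And>n l. prob_space.indep_vars (M n) (\<lambda>_. borel) (\<lambda>e \<omega>. U n e \<omega> + l * V n e \<omega>) (complete_edges n)"
    and indep_pair: "\<And>n e. e \<in> complete_edges n \<Longrightarrow> prob_space.indep_var (M n) borel (U n e) borel (V n e)"
    and uniform: "\<And>n e. e \<in> complete_edges n \<Longrightarrow> distr (M n) borel (U n e) = uniform_measure lborel {0..1}"
      "\<And>n e. e \<in> complete_edges n \<Longrightarrow> distr (M n) borel (V n e) = uniform_measure lborel {0..1}"
begin

lemma AE_nonneg:
  assumes "e \<in> complete_edges n" "0 \<le> l"
  shows "AE \<omega> in M n. 0 \<le> U n e \<omega> + l * V n e \<omega>"
proof -
  interpret prob_space "M n" by (rule M)
  have "AE \<omega> in M n. 0 \<le> U n e \<omega>" "AE \<omega> in M n. 0 \<le> V n e \<omega>"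
    using indep_pair[OF assms(1)] uniform[OF assms(1)]
    by (auto intro!: AE_uniform_nonneg dest: indep_var_rv1 indep_var_rv2)
  thus ?thesis by eventually_elim (use assms in simp)
qed

lemma prob_edge_le:
  assumes "e \<in> complete_edges n" "0 \<le> l" "0 \<le> t" "t \<le> 1" "0 \<le> c" "c \<le> 1" "l * c \<le> t" "c = 1 \<or> l * c = t"
  shows "measure (M n) {\<omega>\<in>space (M n). U n e \<omega> + l * V n e \<omega> \<le> t} = t * c - l * c\<^sup>2 / 2"
proof -
  interpret prob_space "M n" by (rule M)
  show ?thesis
    by (rule prob_sum_uniform[OF indep_pair[OF assms(1)] uniform[OF assms(1)]]) (use assms in auto)
qed

lemma mst_limit_f:
  assumes \<beta>: "0 \<le> \<beta>" and \<epsilon>: "0 < \<epsilon>"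
  shows "aas M (\<lambda>n \<omega>. \<exists>m. is_mst_value n (\<lambda>e. U n e \<omega> + 2 * \<beta> / real n * V n e \<omega>) m \<and> \<bar>m - f \<beta>\<bar> < \<epsilon>)"
proof -
  \<comment> \<open>A cutoff on the linear branch of the rate, with the value
    \<open>12 * ln (real n) + \<beta>\<close> there; it is of logarithmic size, so it stays below
    \<open>real n\<close> eventually.\<close>
  let ?S = "\<lambda>n. 12 * ln (real n) + 2 * \<beta>"
  have "aas M (\<lambda>n \<omega>. \<exists>m. is_mst_value n (\<lambda>e. U n e \<omega> + 2 * \<beta> / real n * V n e \<omega>) m \<and>
      \<bar>m / (real n * (1 / real n)) - (LBINT s:{0..}. kfun (edge_rate \<beta> s))\<bar> < \<epsilon>)"
  proof (rule mst_limit[where S = ?S])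
    show "set_integrable lborel {0..} (\<lambda>s. exp (- edge_rate \<beta> s / 6))"
    proof (rule set_integrable_le_exp[of _ _ 0 "1/6" "exp (\<beta> / 6)"])
      fix s :: real
      have "exp (- edge_rate \<beta> s / 6) \<le> exp (\<beta> / 6 + - (1 / 6) * s)" using edge_rate_ge[OF \<beta>, of s] by simp
      thus "\<bar>exp (- edge_rate \<beta> s / 6)\<bar> \<le> exp (\<beta> / 6) * exp (- (1 / 6) * s)" by (simp only: exp_add abs_exp_cancel)
    qed auto
    show "filterlim ?S at_top sequentially"
      by (subst add.commute, intro filterlim_tendsto_add_at_top[OF tendsto_const] filterlim_tendsto_pos_mult_at_top[OF tendsto_const]
          filterlim_compose[OF ln_at_top filterlim_real_sequentially]) simp
    show "\<forall>\<^sub>F n in sequentially. 0 < 1 / real n \<and> 12 * ln (real n) \<le> edge_rate \<beta> (?S n) \<and>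
       (\<forall>s. 0 \<le> s \<longrightarrow> s \<le> ?S n \<longrightarrow> edge_rate \<beta> s \<le> real n \<and>
          (\<forall>e\<in>complete_edges n. measure (M n) {\<omega>\<in>space (M n). U n e \<omega> + 2 * \<beta> / real n * V n e \<omega> \<le> 1 / real n * s} =
             edge_rate \<beta> s / real n))"
      using ln_bound_eventually[of 12 "2 * \<beta>"] eventually_gt_at_top[of 0]
    proof eventually_elim
      case (elim n)
      have ln0: "0 \<le> ln (real n)" using elim(2) by simp
      have "edge_rate \<beta> s \<le> real n \<and> measure (M n) {\<omega>\<in>space (M n). U n e \<omega> + 2 * \<beta> / real n * V n e \<omega> \<le> 1 / real n * s} =
             edge_rate \<beta> s / real n" if s: "0 \<le> s" "s \<le> ?S n" and e: "e \<in> complete_edges n" for s e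
      proof (cases "s < 2 * \<beta>")
        case True
        hence b: "0 < \<beta>" using s by simp
        have er: "edge_rate \<beta> s = s\<^sup>2 / (4 * \<beta>)" using True by (simp add: edge_rate_def)
        have "s * s \<le> (4 * \<beta>) * s" using True s by (intro mult_right_mono) auto
        hence "edge_rate \<beta> s \<le> s" using b unfolding er by (simp add: power2_eq_square divide_le_eq mult_ac)
        \<comment> \<open>The triangle case: V can reach only \<open>s / (2 * \<beta>)\<close>,
          which is less than 1. On the other branch V takes its full range and
          \<open>c = 1\<close>.\<close>
        moreover have "measure (M n) {\<omega>\<in>space (M n). U n e \<omega> + 2 * \<beta> / real n * V n e \<omega> \<le> s / real n} =
            s / real n * (s / (2 * \<beta>)) - 2 * \<beta> / real n * (s / (2 * \<beta>))\<^sup>2 / 2"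
          by (rule prob_edge_le[OF e]) (use True b s elim in \<open>auto simp: divide_le_eq\<close>)
        moreover have "s / real n * (s / (2 * \<beta>)) - 2 * \<beta> / real n * (s / (2 * \<beta>))\<^sup>2 / 2 = edge_rate \<beta> s / real n"
          using b elim(2) unfolding er by (simp add: field_simps power2_eq_square)
        ultimately show ?thesis using s elim by simp
      next
        case False
        have er: "edge_rate \<beta> s = s - \<beta>" using False by (simp add: edge_rate_def)
        have "measure (M n) {\<omega>\<in>space (M n). U n e \<omega> + 2 * \<beta> / real n * V n e \<omega> \<le> s / real n} =
            s / real n * 1 - 2 * \<beta> / real n * 1\<^sup>2 / 2"
          by (rule prob_edge_le[OF e]) (use False \<beta> s elim in \<open>auto simp: divide_le_eq divide_right_mono\<close>)
        thus ?thesis using s elim \<beta> by (simp add: er diff_divide_distrib)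
      qed
      moreover have "edge_rate \<beta> s \<le> real n" if s: "0 \<le> s" "s \<le> ?S n" for s
      proof (cases "s < 2 * \<beta>")
        case True
        hence b: "0 < \<beta>" using s by simp
        have "s * s \<le> (4 * \<beta>) * s" using True s by (intro mult_right_mono) auto
        hence "edge_rate \<beta> s \<le> s" using b True by (simp add: edge_rate_def power2_eq_square divide_le_eq mult_ac)
        thus ?thesis using s elim by simp
      qed (use s elim \<beta> in \<open>simp add: edge_rate_def\<close>)
      moreover have "12 * ln (real n) \<le> edge_rate \<beta> (?S n)" using ln0 \<beta> by (simp add: edge_rate_def)
      ultimately show ?case using elim(2) by auto
    qed
    show "prob_space.indep_vars (M n) (\<lambda>_. borel) (\<lambda>e \<omega>. U n e \<omega> + 2 * \<beta> / real n * V n e \<omega>) (complete_edges n)" for n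
      by (rule indep_sum)
    show "AE \<omega> in M n. 0 \<le> U n e \<omega> + 2 * \<beta> / real n * V n e \<omega>" if "e \<in> complete_edges n" for n e
      by (rule AE_nonneg[OF that]) (use \<beta> in simp)
  qed (use M \<beta> \<epsilon> edge_rate_nonneg in auto)
  thus ?thesis
  proof (rule aas_mono[OF M])
    show "\<forall>\<^sub>F n in sequentially. \<forall>\<omega>\<in>space (M n).
       (\<exists>m. is_mst_value n (\<lambda>e. U n e \<omega> + 2 * \<beta> / real n * V n e \<omega>) m \<and>
          \<bar>m / (real n * (1 / real n)) - (LBINT s:{0..}. kfun (edge_rate \<beta> s))\<bar> < \<epsilon>) \<longrightarrow>
       (\<exists>m. is_mst_value n (\<lambda>e. U n e \<omega> + 2 * \<beta> / real n * V n e \<omega>) m \<and> \<bar>m - f \<beta>\<bar> < \<epsilon>)"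
      using eventually_gt_at_top[of 0]
    proof eventually_elim
      case (elim n)
      have "real n * (1 / real n) = 1" using elim by simp
      thus ?case unfolding edge_rate_integral[OF \<beta>] by simp
    qed
  qed
qed

text \<open>The cutoff has s^2 = 24 ln n, hence rate 12 ln n. The two bounds say that its level t =
  sqrt (l/n) s is at most \<open>l n\<close> and at most 1, so neither V nor U reaches its upper end
  and only the triangle of area t^2 / (2 l) occurs.\<close>

lemma mst_limit_c1:
  assumes l: "\<And>n. 0 \<le> l n"
    and bounds: "\<forall>\<^sub>F n in sequentially. 24 * ln (real n) \<le> l n * real n \<and> l n * (24 * ln (real n)) \<le> real n"
    and \<epsilon>: "0 < \<epsilon>"
  shows "aas M (\<lambda>n \<omega>. \<exists>m. is_mst_value n (\<lambda>e. U n e \<omega> + l n * V n e \<omega>) m \<and> \<bar>m / (real n * sqrt (l n / real n)) - c1\<bar> < \<epsilon>)"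
  unfolding c1_eq
proof (rule mst_limit[where S = "\<lambda>n. sqrt (24 * ln (real n))"])
  show "set_integrable lborel {0..} (\<lambda>s::real. exp (- (s\<^sup>2 / 2) / 6))"
  proof (rule set_integrable_le_exp[of _ _ 0 1 "exp 3"])
    fix s :: real
    have "- (s\<^sup>2 / 2) / 6 \<le> 3 + - 1 * s"
      using zero_le_power2[of "s - 6"] by (simp add: power2_eq_square algebra_simps)
    hence "exp (- (s\<^sup>2 / 2) / 6) \<le> exp (3 + - 1 * s)" by simp
    thus "\<bar>exp (- (s\<^sup>2 / 2) / 6)\<bar> \<le> exp 3 * exp (- 1 * s)" by (simp only: exp_add abs_exp_cancel)
  qed auto
  show "filterlim (\<lambda>n. sqrt (24 * ln (real n))) at_top sequentially"
    by (intro filterlim_compose[OF sqrt_at_top] filterlim_tendsto_pos_mult_at_top[OF tendsto_const]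
          filterlim_compose[OF ln_at_top filterlim_real_sequentially]) simp
  show "\<forall>\<^sub>F n in sequentially. 0 < sqrt (l n / real n) \<and> 12 * ln (real n) \<le> (sqrt (24 * ln (real n)))\<^sup>2 / 2 \<and>
       (\<forall>s. 0 \<le> s \<longrightarrow> s \<le> sqrt (24 * ln (real n)) \<longrightarrow> s\<^sup>2 / 2 \<le> real n \<and>
          (\<forall>e\<in>complete_edges n. measure (M n) {\<omega>\<in>space (M n). U n e \<omega> + l n * V n e \<omega> \<le> sqrt (l n / real n) * s} =
             s\<^sup>2 / 2 / real n))"
    using bounds ln_bound_eventually[of 12 0] eventually_gt_at_top[of 1]
  proof eventually_elim
    case (elim n)
    have ln0: "0 < ln (real n)" using elim by simp
    have n0: "0 < real n" using elim by simp
    have "0 < l n * real n" using elim(1) ln0 by linarith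
    hence l0: "0 < l n" using n0 by (simp add: zero_less_mult_iff)
    have "s\<^sup>2 / 2 \<le> real n \<and> (\<forall>e\<in>complete_edges n.
        measure (M n) {\<omega>\<in>space (M n). U n e \<omega> + l n * V n e \<omega> \<le> sqrt (l n / real n) * s} = s\<^sup>2 / 2 / real n)"
      if s: "0 \<le> s" "s \<le> sqrt (24 * ln (real n))" for s
    proof -
      have s2: "s\<^sup>2 \<le> 24 * ln (real n)"
        using power_mono[OF s(2) s(1), of 2] ln0 by simp
      define t where "t = sqrt (l n / real n) * s"
      have t0: "0 \<le> t" using s l0 n0 by (simp add: t_def)
      have t2: "t\<^sup>2 = l n * s\<^sup>2 / real n" using l0 n0 by (simp add: t_def power_mult_distrib)
      have "l n * s\<^sup>2 \<le> l n * (24 * ln (real n))" using s2 l0 by (intro mult_left_mono) auto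
      moreover have "l n * (24 * ln (real n)) \<le> l n * (l n * real n)"
        using elim(1) l0 by (intro mult_left_mono) auto
      ultimately have "l n * s\<^sup>2 \<le> real n" "l n * s\<^sup>2 \<le> l n * (l n * real n)"
        using elim(1) by linarith+
      hence "t\<^sup>2 \<le> 1\<^sup>2" "t\<^sup>2 \<le> (l n)\<^sup>2"
        using n0 unfolding t2 by (simp_all only: pos_divide_le_eq) (simp_all add: power2_eq_square[of "l n"] mult_ac)
      hence t1: "t \<le> 1" "t \<le> l n" using l0 power2_le_imp_le[of t 1] power2_le_imp_le[of t "l n"] by auto
      have "measure (M n) {\<omega>\<in>space (M n). U n e \<omega> + l n * V n e \<omega> \<le> t} = s\<^sup>2 / 2 / real n"
        if e: "e \<in> complete_edges n" for e
      proof -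
        have "measure (M n) {\<omega>\<in>space (M n). U n e \<omega> + l n * V n e \<omega> \<le> t} = t * (t / l n) - l n * (t / l n)\<^sup>2 / 2"
          by (rule prob_edge_le[OF e]) (use t0 t1 l0 in auto)
        also have "\<dots> = t\<^sup>2 / (2 * l n)" using l0 by (simp add: field_simps power2_eq_square)
        also have "\<dots> = s\<^sup>2 / 2 / real n" using l0 by (simp add: t2)
        finally show ?thesis .
      qed
      moreover have "s\<^sup>2 / 2 \<le> real n" using s2 elim(2) by linarith
      ultimately show ?thesis by (simp add: t_def)
    qed
    thus ?case using l0 n0 ln0 by simp
  qed
qed (use M indep_sum AE_nonneg l \<epsilon> in auto)

end

lemma is_mst_value_scale:
  assumes "0 < g" "is_mst_value n X m"
  shows "is_mst_value n (\<lambda>e. g * X e) (g * m)"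
  using assms unfolding is_mst_value_def by (auto simp: sum_distrib_left[symmetric])

section \<open>The theorem\<close>

lemma two_sqrt_deriv:
  assumes "0 < x"
  shows "((\<lambda>x. 2 * sqrt x) has_real_derivative 1 / sqrt x) (at x)"
  using assms by (auto intro!: derivative_eq_intros simp: field_simps)

text \<open>Passing to the perspective of \<open>f\<close> turns slopes into tangent intercepts,
  which is why \<open>hfun\<close> determines the multiplier when the roles are exchanged.\<close>

lemma perspective_deriv:
  assumes "0 < g"
  shows "((\<lambda>g. g * f (1 / g)) has_real_derivative hfun (1 / g)) (at g)"
proof -
  have "at (1 / g) within {0..} = at (1 / g)"
    using assms by (intro at_within_interior) (simp add: interior_Ici[of "-1"])
  hence d: "(f has_real_derivative gfun (1 / g)) (at (1 / g))"
    using f_has_deriv[of "1 / g"] assms by simp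
  have "((\<lambda>g. 1 / g) has_real_derivative - (1 / g\<^sup>2)) (at g)"
    using assms by (auto intro!: derivative_eq_intros simp: power2_eq_square)
  from DERIV_chain2[OF d this]
  have "((\<lambda>g. f (1 / g)) has_real_derivative gfun (1 / g) * - (1 / g\<^sup>2)) (at g)" .
  from DERIV_mult[OF DERIV_ident this]
  show ?thesis using assms by (simp add: hfun_def power2_eq_square field_simps)
qed

lemma tendsto_at_right_Ici:
  fixes h :: "real \<Rightarrow> real"
  assumes "continuous_on {0..} h" "0 \<le> x"
  shows "(h \<longlongrightarrow> h x) (at_right x)"
proof (rule tendsto_within_subset)
  show "(h \<longlongrightarrow> h x) (at x within {0..})" using assms by (simp add: continuous_on_def)
qed (use assms in auto)

theorem theorem1:
  fixes M :: "nat \<Rightarrow> 'a measure"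
    and W C :: "nat \<Rightarrow> nat set \<Rightarrow> 'a \<Rightarrow> real"
    and Wstar :: "(nat \<Rightarrow> real) \<Rightarrow> nat \<Rightarrow> 'a \<Rightarrow> ereal"
  defines "Wstar \<equiv> \<lambda>c0 n \<omega>. min_weight n (\<lambda>e. W n e \<omega>) (\<lambda>e. C n e \<omega>) (c0 n)"
  assumes "\<And>n. prob_space (M n)"
    and "\<And>n. prob_space.indep_vars (M n) (\<lambda>_. borel) (case_sum (W n) (C n))
               (complete_edges n <+> complete_edges n)"
    and "\<And>n e. e \<in> complete_edges n \<Longrightarrow>
               distr (M n) borel (W n e) = uniform_measure lborel {0..1}"
    and "\<And>n e. e \<in> complete_edges n \<Longrightarrow>
               distr (M n) borel (C n e) = uniform_measure lborel {0..1}"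
  shows
    "(\<forall>c0. (\<forall>\<^sub>F n in sequentially.
              c0 n \<in> {c1 * sqrt (500 * ln (real n)) .. c1 * real n / sqrt (8000 * ln (real n))})
        \<longrightarrow> whp_approx M (Wstar c0) (\<lambda>n. c1\<^sup>2 * real n / (4 * c0 n))) \<and>
     (\<forall>\<alpha>>1/2. whp_approx M (Wstar (\<lambda>n. \<alpha> * real n)) (\<lambda>n. zeta3)) \<and>
     (\<forall>\<alpha>. 0 < \<alpha> \<and> \<alpha> \<le> 1/2 \<longrightarrow>
        (\<exists>!\<beta>. f_deriv \<beta> (2 * \<alpha>)) \<and>
        (\<forall>\<beta>. f_deriv \<beta> (2 * \<alpha>) \<longrightarrow>
           whp_approx M (Wstar (\<lambda>n. \<alpha> * real n)) (\<lambda>n. f \<beta> - 2 * \<alpha> * \<beta>))) \<and>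
     (\<forall>\<alpha>. 0 < \<alpha> \<and> \<alpha> < zeta3 \<longrightarrow>
        whp M (\<lambda>n \<omega>. \<nexists>T. T \<in> spanning_trees n \<and> (\<Sum>e\<in>T. C n e \<omega>) \<le> \<alpha>)) \<and>
     (\<forall>\<alpha>>zeta3.
        (\<exists>!\<beta>. \<exists>d. f_deriv \<beta> d \<and> f \<beta> - \<beta> * d = \<alpha>) \<and>
        (\<forall>\<beta>. (\<exists>d. f_deriv \<beta> d \<and> f \<beta> - \<beta> * d = \<alpha>) \<longrightarrow>
           whp_approx M (Wstar (\<lambda>n. \<alpha>)) (\<lambda>n. (f \<beta> - \<alpha>) / (2 * \<beta>) * real n)))"
proof -
  note M = assms(2)
  have rv: "W n e \<in> borel_measurable (M n)" "C n e \<in> borel_measurable (M n)" if "e \<in> complete_edges n" for n e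
  proof -
    interpret prob_space "M n" by (rule M)
    show "W n e \<in> borel_measurable (M n)" "C n e \<in> borel_measurable (M n)"
      using indep_edge_lengths(2)[OF assms(3)[of n] that] by (auto dest: indep_var_rv1 indep_var_rv2)
  qed
  have Y: "Wstar c0 n \<in> borel_measurable (M n)" for c0 n
    unfolding Wstar_def by (rule min_weight_measurable) (use rv in auto)
  interpret WC: uniform_lengths M W C
  proof (rule uniform_lengths.intro)
    fix n :: nat and l :: real
    interpret prob_space "M n" by (rule M)
    show "indep_vars (\<lambda>_. borel) (\<lambda>e \<omega>. W n e \<omega> + l * C n e \<omega>) (complete_edges n)"
      using indep_edge_lengths(1)[OF assms(3)[of n], of 1 l] by simp
    show "indep_var borel (W n e) borel (C n e)" if "e \<in> complete_edges n" for e
      using indep_edge_lengths(2)[OF assms(3)[of n] that] .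
  qed (fact M assms(4,5))+
  interpret CW: uniform_lengths M C W
  proof (rule uniform_lengths.intro)
    fix n :: nat and l :: real
    interpret prob_space "M n" by (rule M)
    show "indep_vars (\<lambda>_. borel) (\<lambda>e \<omega>. C n e \<omega> + l * W n e \<omega>) (complete_edges n)"
      using indep_edge_lengths(1)[OF assms(3)[of n], of l 1] by (simp add: add.commute)
    show "indep_var borel (C n e) borel (W n e)" if "e \<in> complete_edges n" for e
      using indep_edge_lengths(3)[OF assms(3)[of n] that] .
  qed (fact M assms(4,5))+

  have case1: "whp_approx M (Wstar c0) (\<lambda>n. c1\<^sup>2 * real n / (4 * c0 n))"
    if c0: "\<forall>\<^sub>F n in sequentially. c0 n \<in> {c1 * sqrt (500 * ln (real n)) .. c1 * real n / sqrt (8000 * ln (real n))}" for c0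
  proof -
    \<comment> \<open>Weights are measured in units of the claimed value \<open>Q n\<close> and
      costs in units of \<open>c0 n\<close>, so the multiplier \<beta> stands for
      \<open>l \<beta> n = \<beta> * Q n / c0 n\<close>. Then c1 sqrt (l n) is exactly 2 sqrt
      \<beta> times \<open>Q n\<close>.\<close>
    define Q where "Q n = c1\<^sup>2 * real n / (4 * c0 n)" for n
    define l where "l \<beta> n = \<beta> * (c1\<^sup>2 * real n / (4 * (c0 n)\<^sup>2))" for \<beta> n
    have ev: "\<forall>\<^sub>F n in sequentially. 0 < c0 n \<and> 0 < real n \<and> 0 < ln (real n) \<and>
        c1\<^sup>2 * (500 * ln (real n)) \<le> (c0 n)\<^sup>2 \<and> (c0 n)\<^sup>2 * (8000 * ln (real n)) \<le> c1\<^sup>2 * (real n)\<^sup>2"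
      using c0 eventually_gt_at_top[of 1]
    proof eventually_elim
      case (elim n)
      have ln0: "0 < ln (real n)" using elim(2) by simp
      have lo: "c1 * sqrt (500 * ln (real n)) \<le> c0 n" and hi: "c0 n \<le> c1 * real n / sqrt (8000 * ln (real n))"
        using elim(1) by auto
      have "0 < c1 * sqrt (500 * ln (real n))" using ln0 c1_pos by simp
      hence pos: "0 < c0 n" using lo by linarith
      have "(c1 * sqrt (500 * ln (real n)))\<^sup>2 \<le> (c0 n)\<^sup>2" using lo ln0 c1_pos by (intro power_mono) auto
      moreover have "(c0 n * sqrt (8000 * ln (real n)))\<^sup>2 \<le> (c1 * real n)\<^sup>2"
        using hi ln0 pos by (intro power_mono) (auto simp: pos_le_divide_eq)
      ultimately show ?case using pos ln0 elim(2) by (simp add: power_mult_distrib)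
    qed
    have "whp_approx M (Wstar c0) (\<lambda>n. c1\<^sup>2 * real n / (4 * c0 n))"
    proof (rule whp_approxI[OF M Y, where a = Q and L = 1])
      show "\<forall>\<^sub>F n in sequentially. 0 < Q n \<and> c1\<^sup>2 * real n / (4 * c0 n) = Q n * 1"
        using ev by eventually_elim (use c1_pos in \<open>auto simp: Q_def\<close>)
      fix \<epsilon> :: real assume \<epsilon>: "0 < \<epsilon>"
      have "aas M (\<lambda>n \<omega>. \<exists>x. min_weight n (\<lambda>e. W n e \<omega>) (\<lambda>e. C n e \<omega>) (1 * c0 n) = ereal x \<and>
          \<bar>x / Q n - (2 * sqrt 1 - 1 * 1)\<bar> < \<epsilon>)"
      proof (rule lagrange_limit[OF M, where \<phi> = "\<lambda>x. 2 * sqrt x" and \<phi>' = "\<lambda>x. 1 / sqrt x"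
            and \<rho> = 1 and \<gamma> = 1 and a = Q and d = c0])
        fix \<beta> \<epsilon> :: real assume \<beta>: "1 \<le> \<beta>" "\<beta> \<le> 1 + 1" and \<epsilon>: "0 < \<epsilon>"
        have "aas M (\<lambda>n \<omega>. \<exists>m. is_mst_value n (\<lambda>e. W n e \<omega> + l \<beta> n * C n e \<omega>) m \<and>
            \<bar>m / (real n * sqrt (l \<beta> n / real n)) - c1\<bar> < \<epsilon> * c1 / (2 * sqrt \<beta>))"
        proof (rule WC.mst_limit_c1)
          show "0 \<le> l \<beta> n" for n using \<beta> by (simp add: l_def)
          show "0 < \<epsilon> * c1 / (2 * sqrt \<beta>)" using \<epsilon> c1_pos \<beta> by simp
          show "\<forall>\<^sub>F n in sequentially. 24 * ln (real n) \<le> l \<beta> n * real n \<and> l \<beta> n * (24 * ln (real n)) \<le> real n"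
            using ev
          proof eventually_elim
            case (elim n)
            \<comment> \<open>The upper end of the range for \<open>c0\<close> gives
              \<open>l \<beta> n * real n\<close> at least 8000/4 = 2000 times the logarithm; the
              lower end gives \<open>l \<beta> n * (24 * ln (real n))\<close> at most 6 \<beta> n /
              500, where \<beta> is at most 2.\<close>
            define D where "D = (c0 n)\<^sup>2"
            have D: "0 < D" "c1\<^sup>2 * (500 * ln (real n)) \<le> D" "D * (8000 * ln (real n)) \<le> c1\<^sup>2 * (real n)\<^sup>2"
              using elim by (auto simp: D_def)
            have "2000 * ln (real n) \<le> c1\<^sup>2 * (real n)\<^sup>2 / (4 * D)" using D by (simp add: field_simps)
            also have "\<dots> \<le> \<beta> * (c1\<^sup>2 * (real n)\<^sup>2 / (4 * D))"
              using \<beta> D mult_right_mono[of 1 \<beta> "c1\<^sup>2 * (real n)\<^sup>2 / (4 * D)"] by simp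
            also have "\<dots> = l \<beta> n * real n" by (simp add: l_def D_def power2_eq_square)
            finally have 1: "24 * ln (real n) \<le> l \<beta> n * real n" using elim by linarith
            have "c1\<^sup>2 * ln (real n) / D \<le> 1 / 500" using D by (simp add: field_simps)
            hence "(6 * \<beta> * real n) * (c1\<^sup>2 * ln (real n) / D) \<le> (6 * \<beta> * real n) * (1 / 500)"
              using \<beta> by (intro mult_left_mono) auto
            also have "(6 * \<beta> * real n) * (c1\<^sup>2 * ln (real n) / D) = l \<beta> n * (24 * ln (real n))"
              by (simp add: l_def D_def)
            also have "(6 * \<beta> * real n) * (1 / 500) \<le> real n"
              using \<beta> mult_right_mono[of \<beta> 2 "real n"] by simp
            finally show ?case using 1 by simp
          qed
        qed
        thus "aas M (\<lambda>n \<omega>. \<exists>m. is_mst_value n (\<lambda>e. W n e \<omega> / Q n + \<beta> * (C n e \<omega> / c0 n)) m \<and> \<bar>m - 2 * sqrt \<beta>\<bar> < \<epsilon>)"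
        proof (rule aas_mono[OF M])
          show "\<forall>\<^sub>F n in sequentially. \<forall>\<omega>\<in>space (M n).
            (\<exists>m. is_mst_value n (\<lambda>e. W n e \<omega> + l \<beta> n * C n e \<omega>) m \<and>
               \<bar>m / (real n * sqrt (l \<beta> n / real n)) - c1\<bar> < \<epsilon> * c1 / (2 * sqrt \<beta>)) \<longrightarrow>
            (\<exists>m. is_mst_value n (\<lambda>e. W n e \<omega> / Q n + \<beta> * (C n e \<omega> / c0 n)) m \<and> \<bar>m - 2 * sqrt \<beta>\<bar> < \<epsilon>)"
            using ev
          proof eventually_elim
            case (elim n)
            have Q: "0 < Q n" using elim c1_pos by (simp add: Q_def)
            have "l \<beta> n / real n = \<beta> * (c1 / (2 * c0 n))\<^sup>2" using elim by (simp add: l_def power_divide power_mult_distrib)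
            hence "sqrt (l \<beta> n / real n) = sqrt \<beta> * (c1 / (2 * c0 n))"
              using elim c1_pos by (simp add: real_sqrt_mult)
            hence nb: "real n * sqrt (l \<beta> n / real n) = Q n * (2 * sqrt \<beta> / c1)"
              using elim c1_pos by (simp add: Q_def power2_eq_square)
            have lQ: "l \<beta> n / Q n = \<beta> / c0 n" using elim c1_pos by (simp add: l_def Q_def power2_eq_square)
            show ?case
            proof (intro ballI impI)
              fix \<omega> assume "\<exists>m. is_mst_value n (\<lambda>e. W n e \<omega> + l \<beta> n * C n e \<omega>) m \<and>
               \<bar>m / (real n * sqrt (l \<beta> n / real n)) - c1\<bar> < \<epsilon> * c1 / (2 * sqrt \<beta>)"
              then obtain m where m: "is_mst_value n (\<lambda>e. W n e \<omega> + l \<beta> n * C n e \<omega>) m"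
                "\<bar>m / (Q n * (2 * sqrt \<beta> / c1)) - c1\<bar> < \<epsilon> * c1 / (2 * sqrt \<beta>)" unfolding nb by blast
              have "is_mst_value n (\<lambda>e. 1 / Q n * (W n e \<omega> + l \<beta> n * C n e \<omega>)) (1 / Q n * m)"
                by (rule is_mst_value_scale[OF _ m(1)]) (use Q in simp)
              moreover have "1 / Q n * (W n e \<omega> + l \<beta> n * C n e \<omega>) = W n e \<omega> / Q n + \<beta> * (C n e \<omega> / c0 n)" for e
              proof -
                have "1 / Q n * (W n e \<omega> + l \<beta> n * C n e \<omega>) = W n e \<omega> / Q n + (l \<beta> n / Q n) * C n e \<omega>"
                  by (simp add: field_simps add_divide_distrib)
                thus ?thesis unfolding lQ by simp
              qed
              ultimately have "is_mst_value n (\<lambda>e. W n e \<omega> / Q n + \<beta> * (C n e \<omega> / c0 n)) (m / Q n)" by simp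
              moreover have "\<bar>m / Q n - 2 * sqrt \<beta>\<bar> < \<epsilon>"
              proof -
                have s: "0 < 2 * sqrt \<beta> / c1" using \<beta> c1_pos by simp
                have "m / Q n - 2 * sqrt \<beta> = (2 * sqrt \<beta> / c1) * (m / (Q n * (2 * sqrt \<beta> / c1)) - c1)"
                  using \<beta> c1_pos Q by (simp add: field_simps)
                hence "\<bar>m / Q n - 2 * sqrt \<beta>\<bar> = (2 * sqrt \<beta> / c1) * \<bar>m / (Q n * (2 * sqrt \<beta> / c1)) - c1\<bar>"
                  using s by (simp only: abs_mult abs_of_pos)
                also have "\<dots> < (2 * sqrt \<beta> / c1) * (\<epsilon> * c1 / (2 * sqrt \<beta>))"
                  by (rule mult_strict_left_mono[OF m(2) s])
                also have "\<dots> = \<epsilon>" using \<beta> c1_pos by simp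
                finally show ?thesis .
              qed
              ultimately show "\<exists>m. is_mst_value n (\<lambda>e. W n e \<omega> / Q n + \<beta> * (C n e \<omega> / c0 n)) m \<and> \<bar>m - 2 * sqrt \<beta>\<bar> < \<epsilon>"
                by blast
            qed
          qed
        qed
      next
        fix \<beta> :: real assume "1 < \<beta>"
        thus "((\<lambda>x. 2 * sqrt x) has_real_derivative 1 / sqrt \<beta>) (at \<beta>)" by (intro two_sqrt_deriv) simp
      next
        fix x y :: real assume "1 \<le> x" "x < y"
        thus "1 / sqrt y < 1 / sqrt x" by (simp add: frac_less2)
      next
        show "((\<lambda>x. 2 * sqrt x) \<longlongrightarrow> 2 * sqrt 1) (at_right 1)" by (intro tendsto_intros)
        show "((\<lambda>x. 1 / sqrt x) \<longlongrightarrow> 1 / sqrt 1) (at_right 1)" by (intro tendsto_intros) simp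
        show "\<forall>\<^sub>F n in sequentially. 0 < Q n \<and> 0 < c0 n"
          using ev by eventually_elim (use c1_pos in \<open>auto simp: Q_def\<close>)
      qed (use \<epsilon> in auto)
      thus "aas M (\<lambda>n \<omega>. \<exists>x. Wstar c0 n \<omega> = ereal x \<and> \<bar>x / Q n - 1\<bar> < \<epsilon>)" by (simp add: Wstar_def)
    qed simp
    thus ?thesis .
  qed

  \<comment> \<open>Costs are measured in units of n/2, so the multiplier 2 \<beta> / n becomes
    \<beta> and the bound \<alpha> n becomes 2 \<alpha>. The boundary optimum 0 gives the
    unconstrained value, a stationary point the other case.\<close>
  have case2: "whp_approx M (Wstar (\<lambda>n. \<alpha> * real n)) (\<lambda>n. f \<beta>0 - 2 * \<alpha> * \<beta>0)"
    if \<beta>0: "0 \<le> \<beta>0" and \<alpha>: "gfun \<beta>0 \<le> 2 * \<alpha>" "\<beta>0 = 0 \<or> gfun \<beta>0 = 2 * \<alpha>" for \<alpha> \<beta>0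
  proof (rule whp_approxI[OF M Y, where a = "\<lambda>_. 1" and L = "f \<beta>0 - 2 * \<alpha> * \<beta>0"])
    \<comment> \<open>A relative error needs a positive limit; here it is at least
      \<open>hfun 0 = zeta3\<close>.\<close>
    have "f \<beta>0 - 2 * \<alpha> * \<beta>0 = hfun \<beta>0" using \<alpha>(2) by (auto simp: hfun_def)
    also have "0 < hfun \<beta>0" using hfun_strict_mono[of 0 \<beta>0] \<beta>0 zeta3_pos by (cases "\<beta>0 = 0") (auto simp: hfun_0)
    finally show "0 < f \<beta>0 - 2 * \<alpha> * \<beta>0" .
    fix \<epsilon> :: real assume \<epsilon>: "0 < \<epsilon>"
    have "aas M (\<lambda>n \<omega>. \<exists>x. min_weight n (\<lambda>e. W n e \<omega>) (\<lambda>e. C n e \<omega>) (2 * \<alpha> * (real n / 2)) = ereal x \<and>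
        \<bar>x / 1 - (f \<beta>0 - \<beta>0 * (2 * \<alpha>))\<bar> < \<epsilon>)"
    proof (rule lagrange_limit[OF M, where \<phi> = f and \<phi>' = gfun and \<rho> = \<beta>0 and \<gamma> = "2 * \<alpha>"
          and a = "\<lambda>_. 1" and d = "\<lambda>n. real n / 2"])
      fix \<beta> \<epsilon> :: real assume "\<beta>0 \<le> \<beta>" "0 < \<epsilon>"
      hence "aas M (\<lambda>n \<omega>. \<exists>m. is_mst_value n (\<lambda>e. W n e \<omega> + 2 * \<beta> / real n * C n e \<omega>) m \<and> \<bar>m - f \<beta>\<bar> < \<epsilon>)"
        using \<beta>0 by (intro WC.mst_limit_f) auto
      moreover have "W n e \<omega> + 2 * \<beta> / real n * C n e \<omega> = W n e \<omega> / 1 + \<beta> * (C n e \<omega> / (real n / 2))" for n e \<omega>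
        by simp
      ultimately show "aas M (\<lambda>n \<omega>. \<exists>m. is_mst_value n (\<lambda>e. W n e \<omega> / 1 + \<beta> * (C n e \<omega> / (real n / 2))) m \<and> \<bar>m - f \<beta>\<bar> < \<epsilon>)"
        by (simp only:)
    next
      fix \<beta> assume "\<beta>0 < \<beta>"
      thus "(f has_real_derivative gfun \<beta>) (at \<beta>)"
        using f_has_deriv[of \<beta>] at_within_interior[of \<beta> "{0..}"] \<beta>0 by (simp add: interior_Ici[of "-1"])
    next
      show "\<forall>\<^sub>F n in sequentially. 0 < (1::real) \<and> 0 < real n / 2"
        using eventually_gt_at_top[of 0] by eventually_elim simp
    qed (use \<beta>0 \<alpha> \<epsilon> gfun_strict_antimono tendsto_at_right_Ici[OF continuous_on_f]
        tendsto_at_right_Ici[OF continuous_on_gfun] in auto)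
    thus "aas M (\<lambda>n \<omega>. \<exists>x. Wstar (\<lambda>n. \<alpha> * real n) n \<omega> = ereal x \<and> \<bar>x / 1 - (f \<beta>0 - 2 * \<alpha> * \<beta>0)\<bar> < \<epsilon>)"
      by (simp add: Wstar_def mult_ac)
  qed simp

  have case3i: "whp M (\<lambda>n \<omega>. \<nexists>T. T \<in> spanning_trees n \<and> (\<Sum>e\<in>T. C n e \<omega>) \<le> \<alpha>)"
    if \<alpha>: "\<alpha> < zeta3" for \<alpha>
  proof (rule aas_imp_whp[OF M])
    \<comment> \<open>In the exchanged model the multiplier 0 leaves the costs alone, whose minimum
      over spanning trees is close to \<open>f 0 = zeta3\<close>.\<close>
    have "aas M (\<lambda>n \<omega>. \<exists>m. is_mst_value n (\<lambda>e. C n e \<omega> + 2 * 0 / real n * W n e \<omega>) m \<and> \<bar>m - f 0\<bar> < zeta3 - \<alpha>)"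
      by (rule CW.mst_limit_f) (use \<alpha> in auto)
    thus "aas M (\<lambda>n \<omega>. \<nexists>T. T \<in> spanning_trees n \<and> (\<Sum>e\<in>T. C n e \<omega>) \<le> \<alpha>)"
    proof (rule aas_mono[OF M], intro always_eventually allI ballI impI notI)
      fix n \<omega>
      assume "\<exists>m. is_mst_value n (\<lambda>e. C n e \<omega> + 2 * 0 / real n * W n e \<omega>) m \<and> \<bar>m - f 0\<bar> < zeta3 - \<alpha>"
        and "\<exists>T. T \<in> spanning_trees n \<and> (\<Sum>e\<in>T. C n e \<omega>) \<le> \<alpha>"
      then obtain m T where "is_mst_value n (\<lambda>e. C n e \<omega>) m" "\<bar>m - zeta3\<bar> < zeta3 - \<alpha>"
        "T \<in> spanning_trees n" "(\<Sum>e\<in>T. C n e \<omega>) \<le> \<alpha>" by (auto simp: f_0)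
      moreover from this have "m \<le> (\<Sum>e\<in>T. C n e \<omega>)" by (auto simp: is_mst_value_def)
      ultimately show False by linarith
    qed
    show "\<forall>\<^sub>F n in sequentially. {\<omega> \<in> space (M n). \<nexists>T. T \<in> spanning_trees n \<and> (\<Sum>e\<in>T. C n e \<omega>) \<le> \<alpha>} \<in> sets (M n)"
    proof (intro always_eventually allI)
      fix n
      have "{\<omega> \<in> space (M n). \<forall>T\<in>spanning_trees n. \<alpha> < (\<Sum>e\<in>T. C n e \<omega>)} \<in> sets (M n)"
      proof (rule sets.sets_Collect_finite_All)
        fix T assume "T \<in> spanning_trees n"
        hence "T \<subseteq> complete_edges n" by (simp add: spanning_trees_def)
        hence [measurable]: "(\<lambda>\<omega>. \<Sum>e\<in>T. C n e \<omega>) \<in> borel_measurable (M n)"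
          using rv(2) by (auto intro!: borel_measurable_sum)
        show "{\<omega> \<in> space (M n). \<alpha> < (\<Sum>e\<in>T. C n e \<omega>)} \<in> sets (M n)" by measurable
      qed (rule finite_spanning_trees)
      also have "{\<omega> \<in> space (M n). \<forall>T\<in>spanning_trees n. \<alpha> < (\<Sum>e\<in>T. C n e \<omega>)} =
          {\<omega> \<in> space (M n). \<nexists>T. T \<in> spanning_trees n \<and> (\<Sum>e\<in>T. C n e \<omega>) \<le> \<alpha>}"
        by (auto simp: not_le)
      finally show "{\<omega> \<in> space (M n). \<nexists>T. T \<in> spanning_trees n \<and> (\<Sum>e\<in>T. C n e \<omega>) \<le> \<alpha>} \<in> sets (M n)" .
    qed
  qed

  have case3ii: "whp_approx M (Wstar (\<lambda>n. \<alpha>)) (\<lambda>n. (f \<beta>0 - \<alpha>) / (2 * \<beta>0) * real n)"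
    if \<beta>0: "0 \<le> \<beta>0" and \<alpha>: "zeta3 < \<alpha>" "hfun \<beta>0 = \<alpha>" for \<alpha> \<beta>0
  proof -
    \<comment> \<open>The value \<open>hfun 0 = zeta3\<close> is excluded, so the division by
      \<open>2 * \<beta>0\<close> in the claim is genuine.\<close>
    have b0: "0 < \<beta>0" using \<beta>0 \<alpha> hfun_0 by (cases "\<beta>0 = 0") auto
    \<comment> \<open>With weights in units of n/2, the length for multiplier g is g times the
      exchanged length C + (2/(g n)) W, whose limit is f(1/g). Stationarity of g f(1/g) - g \<alpha>
      reads \<open>hfun (1 / g) = \<alpha>\<close>, so the optimum is the reciprocal of
      \<open>\<beta>0\<close>, and the dual value there is \<open>gfun \<beta>0\<close>.\<close>
    define g0 where "g0 = 1 / \<beta>0"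
    have g0: "0 < g0" "1 / g0 = \<beta>0" using b0 by (auto simp: g0_def)
    have L: "g0 * f (1 / g0) - g0 * \<alpha> = gfun \<beta>0"
      using b0 \<alpha>(2) by (simp add: g0_def hfun_def field_simps)
    have "whp_approx M (Wstar (\<lambda>n. \<alpha>)) (\<lambda>n. (f \<beta>0 - \<alpha>) / (2 * \<beta>0) * real n)"
    proof (rule whp_approxI[OF M Y, where a = "\<lambda>n. real n / 2" and L = "gfun \<beta>0"])
      show "0 < gfun \<beta>0" using gfun_pos[OF \<beta>0] .
      have "(f \<beta>0 - \<alpha>) / (2 * \<beta>0) * real n = real n / 2 * gfun \<beta>0" for n
        using b0 by (simp add: L[symmetric] g0_def field_simps)
      thus "\<forall>\<^sub>F n in sequentially. 0 < real n / 2 \<and> (f \<beta>0 - \<alpha>) / (2 * \<beta>0) * real n = real n / 2 * gfun \<beta>0"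
        using eventually_gt_at_top[of 0] by (auto elim: eventually_mono)
      fix \<epsilon> :: real assume \<epsilon>: "0 < \<epsilon>"
      have "aas M (\<lambda>n \<omega>. \<exists>x. min_weight n (\<lambda>e. W n e \<omega>) (\<lambda>e. C n e \<omega>) (\<alpha> * 1) = ereal x \<and>
          \<bar>x / (real n / 2) - (g0 * f (1 / g0) - g0 * \<alpha>)\<bar> < \<epsilon>)"
      proof (rule lagrange_limit[OF M, where \<phi> = "\<lambda>g. g * f (1 / g)" and \<phi>' = "\<lambda>g. hfun (1 / g)"
            and \<rho> = g0 and \<gamma> = \<alpha> and a = "\<lambda>n. real n / 2" and d = "\<lambda>_. 1"])
        fix g \<epsilon> :: real assume g: "g0 \<le> g" and \<epsilon>: "0 < \<epsilon>"
        have gp: "0 < g" using g g0 by linarith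
        have "aas M (\<lambda>n \<omega>. \<exists>m. is_mst_value n (\<lambda>e. C n e \<omega> + 2 * (1 / g) / real n * W n e \<omega>) m \<and> \<bar>m - f (1 / g)\<bar> < \<epsilon> / g)"
          by (rule CW.mst_limit_f) (use gp \<epsilon> in auto)
        thus "aas M (\<lambda>n \<omega>. \<exists>m. is_mst_value n (\<lambda>e. W n e \<omega> / (real n / 2) + g * (C n e \<omega> / 1)) m \<and> \<bar>m - g * f (1 / g)\<bar> < \<epsilon>)"
        proof (rule aas_mono[OF M], intro always_eventually allI ballI impI)
          fix n \<omega>
          assume "\<exists>m. is_mst_value n (\<lambda>e. C n e \<omega> + 2 * (1 / g) / real n * W n e \<omega>) m \<and> \<bar>m - f (1 / g)\<bar> < \<epsilon> / g"
          then obtain m where m: "is_mst_value n (\<lambda>e. C n e \<omega> + 2 * (1 / g) / real n * W n e \<omega>) m" "\<bar>m - f (1 / g)\<bar> < \<epsilon> / g"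
            by blast
          have "is_mst_value n (\<lambda>e. g * (C n e \<omega> + 2 * (1 / g) / real n * W n e \<omega>)) (g * m)"
            by (rule is_mst_value_scale[OF gp m(1)])
          moreover have "g * (C n e \<omega> + 2 * (1 / g) / real n * W n e \<omega>) = W n e \<omega> / (real n / 2) + g * (C n e \<omega> / 1)" for e
            using gp by (simp add: distrib_left)
          moreover have "\<bar>g * m - g * f (1 / g)\<bar> < \<epsilon>"
          proof -
            have "\<bar>g * m - g * f (1 / g)\<bar> = g * \<bar>m - f (1 / g)\<bar>"
              using gp by (simp add: abs_mult flip: right_diff_distrib)
            also have "\<dots> < g * (\<epsilon> / g)" by (rule mult_strict_left_mono[OF m(2) gp])
            finally show ?thesis using gp by simp
          qed
          ultimately show "\<exists>m. is_mst_value n (\<lambda>e. W n e \<omega> / (real n / 2) + g * (C n e \<omega> / 1)) m \<and> \<bar>m - g * f (1 / g)\<bar> < \<epsilon>"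
            by auto
        qed
      next
        fix g assume "g0 < g"
        thus "((\<lambda>g. g * f (1 / g)) has_real_derivative hfun (1 / g)) (at g)"
          using g0 by (intro perspective_deriv) simp
      next
        fix x y assume "g0 \<le> x" "x < y"
        thus "hfun (1 / y) < hfun (1 / x)" using g0 by (intro hfun_strict_mono) (auto simp: frac_less2)
      next
        have "isCont (\<lambda>g. g * f (1 / g)) g0" using DERIV_isCont[OF perspective_deriv[OF g0(1)]] .
        thus "((\<lambda>g. g * f (1 / g)) \<longlongrightarrow> g0 * f (1 / g0)) (at_right g0)"
          unfolding isCont_def by (rule tendsto_within_subset) simp
        have "isCont (\<lambda>g. 1 / g) g0" using g0 by (intro continuous_intros) auto
        moreover have "isCont hfun (1 / g0)"
          using continuous_on_interior[OF continuous_on_hfun, of "1 / g0"] g0(1) by (simp add: interior_Ici[of "-1"])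
        ultimately have "isCont (\<lambda>g. hfun (1 / g)) g0" by (rule isCont_o2)
        thus "((\<lambda>g. hfun (1 / g)) \<longlongrightarrow> hfun (1 / g0)) (at_right g0)"
          unfolding isCont_def by (rule tendsto_within_subset) simp
      next
        show "\<forall>\<^sub>F n in sequentially. 0 < real n / 2 \<and> 0 < (1::real)"
          using eventually_gt_at_top[of 0] by eventually_elim simp
      qed (use g0 \<alpha> \<epsilon> in auto)
      thus "aas M (\<lambda>n \<omega>. \<exists>x. Wstar (\<lambda>n. \<alpha>) n \<omega> = ereal x \<and> \<bar>x / (real n / 2) - gfun \<beta>0\<bar> < \<epsilon>)"
        unfolding L by (simp add: Wstar_def)
    qed
    thus ?thesis .
  qed

  have case2i: "whp_approx M (Wstar (\<lambda>n. \<alpha> * real n)) (\<lambda>n. zeta3)" if "1/2 < \<alpha>" for \<alpha>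
    using case2[of 0 \<alpha>] that by (simp add: f_0 gfun_0)
  have case2ii: "(\<exists>!\<beta>. f_deriv \<beta> (2 * \<alpha>)) \<and>
        (\<forall>\<beta>. f_deriv \<beta> (2 * \<alpha>) \<longrightarrow> whp_approx M (Wstar (\<lambda>n. \<alpha> * real n)) (\<lambda>n. f \<beta> - 2 * \<alpha> * \<beta>))"
    if "0 < \<alpha>" "\<alpha> \<le> 1/2" for \<alpha>
    using ex1_gfun[of "2 * \<alpha>"] case2[of _ \<alpha>] that unfolding f_deriv_iff by (auto simp: eq_commute)
  have case3: "(\<exists>!\<beta>. \<exists>d. f_deriv \<beta> d \<and> f \<beta> - \<beta> * d = \<alpha>) \<and>
        (\<forall>\<beta>. (\<exists>d. f_deriv \<beta> d \<and> f \<beta> - \<beta> * d = \<alpha>) \<longrightarrow>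
           whp_approx M (Wstar (\<lambda>n. \<alpha>)) (\<lambda>n. (f \<beta> - \<alpha>) / (2 * \<beta>) * real n))" if "zeta3 < \<alpha>" for \<alpha>
  proof -
    have "(\<exists>d. f_deriv \<beta> d \<and> f \<beta> - \<beta> * d = \<alpha>) \<longleftrightarrow> 0 \<le> \<beta> \<and> hfun \<beta> = \<alpha>" for \<beta>
      by (auto simp: f_deriv_iff hfun_def)
    thus ?thesis using ex1_hfun[OF that] case3ii[of _ \<alpha>] that by simp
  qed
  show ?thesis
    by (rule conjI[OF _ conjI[OF _ conjI[OF _ conjI]]]; intro allI impI)
      (erule case1, erule case2i, elim conjE, erule (1) case2ii, elim conjE, erule (0) case3i, erule case3)
qed

end
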